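(* Let $1\leq p\leq2$ and $q$ with $1/p+1/q=1$ (so $q=\infty$ when $p=1$). Let $g\in L^2(\mathbb{R})$ be such that $G(g)=\{e^{2\pi i n t}g(t-m)\}_{(m,n)\in\mathbb{Z}^2}$ is a Riesz basis of $L^2(\mathbb{R})$ with Riesz basis bounds $A,B$. Then there is a constant $C>0$ depending only on $A$, $B$ (and $p$) such that for all $R,L\geq1$, $$\frac{C}{(RL)^{p/q}}<\sum_{k\in\mathbb{Z},\,|k|>R}\|g\|_{L^q(k,k+1)}^p+\sum_{k\in\mathbb{Z},\,|k|>L}\|\hat g\|_{L^q(k,k+1)}^p.$$
   Context: The Fourier transform is $\hat g(\xi)=\int g(t)e^{-2\pi i\xi t}dt$, extended to $L^2(\mathbb{R})$. A system $\{f_n\}$ in a Hilbert space $H$ is a Riesz basis if it is complete and there are constants $0<A\le B$ with $A\sum|a_n|^2\le\|\sum a_nf_n\|^2\le B\sum|a_n|^2$ for all $\{a_n\}\in\ell^2$; the largest such $A$ and smallest such $B$ are the Riesz basis bounds. *)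

theory Defs
  imports "HOL-Analysis.Analysis" "HOL-Probability.Essential_Supremum"
begin

definition L2 :: "(real \<Rightarrow> complex) \<Rightarrow> bool" where
  "L2 f \<longleftrightarrow> f \<in> borel_measurable lebesgue \<and> integrable lebesgue (\<lambda>t. (norm (f t))\<^sup>2)"

definition L2_norm_sq :: "(real \<Rightarrow> complex) \<Rightarrow> ennreal" where
  "L2_norm_sq f = (\<integral>\<^sup>+ t. ennreal ((norm (f t))\<^sup>2) \<partial>lebesgue)"

definition is_fourier_L2 :: "(real \<Rightarrow> complex) \<Rightarrow> (real \<Rightarrow> complex) \<Rightarrow> bool" where
  "is_fourier_L2 g gh \<longleftrightarrow> L2 gh \<and>
     ((\<lambda>N::nat. L2_norm_sq (\<lambda>\<xi>. gh \<xi> -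
        (LINT t:{- real N..real N}|lebesgue. g t * exp (- 2 * pi * \<i> * complex_of_real (\<xi> * t)))))
      \<longlongrightarrow> 0) sequentially"

definition gabor :: "(real \<Rightarrow> complex) \<Rightarrow> int \<times> int \<Rightarrow> real \<Rightarrow> complex" where
  "gabor g = (\<lambda>(m, n) t. exp (2 * pi * \<i> * complex_of_real (real_of_int n * t)) * g (t - real_of_int m))"

definition riesz_lower :: "('i \<Rightarrow> real \<Rightarrow> complex) \<Rightarrow> real \<Rightarrow> bool" where
  "riesz_lower f A \<longleftrightarrow> (\<forall>S a. finite S \<longrightarrow>
     ennreal A * ennreal (\<Sum>i\<in>S. (cmod (a i))\<^sup>2) \<le> L2_norm_sq (\<lambda>t. \<Sum>i\<in>S. a i * f i t))"

definition riesz_upper :: "('i \<Rightarrow> real \<Rightarrow> complex) \<Rightarrow> real \<Rightarrow> bool" where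
  "riesz_upper f B \<longleftrightarrow> (\<forall>S a. finite S \<longrightarrow>
     L2_norm_sq (\<lambda>t. \<Sum>i\<in>S. a i * f i t) \<le> ennreal B * ennreal (\<Sum>i\<in>S. (cmod (a i))\<^sup>2))"

definition complete_L2 :: "('i \<Rightarrow> real \<Rightarrow> complex) \<Rightarrow> bool" where
  "complete_L2 f \<longleftrightarrow> (\<forall>i. L2 (f i)) \<and> (\<forall>h e. L2 h \<longrightarrow> e > 0 \<longrightarrow>
     (\<exists>S a. finite S \<and> L2_norm_sq (\<lambda>t. h t - (\<Sum>i\<in>S. a i * f i t)) < ennreal e))"

definition riesz_basis_bounds :: "('i \<Rightarrow> real \<Rightarrow> complex) \<Rightarrow> real \<Rightarrow> real \<Rightarrow> bool" where
  "riesz_basis_bounds f A B \<longleftrightarrow> complete_L2 f \<and> 0 < A \<and> A \<le> B \<and>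
     riesz_lower f A \<and> riesz_upper f B \<and>
     (\<forall>A'. riesz_lower f A' \<longrightarrow> A' \<le> A) \<and> (\<forall>B'. riesz_upper f B' \<longrightarrow> B \<le> B')"

text \<open>x ^ a for x in [0,\<infinity>], a > 0 (with \<infinity> ^ a = \<infinity>).\<close>
definition enn_powr :: "ennreal \<Rightarrow> real \<Rightarrow> ennreal" where
  "enn_powr x a = (if x = \<infinity> then \<infinity> else ennreal (enn2real x powr a))"

text \<open>The quantity \<parallel>f\<parallel>_{L^q(k,k+1)}^p where 1/p + 1/q = 1, 1 \<le> p
  (q = \<infinity> when p = 1, q = p/(p-1) otherwise).\<close>
definition Lq_pow_p :: "real \<Rightarrow> (real \<Rightarrow> complex) \<Rightarrow> int \<Rightarrow> ennreal" where
  "Lq_pow_p p f k =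
    (if p = 1 then esssup (restrict_space lebesgue {real_of_int k..real_of_int k + 1})
                     (\<lambda>t. ennreal (norm (f t)))
     else (let q = p / (p - 1) in
       enn_powr (\<integral>\<^sup>+ t. indicator {real_of_int k..real_of_int k + 1} t * ennreal (norm (f t) powr q) \<partial>lebesgue)
                (p / q)))"

end

theory Submission
  imports Defs "HOL-Probability.Probability"
begin

text \<open>Let G be the Zak transform of g. The Riesz bounds say that A \<le> |G|^2 \<le> B almost everywhere on the
  unit square. Since G is quasi-periodic, a discrete winding argument on every translate of an M by N
  grid finds a jump of size comparable to sqrt A, either of G in the second variable or of
  H = exp (- 2 pi i x w) G in the first. The x-coefficients of H are the values of the Fourier
  transform of g. Damping the coefficients with a de la Vallee Poussin kernel of order R (for G) or L
  (for H) gives functions that are Lipschitz with constant of order R or L, so for N of order R and M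
  of order L they cannot jump. Hence one of the two remainders, which are the Zak transforms of the
  tails of g and of its Fourier transform, is of size comparable to sqrt A on a set of measure at least
  of order 1 / (R L), and a weak-type Hausdorff-Young estimate bounds that measure by the q / p-th power
  of the tail sum.\<close>

subsection \<open>Characters and the unit square\<close>

text \<open>A sharp cutoff of the coefficients at R would cost a factor log R in the Lipschitz
  constant, since Dirichlet kernels are not bounded in L1. The smoothed weights avoid this and still
  equal 1 up to R. The functions are only defined almost everywhere, so no winding number along a
  curve is available. The contradiction has to live on finitely many points, for almost every
  translate of a grid; each translate then yields a bad point, and averaging over translates turns
  this into the measure 1 / (M N). Neither function is obstructed alone: G is periodic in its second
  variable and H in the first. The obstruction is that the unimodular factor linking them is
  periodic in neither. The two smoothing orders therefore enter only through the product R L. The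
  exponent comes from \<open>p / q = p - 1\<close> and (p - 1) (q - 1) = 1: the measure bound is a
  constant times T^(q - 1) for a tail sum T, and T^(q - 1) of order 1 / (R L) means T of order (R
  L)^(-(p - 1)).\<close>

definition ee :: "real \<Rightarrow> complex" where
  "ee t = cis (2 * pi * t)"

lemma ee_add: "ee (s + t) = ee s * ee t"
  by (simp add: ee_def cis_mult distrib_left)

lemma ee_0 [simp]: "ee 0 = 1"
  by (simp add: ee_def)

lemma norm_ee [simp]: "norm (ee t) = 1"
  by (simp add: ee_def)

lemma cnj_ee: "cnj (ee t) = ee (- t)"
  by (simp add: ee_def cis_cnj)

lemma ee_diff: "ee (s - t) = ee s * ee (- t)"
  using ee_add[of s "-t"] by simp

lemma ee_of_int [simp]: "ee (of_int k) = 1"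
  by (simp add: ee_def cis_multiple_2pi)

lemma ee_add_int [simp]: "ee (t + of_int k) = ee t"
  by (simp add: ee_add)

lemma ee_eq_exp: "ee t = exp (2 * pi * \<i> * complex_of_real t)"
  by (simp add: ee_def cis_conv_exp mult_ac)

lemma continuous_on_ee [continuous_intros]:
  "continuous_on S f \<Longrightarrow> continuous_on S (\<lambda>x. ee (f x))"
  unfolding ee_eq_exp by (intro continuous_intros)

lemma measurable_ee [measurable]: "ee \<in> borel_measurable borel"
  by (intro borel_measurable_continuous_onI continuous_intros)

lemma ee_has_vector_derivative:
  "((\<lambda>t. ee (c * t)) has_vector_derivative (2 * pi * \<i> * c * ee (c * t))) (at t within S)"
proof -
  have "((\<lambda>z. exp (2 * pi * \<i> * c * z)) has_field_derivative 2 * pi * \<i> * c * exp (2 * pi * \<i> * c * of_real t)) (at (of_real t))"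
    by (auto intro!: derivative_eq_intros)
  from has_vector_derivative_real_field[OF this, of S] show ?thesis
    by (simp add: ee_eq_exp mult_ac)
qed

lemma norm_ee_diff_le: "norm (ee s - ee t) \<le> 2 * pi * \<bar>s - t\<bar>"
proof -
  have *: "ee s - ee t = ee t * (ee (s - t) - 1)"
    using ee_add[of t "s - t"] by (simp add: algebra_simps)
  have "norm (ee s - ee t) = norm (ee (s - t) - 1)"
    unfolding * by (simp add: norm_mult)
  also have "ee (s - t) = exp (\<i> * complex_of_real (2 * pi * (s - t)))"
    by (simp add: ee_def cis_conv_exp)
  also have "norm (exp (\<i> * complex_of_real (2 * pi * (s - t))) - 1) \<le> \<bar>2 * pi * (s - t)\<bar>"
    using dist_exp_i_1[of "2 * pi * (s - t)"] abs_sin_x_le_abs_x[of "pi * (s - t)"]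
    by (simp add: dist_norm abs_mult mult.assoc)
  finally show ?thesis by (simp add: abs_mult)
qed

lemma ee_eq_iff: "ee s = ee t \<longleftrightarrow> (\<exists>n::int. s = t + of_int n)"
proof -
  have "ee s = ee t \<longleftrightarrow> sin (2 * pi * s) = sin (2 * pi * t) \<and> cos (2 * pi * s) = cos (2 * pi * t)"
    by (auto simp: ee_def complex_eq_iff)
  also have "\<dots> \<longleftrightarrow> (\<exists>n::int. 2 * pi * s = 2 * pi * t + 2 * pi * n)"
    by (simp add: sin_cos_eq_iff)
  also have "\<dots> \<longleftrightarrow> (\<exists>n::int. s = t + of_int n)"
    by (simp flip: distrib_left)
  finally show ?thesis .
qed

lemma ee_surj: "norm z = 1 \<Longrightarrow> \<exists>t\<in>{0..1}. ee t = z"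
proof -
  assume "norm z = 1"
  then obtain t where "0 \<le> t" "t < 2 * pi" "z = Complex (cos t) (sin t)"
    by (rule complex_unimodular_polar)
  then show ?thesis
    by (intro bexI[of _ "t / (2 * pi)"]) (auto simp: ee_def complex_eq_iff)
qed

text \<open>The interval is half-open so that its integer translates tile the line exactly. Writing
  the restriction as a density keeps the whole line as the space and the Borel sets as the
  sigma-algebra, so measurability questions stay those of \<open>borel\<close>.\<close>

definition IU :: "real measure" where
  "IU = density lborel (\<lambda>x. ennreal (indicator {0..<1} x))"

definition QU :: "(real \<times> real) measure" where
  "QU = IU \<Otimes>\<^sub>M IU"

lemma sets_IU [simp, measurable_cong]: "sets IU = sets borel"
  by (simp add: IU_def)

lemma space_IU [simp]: "space IU = UNIV"
  by (simp add: IU_def)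

lemma sets_QU [simp, measurable_cong]: "sets QU = sets borel"
proof -
  have "sets QU = sets (borel \<Otimes>\<^sub>M borel :: (real \<times> real) measure)"
    unfolding QU_def by (intro sets_pair_measure_cong) simp_all
  then show ?thesis unfolding borel_prod .
qed

lemma space_QU [simp]: "space QU = UNIV"
  by (simp add: QU_def space_pair_measure)

lemma AE_IU: "(AE x in IU. P x) \<longleftrightarrow> (AE x in lborel. x \<in> {0..<1} \<longrightarrow> P x)"
  unfolding IU_def by (subst AE_density) (auto split: split_indicator)

lemma nn_integral_IU:
  "f \<in> borel_measurable borel \<Longrightarrow> (\<integral>\<^sup>+x. f x \<partial>IU) = (\<integral>\<^sup>+x. indicator {0..<1} x * f x \<partial>lborel)"
  unfolding IU_def by (subst nn_integral_density) (auto simp: ennreal_indicator)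

lemma integral_IU:
  fixes f :: "real \<Rightarrow> 'b::{banach, second_countable_topology}"
  shows "f \<in> borel_measurable borel \<Longrightarrow> (LINT x|IU. f x) = (LINT x|lborel. indicator {0..<1} x *\<^sub>R f x)"
  unfolding IU_def by (subst integral_density) auto

lemma prob_space_IU: "prob_space IU"
  by (rule prob_spaceI) (simp add: IU_def emeasure_density ennreal_indicator nn_integral_indicator_singleton')

interpretation IU: prob_space IU
  by (rule prob_space_IU)

interpretation QU: pair_prob_space IU IU ..

lemma prob_space_QU: "prob_space QU"
  unfolding QU_def by (rule QU.prob_space_axioms)

interpretation Q: prob_space QU
  by (rule prob_space_QU)

lemma unit_square_borel [measurable]: "{0..<1} \<times> {0..<1} \<in> sets (borel :: (real \<times> real) measure)"
  by (intro borel_Times) auto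

lemma QU_density: "QU = density lborel (\<lambda>z. ennreal (indicator ({0..<1} \<times> {0..<1}) z))"
proof -
  have "QU = density (lborel \<Otimes>\<^sub>M lborel) (\<lambda>(x, y). ennreal (indicator {0..<1} x) * ennreal (indicator {0..<1} y))"
    unfolding QU_def IU_def
    by (rule pair_measure_density) (auto simp flip: IU_def intro!: sigma_finite_lborel IU.sigma_finite_measure_axioms)
  also have "\<dots> = density lborel (\<lambda>z. ennreal (indicator ({0..<1} \<times> {0..<1}) z))"
    unfolding lborel_prod by (intro arg_cong2[where f = density] ext) (auto simp: indicator_def)
  finally show ?thesis .
qed

lemma AE_QU: "(AE z in QU. P z) \<longleftrightarrow> (AE z in lborel. z \<in> {0..<1} \<times> {0..<1} \<longrightarrow> P z)"
  unfolding QU_density by (subst AE_density) (auto split: split_indicator)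

lemma AE_QU_mem: "AE z in QU. z \<in> {0..<1} \<times> {0..<1}"
  unfolding AE_QU by simp

lemma AE_IU_mem: "AE x in IU. x \<in> {0..<1}"
  unfolding AE_IU by simp

lemma integral_ee: "(LINT x|IU. ee (of_int k * x)) = of_bool (k = 0)"
proof (cases "k = 0")
  case True
  then show ?thesis using IU.prob_space by simp
next
  case False
  let ?c = "2 * pi * \<i> * complex_of_real (of_int k)"
  have "has_bochner_integral lborel (\<lambda>x. indicator {0..1} x *\<^sub>R ee (of_int k * x))
     (ee (of_int k * 1) / ?c - ee (of_int k * 0) / ?c)"
  proof (rule has_bochner_integral_FTC_Icc)
    fix x :: real
    have "((\<lambda>t. ee (of_int k * t) / ?c) has_vector_derivative (2 * pi * \<i> * of_int k * ee (of_int k * x)) / ?c)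
        (at x within {0..1})"
      by (rule has_vector_derivative_divide) (use ee_has_vector_derivative[of "of_int k"] in simp)
    then show "((\<lambda>t. ee (of_int k * t) / ?c) has_vector_derivative ee (of_int k * x)) (at x within {0..1})"
      using False by simp
  qed (auto intro!: continuous_intros)
  then have "(LINT x|lborel. indicator {0..1} x *\<^sub>R ee (of_int k * x)) = 0"
    by (simp add: has_bochner_integral_integral_eq)
  moreover have "AE x in lborel. x \<noteq> (1::real)"
    by (rule AE_lborel_singleton)
  then have "(LINT x|lborel. indicator {0..1} x *\<^sub>R ee (of_int k * x)) = (LINT x|lborel. indicator {0..<1} x *\<^sub>R ee (of_int k * x))"
    by (intro integral_cong_AE) (auto split: split_indicator)
  ultimately show ?thesis
    using False by (subst integral_IU) simp_all
qed

subsection \<open>Density of trigonometric polynomials\<close>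

text \<open>The index (m, n) is that of the Gabor element: this is the factor by which the Zak
  transform changes when g is translated by m and modulated by n. Hence the minus sign and the order
  of the entries.\<close>

definition trig_mono :: "int \<times> int \<Rightarrow> real \<times> real \<Rightarrow> complex" where
  "trig_mono i z = ee (of_int (snd i) * fst z - of_int (fst i) * snd z)"

definition trig_poly :: "(real \<times> real \<Rightarrow> complex) set" where
  "trig_poly = {P. \<exists>S a. finite S \<and> P = (\<lambda>z. \<Sum>i\<in>S. a i * trig_mono i z)}"

lemma norm_trig_mono [simp]: "norm (trig_mono i z) = 1"
  by (simp add: trig_mono_def)

lemma trig_mono_mult: "trig_mono i z * trig_mono j z = trig_mono (fst i + fst j, snd i + snd j) z"
  by (simp add: trig_mono_def flip: ee_add) (simp add: algebra_simps)

lemma cnj_trig_mono: "cnj (trig_mono i z) = trig_mono (- fst i, - snd i) z"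
  by (simp add: trig_mono_def cnj_ee)

lemma measurable_trig_mono [measurable]: "trig_mono i \<in> borel_measurable borel"
  unfolding trig_mono_def
  by (intro borel_measurable_continuous_onI continuous_intros)

lemma trig_poly_mono: "(\<lambda>z. c * trig_mono i z) \<in> trig_poly"
  unfolding trig_poly_def by (intro CollectI exI[of _ "{i}"] exI[of _ "\<lambda>_. c"]) auto

lemma trig_poly_const: "(\<lambda>z. c) \<in> trig_poly"
  using trig_poly_mono[of c "(0, 0)"] by (simp add: trig_mono_def)

lemma trig_poly_add:
  assumes "P \<in> trig_poly" "P' \<in> trig_poly"
  shows "(\<lambda>z. P z + P' z) \<in> trig_poly"
proof -
  obtain S a S' a' where *: "finite S" "P = (\<lambda>z. \<Sum>i\<in>S. a i * trig_mono i z)"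
      "finite S'" "P' = (\<lambda>z. \<Sum>i\<in>S'. a' i * trig_mono i z)"
    using assms unfolding trig_poly_def by blast
  define b where "b i = (if i \<in> S then a i else 0) + (if i \<in> S' then a' i else 0)" for i
  have "P z + P' z = (\<Sum>i\<in>S \<union> S'. b i * trig_mono i z)" for z
  proof -
    have "P z = (\<Sum>i\<in>S \<union> S'. (if i \<in> S then a i else 0) * trig_mono i z)"
      unfolding *(2) using *(1,3) by (intro sum.mono_neutral_cong_left) auto
    moreover have "P' z = (\<Sum>i\<in>S \<union> S'. (if i \<in> S' then a' i else 0) * trig_mono i z)"
      unfolding *(4) using *(1,3) by (intro sum.mono_neutral_cong_left) auto
    ultimately show ?thesis
      by (simp add: b_def distrib_right sum.distrib)
  qed
  then show ?thesis
    unfolding trig_poly_def using *(1,3) by (intro CollectI exI[of _ "S \<union> S'"] exI[of _ b]) auto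
qed

lemma trig_poly_sum:
  "(\<And>i. i \<in> S \<Longrightarrow> P i \<in> trig_poly) \<Longrightarrow> (\<lambda>z. \<Sum>i\<in>S. P i z) \<in> trig_poly"
  by (induction S rule: infinite_finite_induct) (auto intro: trig_poly_const trig_poly_add)

lemma trig_poly_mult:
  assumes "P \<in> trig_poly" "P' \<in> trig_poly"
  shows "(\<lambda>z. P z * P' z) \<in> trig_poly"
proof -
  obtain S a S' a' where *: "P = (\<lambda>z. \<Sum>i\<in>S. a i * trig_mono i z)"
      "P' = (\<lambda>z. \<Sum>i\<in>S'. a' i * trig_mono i z)"
    using assms unfolding trig_poly_def by blast
  have "(\<lambda>z. P z * P' z) = (\<lambda>z. \<Sum>i\<in>S. \<Sum>j\<in>S'. (a i * a' j) * trig_mono (fst i + fst j, snd i + snd j) z)"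
    unfolding * sum_product by (simp add: trig_mono_mult[symmetric] mult_ac)
  then show ?thesis
    by (simp add: trig_poly_sum trig_poly_mono)
qed

lemma trig_poly_cnj:
  assumes "P \<in> trig_poly"
  shows "(\<lambda>z. cnj (P z)) \<in> trig_poly"
proof -
  obtain S a where "P = (\<lambda>z. \<Sum>i\<in>S. a i * trig_mono i z)"
    using assms unfolding trig_poly_def by blast
  then show ?thesis
    by (simp add: cnj_trig_mono trig_poly_sum trig_poly_mono)
qed

lemma measurable_trig_poly [measurable_dest]: "P \<in> trig_poly \<Longrightarrow> P \<in> borel_measurable borel"
  unfolding trig_poly_def by auto

text \<open>The map (x, y) to (ee x, ee y) identifies distinct points of the closed square only on
  its boundary, where h vanishes, so h descends to the torus. Continuity of the quotient follows
  from compactness of the square.\<close>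

lemma torus_factor:
  fixes h :: "real \<times> real \<Rightarrow> real"
  assumes h: "continuous_on UNIV h" and h0: "\<And>z. z \<notin> {0<..<1} \<times> {0<..<1} \<Longrightarrow> h z = 0"
  obtains \<phi> where "continuous_on (sphere 0 1 \<times> sphere 0 1) \<phi>"
    "\<And>x y. x \<in> {0..1} \<Longrightarrow> y \<in> {0..1} \<Longrightarrow> \<phi> (ee x, ee y) = h (x, y)"
proof -
  define E where "E z = (ee (fst z), ee (snd z))" for z
  let ?T = "sphere 0 1 \<times> sphere 0 1 :: (complex \<times> complex) set"
  let ?S = "{0..1} \<times> {0..1} :: (real \<times> real) set"
  define \<phi> where "\<phi> w = h (SOME z. z \<in> ?S \<and> E z = w)" for w
  have contE: "continuous_on S E" for S
    unfolding E_def by (intro continuous_intros)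
  have E_mem: "E z \<in> ?T" for z
    by (simp add: E_def)
  have ee_cases: "x = y \<or> (x = 0 \<and> y = 1) \<or> (x = 1 \<and> y = 0)"
    if xy: "x \<in> {0..1}" "y \<in> {0..1}" "ee x = ee y" for x y :: real
  proof -
    obtain n :: int where n: "x = y + of_int n"
      using xy(3) unfolding ee_eq_iff by blast
    with xy have "-1 \<le> n" "n \<le> 1" by auto
    then have "n = -1 \<or> n = 0 \<or> n = 1" by auto
    with n xy show ?thesis by auto
  qed
  have \<phi>: "\<phi> (E z) = h z" if z: "z \<in> ?S" for z
  proof -
    let ?z = "SOME z'. z' \<in> ?S \<and> E z' = E z"
    have mem: "?z \<in> ?S \<and> E ?z = E z"
      by (rule someI[of "\<lambda>z'. z' \<in> ?S \<and> E z' = E z" z], rule conjI[OF z refl])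
    have "h z' = h z" if "z' \<in> ?S \<and> E z' = E z" for z'
    proof (cases "z' = z")
      case False
      have "fst z' \<in> {0..1}" "fst z \<in> {0..1}" "snd z' \<in> {0..1}" "snd z \<in> {0..1}"
        "ee (fst z') = ee (fst z)" "ee (snd z') = ee (snd z)"
        using z that by (auto simp: E_def)
      note c = this
      have "fst z' = fst z \<or> (fst z' = 0 \<and> fst z = 1) \<or> (fst z' = 1 \<and> fst z = 0)"
        "snd z' = snd z \<or> (snd z' = 0 \<and> snd z = 1) \<or> (snd z' = 1 \<and> snd z = 0)"
        by (rule ee_cases[OF c(1,2,5)], rule ee_cases[OF c(3,4,6)])
      then have out: "z' \<notin> {0<..<1} \<times> {0<..<1}" "z \<notin> {0<..<1} \<times> {0<..<1}"
        using False by (cases z; cases z'; auto)+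
      show ?thesis using h0[OF out(1)] h0[OF out(2)] by simp
    qed simp
    from this[OF mem] have "h ?z = h z" .
    then show ?thesis by (simp add: \<phi>_def)
  qed
  have surj: "\<exists>z\<in>?S. E z = w" if "w \<in> ?T" for w
  proof -
    have "norm (fst w) = 1" "norm (snd w) = 1"
      using that by (auto simp: mem_Times_iff)
    from this[THEN ee_surj] obtain x y where "x \<in> {0..1}" "ee x = fst w" "y \<in> {0..1}" "ee y = snd w"
      by (elim bexE)
    then show ?thesis
      by (intro bexI[of _ "(x, y)"]) (auto simp: E_def)
  qed
  have "continuous_on ?T \<phi>"
  proof (subst continuous_on_closed_vimage)
    show "closed ?T" by (intro closed_Times closed_sphere)
    show "\<forall>B. closed B \<longrightarrow> closed (\<phi> -` B \<inter> ?T)"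
    proof (intro allI impI)
      fix B :: "real set" assume "closed B"
      \<comment> \<open>The preimage of a closed set is the image of a compact subset of the square,
        hence closed.\<close>
      have "\<phi> -` B \<inter> ?T = E ` (?S \<inter> h -` B)"
      proof (intro equalityI subsetI)
        fix w assume w: "w \<in> \<phi> -` B \<inter> ?T"
        then obtain z where z: "z \<in> ?S" "E z = w" using surj[of w] by blast
        with w \<phi>[OF z(1)] show "w \<in> E ` (?S \<inter> h -` B)" by (intro image_eqI[of _ _ z]) auto
      next
        fix w assume "w \<in> E ` (?S \<inter> h -` B)"
        then obtain z where z: "z \<in> ?S" "h z \<in> B" "w = E z" by blast
        then show "w \<in> \<phi> -` B \<inter> ?T" using \<phi>[OF z(1)] E_mem[of z] by simp
      qed
      moreover have "compact (?S \<inter> h -` B)"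
      proof (intro compact_Int_closed compact_Times)
        show "closed (h -` B)"
          using continuous_closed_preimage[OF h closed_UNIV \<open>closed B\<close>] by simp
      qed auto
      ultimately show "closed (\<phi> -` B \<inter> ?T)"
        using compact_imp_closed[OF compact_continuous_image[OF contE]] by simp
    qed
  qed
  moreover have "\<phi> (ee x, ee y) = h (x, y)" if "x \<in> {0..1}" "y \<in> {0..1}" for x y
    using \<phi>[of "(x, y)"] that by (simp add: E_def)
  ultimately show ?thesis by (rule that)
qed

lemma trig_poly_Re_Im_mono:
  shows "(\<lambda>z. complex_of_real (Re (trig_mono i z))) \<in> trig_poly"
    and "(\<lambda>z. complex_of_real (Im (trig_mono i z))) \<in> trig_poly"
proof -
  have "(\<lambda>z. complex_of_real (Re (trig_mono i z))) = (\<lambda>z. 1/2 * trig_mono i z + 1/2 * trig_mono (- fst i, - snd i) z)"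
    by (auto simp: cnj_trig_mono[symmetric] complex_eq_iff)
  then show "(\<lambda>z. complex_of_real (Re (trig_mono i z))) \<in> trig_poly"
    using trig_poly_add[OF trig_poly_mono trig_poly_mono, of "1/2" i "1/2" "(- fst i, - snd i)"] by simp
  have "(\<lambda>z. complex_of_real (Im (trig_mono i z))) = (\<lambda>z. (-\<i>/2) * trig_mono i z + (\<i>/2) * trig_mono (- fst i, - snd i) z)"
    by (auto simp: cnj_trig_mono[symmetric] complex_eq_iff)
  then show "(\<lambda>z. complex_of_real (Im (trig_mono i z))) \<in> trig_poly"
    using trig_poly_add[OF trig_poly_mono trig_poly_mono, of "-\<i>/2" i "\<i>/2" "(- fst i, - snd i)"] by simp
qed

lemma trig_poly_approx:
  fixes h :: "real \<times> real \<Rightarrow> real"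
  assumes h: "continuous_on UNIV h" and h0: "\<And>z. z \<notin> {0<..<1} \<times> {0<..<1} \<Longrightarrow> h z = 0"
    and e: "e > 0"
  obtains P where "P \<in> trig_poly" "\<And>z. z \<in> {0..1} \<times> {0..1} \<Longrightarrow> norm (P z - of_real (h z)) < e"
proof -
  let ?T = "sphere 0 1 \<times> sphere 0 1 :: (complex \<times> complex) set"
  obtain \<phi> where cont: "continuous_on ?T \<phi>"
    and \<phi>: "\<And>x y. x \<in> {0..1} \<Longrightarrow> y \<in> {0..1} \<Longrightarrow> \<phi> (ee x, ee y) = h (x, y)"
    using torus_factor[OF h h0] by blast
  \<comment> \<open>The real form of Stone-Weierstrass asks for a ring of real functions. The real
    and imaginary parts of the two torus coordinates belong to this one and separate points.\<close>
  define R where "R = {f. continuous_on ?T f \<and>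
    (\<lambda>z. complex_of_real (f (ee (fst z), ee (snd z)))) \<in> trig_poly}"
  have ee_mono: "ee (fst z) = trig_mono (0, 1) z" "ee (snd z) = trig_mono (- 1, 0) z" for z
    by (simp_all add: trig_mono_def)
  have coord: "(\<lambda>w. Re (fst w)) \<in> R" "(\<lambda>w. Im (fst w)) \<in> R" "(\<lambda>w. Re (snd w)) \<in> R" "(\<lambda>w. Im (snd w)) \<in> R"
    unfolding R_def
    by (auto intro!: continuous_intros simp: ee_mono trig_poly_Re_Im_mono)
  interpret function_ring_on R ?T
  proof
    show "compact ?T" by (intro compact_Times compact_sphere)
    show "\<exists>f\<in>R. f x \<noteq> f y" if "x \<noteq> y" for x y
    proof (rule ccontr)
      assume "\<not> (\<exists>f\<in>R. f x \<noteq> f y)"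
      then have "f x = f y" if "f \<in> R" for f using that by blast
      from coord[THEN this] have "x = y" by (simp add: complex_eq_iff prod_eq_iff)
      with that show False by simp
    qed
  qed (auto simp: R_def intro!: continuous_intros trig_poly_const trig_poly_add trig_poly_mult)
  obtain f where f: "f \<in> R" "\<And>w. w \<in> ?T \<Longrightarrow> \<bar>\<phi> w - f w\<bar> < e"
    using Stone_Weierstrass_basic[OF cont e] by blast
  show ?thesis
  proof (rule that)
    show "(\<lambda>z. complex_of_real (f (ee (fst z), ee (snd z)))) \<in> trig_poly"
      using f(1) by (simp add: R_def)
    fix z :: "real \<times> real" assume z: "z \<in> {0..1} \<times> {0..1}"
    have "norm (complex_of_real (f (ee (fst z), ee (snd z))) - of_real (h z)) = \<bar>\<phi> (ee (fst z), ee (snd z)) - f (ee (fst z), ee (snd z))\<bar>"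
      using \<phi>[of "fst z" "snd z"] z by (simp add: mem_Times_iff abs_minus_commute flip: of_real_diff)
    then show "norm (complex_of_real (f (ee (fst z), ee (snd z))) - of_real (h z)) < e"
      using f(2)[of "(ee (fst z), ee (snd z))"] by simp
  qed
qed

lemma AE_lborel_not_negligible: "negligible N \<Longrightarrow> AE z in lborel. z \<notin> N"
proof -
  assume "negligible N"
  then have "N \<in> null_sets (completion lborel)" by (simp add: negligible_iff_null_sets)
  then obtain N' where "N' \<in> null_sets lborel" "N \<subseteq> N'"
    by (auto simp: null_sets_completion_iff2)
  then show ?thesis using AE_not_in[of N' lborel] by (auto elim: eventually_mono)
qed

text \<open>A measurable function is an almost everywhere limit of continuous ones; clipping to
  [0, 1] and cutting off at the boundary makes these descend to the torus. The bound 2 is 1 for the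
  clipped function plus an approximation error below 1. Bounded almost everywhere convergence is
  what dominated convergence asks for.\<close>

lemma trig_poly_indicator:
  assumes E: "E \<in> sets borel"
  obtains P where "\<And>n. P n \<in> trig_poly" "\<And>n z. z \<in> {0..<1} \<times> {0..<1} \<Longrightarrow> norm (P n z) \<le> 2"
    "AE z in QU. (\<lambda>n. P n z) \<longlonglongrightarrow> indicator E z"
proof -
  have "(indicator E :: real \<times> real \<Rightarrow> real) measurable_on UNIV"
    using E by (intro lebesgue_measurable_imp_measurable_on) (auto intro!: borel_measurable_indicator)
  then obtain N g where N: "negligible N" and g: "\<And>n. continuous_on UNIV (g n)"
    and lim: "\<And>z. z \<notin> N \<Longrightarrow> (\<lambda>n::nat. g n z) \<longlonglongrightarrow> (indicator E z :: real)"
    unfolding measurable_on_def by auto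
  \<comment> \<open>A continuous cutoff that vanishes off the open unit interval and is eventually 1
    at each of its points.\<close>
  define bump where "bump n x = max 0 (min 1 (real n * min x (1 - x)))" for n and x :: real
  define h where "h n z = max 0 (min 1 (g n z)) * (bump n (fst z) * bump n (snd z))" for n z
  have bump_cont: "continuous_on UNIV (bump n)" for n
    unfolding bump_def by (intro continuous_intros)
  have h_cont: "continuous_on UNIV (h n)" for n
    unfolding h_def
    by (intro continuous_intros g continuous_on_compose2[OF bump_cont]) auto
  have bump0: "bump n x = 0" if "x \<notin> {0<..<1}" for n x
  proof -
    have "real n * min x (1 - x) \<le> 0"
      using that by (intro mult_nonneg_nonpos) auto
    then show ?thesis by (simp add: bump_def)
  qed
  have h0: "h n z = 0" if "z \<notin> {0<..<1} \<times> {0<..<1}" for n z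
    using that bump0[of "fst z" n] bump0[of "snd z" n] by (auto simp: h_def mem_Times_iff)
  have bump_bd: "0 \<le> bump n x" "bump n x \<le> 1" for n x
    by (auto simp: bump_def)
  have h_bd: "\<bar>h n z\<bar> \<le> 1" for n z
    unfolding h_def abs_mult by (intro mult_le_one) (use bump_bd in auto)
  have "\<exists>P\<in>trig_poly. \<forall>z\<in>{0..1} \<times> {0..1}. norm (P z - of_real (h n z)) < 1 / real (Suc n)" for n
    using trig_poly_approx[OF h_cont[of n] h0, of "1 / real (Suc n)"] by (metis of_nat_0_less_iff zero_less_Suc zero_less_divide_1_iff)
  then obtain P where P: "\<And>n. P n \<in> trig_poly"
    "\<And>n z. z \<in> {0..1} \<times> {0..1} \<Longrightarrow> norm (P n z - of_real (h n z)) < 1 / real (Suc n)"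
    by metis
  show ?thesis
  proof (rule that[of P])
    fix n and z :: "real \<times> real" assume "z \<in> {0..<1} \<times> {0..<1}"
    then have "norm (P n z - of_real (h n z)) < 1 / real (Suc n)"
      by (intro P(2)) auto
    also have "\<dots> \<le> 1" by simp
    finally show "norm (P n z) \<le> 2"
      using h_bd[of n z] norm_triangle_sub[of "P n z" "of_real (h n z)"] by simp
  next
    have "AE z in lborel. z \<notin> N" using N by (rule AE_lborel_not_negligible)
    \<comment> \<open>On the two edges contained in the half-open square the cutoff stays 0, so they
      are discarded as null sets.\<close>
    moreover have "AE z in lborel. z \<notin> {z :: real \<times> real. fst z = 0}" "AE z in lborel. z \<notin> {z :: real \<times> real. snd z = 0}"
      by (rule AE_lborel_not_negligible;
          use negligible_standard_hyperplane[of "(1, 0) :: real \<times> real" 0] negligible_standard_hyperplane[of "(0, 1) :: real \<times> real" 0]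
            in \<open>simp add: Basis_prod_def inner_prod_def\<close>)+
    ultimately show "AE z in QU. (\<lambda>n. P n z) \<longlonglongrightarrow> indicator E z"
      unfolding AE_QU
    proof eventually_elim
      case (elim z)
      show ?case
      proof
        assume "z \<in> {0..<1} \<times> {0..<1}"
        with elim have z: "z \<in> {0<..<1} \<times> {0<..<1}" by (auto simp: less_le)
        have bump_lim: "(\<lambda>n. bump n x) \<longlonglongrightarrow> 1" if "x \<in> {0<..<1}" for x
        proof (rule tendsto_eventually)
          have "0 < min x (1 - x)" using that by auto
          then obtain n0 where n0: "1 < real n0 * min x (1 - x)"
            using reals_Archimedean3 by blast
          show "\<forall>\<^sub>F n in sequentially. bump n x = 1"
          proof (rule eventually_sequentiallyI[of n0])
            fix n assume "n0 \<le> n"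
            then have "real n0 * min x (1 - x) \<le> real n * min x (1 - x)"
              using \<open>0 < min x (1 - x)\<close> by (intro mult_right_mono) auto
            with n0 show "bump n x = 1" by (simp add: bump_def)
          qed
        qed
        have "(\<lambda>n. h n z) \<longlonglongrightarrow> max 0 (min 1 (indicator E z)) * (1 * 1)"
          unfolding h_def using z elim by (intro tendsto_intros lim bump_lim) auto
        then have "(\<lambda>n. complex_of_real (h n z)) \<longlonglongrightarrow> of_real (indicator E z)"
          by (intro tendsto_of_real) (auto split: split_indicator_asm simp: indicator_def)
        moreover have "(\<lambda>n. P n z - of_real (h n z)) \<longlonglongrightarrow> 0"
        proof (rule tendsto_norm_zero_cancel, rule tendsto_sandwich[of "\<lambda>_. 0"])
          show "\<forall>\<^sub>F n in sequentially. norm (P n z - of_real (h n z)) \<le> 1 / real (Suc n)"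
            using P(2)[of z] z by (intro always_eventually allI less_imp_le P(2)) auto
          show "(\<lambda>n. 1 / real (Suc n)) \<longlonglongrightarrow> 0"
            using LIMSEQ_inverse_real_of_nat by (simp add: inverse_eq_divide)
        qed auto
        ultimately have "(\<lambda>n. P n z - of_real (h n z) + of_real (h n z)) \<longlonglongrightarrow> 0 + of_real (indicator E z)"
          by (intro tendsto_add)
        then show "(\<lambda>n. P n z) \<longlonglongrightarrow> indicator E z"
          by (cases "z \<in> E") simp_all
      qed
    qed
  qed (use P in auto)
qed

text \<open>Let the squared moduli of trigonometric polynomials tend boundedly to the indicator of
  the set where W is negative. The integral of W over that set is then nonnegative, which forces the
  set to be null. This converts the Riesz inequalities, which test against all polynomials, into
  pointwise bounds.\<close>

lemma trig_poly_nonneg_imp_AE_nonneg: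
  fixes W :: "real \<times> real \<Rightarrow> real"
  assumes W: "integrable QU W"
    and nonneg: "\<And>P. P \<in> trig_poly \<Longrightarrow> 0 \<le> (LINT z|QU. (norm (P z))\<^sup>2 * W z)"
  shows "AE z in QU. 0 \<le> W z"
proof -
  have [measurable]: "W \<in> borel_measurable borel"
    using borel_measurable_integrable[OF W] by simp
  define E where "E = {z. W z < 0}"
  have E [measurable]: "E \<in> sets borel" unfolding E_def by measurable
  obtain P where P: "\<And>n. P n \<in> trig_poly" "\<And>n z. z \<in> {0..<1} \<times> {0..<1} \<Longrightarrow> norm (P n z) \<le> 2"
    and lim: "AE z in QU. (\<lambda>n. P n z) \<longlonglongrightarrow> indicator E z"
    using trig_poly_indicator[OF E] by blast
  note [measurable] = P(1)[THEN measurable_trig_poly]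
  have "(\<lambda>n. LINT z|QU. (norm (P n z))\<^sup>2 * W z) \<longlonglongrightarrow> (LINT z|QU. (norm (indicator E z :: complex))\<^sup>2 * W z)"
  proof (rule integral_dominated_convergence[where w = "\<lambda>z. 4 * \<bar>W z\<bar>"])
    show "integrable QU (\<lambda>z. 4 * \<bar>W z\<bar>)" using W by simp
    show "AE z in QU. (\<lambda>n. (norm (P n z))\<^sup>2 * W z) \<longlonglongrightarrow> (norm (indicator E z :: complex))\<^sup>2 * W z"
      using lim by eventually_elim (intro tendsto_intros)
    show "AE z in QU. norm ((norm (P n z))\<^sup>2 * W z) \<le> 4 * \<bar>W z\<bar>" for n
      using AE_QU_mem
    proof eventually_elim
      case (elim z)
      have "(norm (P n z))\<^sup>2 \<le> 2\<^sup>2" using P(2)[OF elim] by (intro power_mono) auto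
      then show ?case by (auto simp: abs_mult intro!: mult_right_mono)
    qed
  qed measurable
  then have "0 \<le> (LINT z|QU. (norm (indicator E z :: complex))\<^sup>2 * W z)"
    by (rule LIMSEQ_le_const) (use nonneg[OF P(1)] in auto)
  also have "(LINT z|QU. (norm (indicator E z :: complex))\<^sup>2 * W z) = (LINT z|QU. - (indicator E z * - W z))"
    by (intro Bochner_Integration.integral_cong) (auto split: split_indicator)
  finally have "(LINT z|QU. indicator E z * - W z) \<le> 0"
    by simp
  moreover have nn: "AE z in QU. 0 \<le> indicator E z * - W z"
    by (intro AE_I2) (auto simp: E_def split: split_indicator)
  moreover have int: "integrable QU (\<lambda>z. indicator E z * - W z)"
    using integrable_real_mult_indicator[of E QU "\<lambda>z. - W z"] W by (simp add: mult.commute)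
  ultimately have "(LINT z|QU. indicator E z * - W z) = 0"
    using integral_nonneg_AE[OF nn] by simp
  then have "AE z in QU. indicator E z * - W z = 0"
    using integral_nonneg_eq_0_iff_AE[OF int nn] by simp
  then show ?thesis
    by eventually_elim (auto simp: E_def indicator_def split: if_splits)
qed

text \<open>The squared modulus of a trigonometric polynomial is again one, so its integral against
  W vanishes; the preceding criterion then applies to both signs of the real and imaginary
  parts.\<close>

lemma trig_coeffs_zero_imp_AE_zero:
  fixes W :: "real \<times> real \<Rightarrow> complex"
  assumes W: "integrable QU W"
    and zero: "\<And>i. (LINT z|QU. trig_mono i z * W z) = 0"
  shows "AE z in QU. W z = 0"
proof -
  have [measurable]: "W \<in> borel_measurable borel"
    using borel_measurable_integrable[OF W] by simp
  have int: "integrable QU (\<lambda>z. trig_mono i z * W z)" for i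
    by (rule Bochner_Integration.integrable_bound[OF W]) (auto simp: norm_mult)
  have P0: "integrable QU (\<lambda>z. P z * W z) \<and> (LINT z|QU. P z * W z) = 0" if P: "P \<in> trig_poly" for P
  proof -
    obtain S a where "P = (\<lambda>z. \<Sum>i\<in>S. a i * trig_mono i z)"
      using P unfolding trig_poly_def by blast
    then show ?thesis
      by (simp add: sum_distrib_right mult.assoc int zero)
  qed
  have sq: "integrable QU (\<lambda>z. of_real ((norm (P z))\<^sup>2) * W z) \<and> (LINT z|QU. of_real ((norm (P z))\<^sup>2) * W z) = 0"
    if "P \<in> trig_poly" for P
    using P0[OF trig_poly_mult[OF that trig_poly_cnj[OF that]]] by (simp only: complex_norm_square)
  have re: "(LINT z|QU. (norm (P z))\<^sup>2 * Re (W z)) = 0" and im: "(LINT z|QU. (norm (P z))\<^sup>2 * Im (W z)) = 0"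
    if "P \<in> trig_poly" for P
    using integral_Re[of QU "\<lambda>z. of_real ((norm (P z))\<^sup>2) * W z"] integral_Im[of QU "\<lambda>z. of_real ((norm (P z))\<^sup>2) * W z"]
      sq[OF that] by simp_all
  have "AE z in QU. 0 \<le> Re (W z)" "AE z in QU. 0 \<le> - Re (W z)" "AE z in QU. 0 \<le> Im (W z)" "AE z in QU. 0 \<le> - Im (W z)"
    by (rule trig_poly_nonneg_imp_AE_nonneg; use W re im in simp)+
  then show ?thesis
    by eventually_elim (simp add: complex_eq_iff)
qed

subsection \<open>Square-integrable functions\<close>

definition sq_integrable :: "'a measure \<Rightarrow> ('a \<Rightarrow> complex) \<Rightarrow> bool" where
  "sq_integrable M F \<longleftrightarrow> F \<in> borel_measurable M \<and> integrable M (\<lambda>z. (norm (F z))\<^sup>2)"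

lemma sq_integrable_measurable [measurable_dest]: "sq_integrable M F \<Longrightarrow> F \<in> borel_measurable M"
  by (simp add: sq_integrable_def)

lemma sq_integrable_iff_finite:
  "sq_integrable M F \<longleftrightarrow> F \<in> borel_measurable M \<and> (\<integral>\<^sup>+z. ennreal ((norm (F z))\<^sup>2) \<partial>M) < \<infinity>"
  by (auto simp: sq_integrable_def integrable_iff_bounded)

lemma sq_integrable_nn_integral:
  "sq_integrable M F \<Longrightarrow> (\<integral>\<^sup>+z. ennreal ((norm (F z))\<^sup>2) \<partial>M) = ennreal (LINT z|M. (norm (F z))\<^sup>2)"
  by (intro nn_integral_eq_integral) (auto simp: sq_integrable_def)

lemma sq_integrable_bound:
  assumes "sq_integrable M G" "F \<in> borel_measurable M" "\<And>z. norm (F z) \<le> norm (G z)"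
  shows "sq_integrable M F"
  using assms unfolding sq_integrable_def
  by (auto intro!: Bochner_Integration.integrable_bound[of M "\<lambda>z. (norm (G z))\<^sup>2"] power_mono)

lemma sq_integrable_add:
  assumes "sq_integrable M F" "sq_integrable M G"
  shows "sq_integrable M (\<lambda>z. F z + G z)"
proof -
  have [measurable]: "F \<in> borel_measurable M" "G \<in> borel_measurable M"
    using assms by measurable
  have "(norm (a + b))\<^sup>2 \<le> 2 * (norm a)\<^sup>2 + 2 * (norm b)\<^sup>2" for a b :: complex
  proof -
    have "(norm (a + b))\<^sup>2 \<le> (norm a + norm b)\<^sup>2"
      by (intro power_mono norm_triangle_ineq) auto
    also have "\<dots> \<le> 2 * (norm a)\<^sup>2 + 2 * (norm b)\<^sup>2"
      using zero_le_power2[of "norm a - norm b"] by (simp add: power2_eq_square algebra_simps)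
    finally show ?thesis .
  qed
  moreover have "integrable M (\<lambda>z. 2 * (norm (F z))\<^sup>2 + 2 * (norm (G z))\<^sup>2)"
    using assms unfolding sq_integrable_def by auto
  ultimately have "integrable M (\<lambda>z. (norm (F z + G z))\<^sup>2)"
    by (elim Bochner_Integration.integrable_bound) auto
  then show ?thesis by (simp add: sq_integrable_def)
qed

lemma sq_integrable_mult_bounded:
  assumes "sq_integrable M F" "u \<in> borel_measurable M" "\<And>z. norm (u z) \<le> C"
  shows "sq_integrable M (\<lambda>z. u z * F z)"
proof -
  have "sq_integrable M (\<lambda>z. of_real C * F z)"
    using assms(1) by (auto simp: sq_integrable_def norm_mult power_mult_distrib)
  moreover have "norm (u z) * norm (F z) \<le> \<bar>C\<bar> * norm (F z)" for z
    using assms(3)[of z] by (intro mult_right_mono) auto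
  ultimately show ?thesis
    using assms(1,2) by (auto intro!: sq_integrable_bound[of M "\<lambda>z. of_real C * F z"] simp: norm_mult)
qed

lemma sq_integrable_cmult: "sq_integrable M F \<Longrightarrow> sq_integrable M (\<lambda>z. c * F z)"
  by (rule sq_integrable_mult_bounded[of _ _ _ "norm c"]) auto

lemma sq_integrable_0 [simp]: "sq_integrable M (\<lambda>z. 0)"
  by (simp add: sq_integrable_def)

lemma sq_integrable_sum:
  "(\<And>i. i \<in> S \<Longrightarrow> sq_integrable M (F i)) \<Longrightarrow> sq_integrable M (\<lambda>z. \<Sum>i\<in>S. F i z)"
  by (induction S rule: infinite_finite_induct) (auto intro: sq_integrable_add)

lemma sq_integrable_diff:
  "sq_integrable M F \<Longrightarrow> sq_integrable M G \<Longrightarrow> sq_integrable M (\<lambda>z. F z - G z)"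
  using sq_integrable_add[of M F "\<lambda>z. - 1 * G z"] sq_integrable_cmult[of M G "-1"] by simp

lemma le_one_plus_square: "x \<le> 1 + x\<^sup>2" for x :: real
  using zero_le_power2[of "x - 1/2"] by (simp add: power2_diff power_divide)

lemma (in finite_measure) sq_integrable_imp_integrable:
  assumes "sq_integrable M F"
  shows "integrable M F"
proof (rule Bochner_Integration.integrable_bound)
  show "integrable M (\<lambda>z. 1 + (norm (F z))\<^sup>2)"
    using assms by (auto simp: sq_integrable_def)
  show "AE z in M. norm (F z) \<le> norm (1 + (norm (F z))\<^sup>2)"
    by (intro AE_I2) (use le_one_plus_square in auto)
qed (use assms in \<open>auto simp: sq_integrable_def\<close>)

lemma Cauchy_Schwarz_integral:
  fixes u v :: "'a \<Rightarrow> real"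
  assumes [measurable]: "u \<in> borel_measurable M" "v \<in> borel_measurable M"
    and u: "integrable M (\<lambda>x. (u x)\<^sup>2)" and v: "integrable M (\<lambda>x. (v x)\<^sup>2)"
  shows "integrable M (\<lambda>x. u x * v x)"
    and "(LINT x|M. \<bar>u x * v x\<bar>) \<le> sqrt (LINT x|M. (u x)\<^sup>2) * sqrt (LINT x|M. (v x)\<^sup>2)"
proof -
  have bd: "\<bar>a * b\<bar> \<le> a\<^sup>2 + b\<^sup>2" for a b :: real
  proof -
    have "0 \<le> (\<bar>a\<bar> - \<bar>b\<bar>)\<^sup>2" "0 \<le> \<bar>a\<bar> * \<bar>b\<bar>" by auto
    then show ?thesis by (simp only: power2_diff abs_mult power2_abs)
  qed
  show int: "integrable M (\<lambda>x. u x * v x)"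
    by (rule Bochner_Integration.integrable_bound[OF Bochner_Integration.integrable_add[OF u v]])
       (use bd in auto)
  have "(\<integral>\<^sup>+x. ennreal \<bar>u x\<bar> * ennreal \<bar>v x\<bar> \<partial>M)\<^sup>2 \<le> (\<integral>\<^sup>+x. (ennreal \<bar>u x\<bar>)\<^sup>2 \<partial>M) * (\<integral>\<^sup>+x. (ennreal \<bar>v x\<bar>)\<^sup>2 \<partial>M)"
    by (rule Cauchy_Schwarz_nn_integral) measurable
  also have "(\<integral>\<^sup>+x. ennreal \<bar>u x\<bar> * ennreal \<bar>v x\<bar> \<partial>M) = ennreal (LINT x|M. \<bar>u x * v x\<bar>)"
    using integrable_abs[OF int] by (subst nn_integral_eq_integral[symmetric]) (auto simp: abs_mult ennreal_mult)
  also have "(\<integral>\<^sup>+x. (ennreal \<bar>u x\<bar>)\<^sup>2 \<partial>M) = ennreal (LINT x|M. (u x)\<^sup>2)"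
    using u by (subst nn_integral_eq_integral[symmetric]) (auto simp: ennreal_power)
  also have "(\<integral>\<^sup>+x. (ennreal \<bar>v x\<bar>)\<^sup>2 \<partial>M) = ennreal (LINT x|M. (v x)\<^sup>2)"
    using v by (subst nn_integral_eq_integral[symmetric]) (auto simp: ennreal_power)
  finally have "(LINT x|M. \<bar>u x * v x\<bar>)\<^sup>2 \<le> (LINT x|M. (u x)\<^sup>2) * (LINT x|M. (v x)\<^sup>2)"
    by (simp add: ennreal_power flip: ennreal_mult)
  then show "(LINT x|M. \<bar>u x * v x\<bar>) \<le> sqrt (LINT x|M. (u x)\<^sup>2) * sqrt (LINT x|M. (v x)\<^sup>2)"
    by (simp add: real_le_rsqrt flip: real_sqrt_mult)
qed

lemma (in prob_space) norm_integral_le_L2: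
  assumes F: "sq_integrable M F"
  shows "(LINT z|M. norm (F z)) \<le> sqrt (LINT z|M. (norm (F z))\<^sup>2)"
  using Cauchy_Schwarz_integral(2)[of "\<lambda>z. norm (F z)" M "\<lambda>_. 1"] F
  by (simp add: sq_integrable_def prob_space)

lemma orthonormal_sum_norm:
  fixes u :: "'i \<Rightarrow> 'a \<Rightarrow> complex"
  assumes fin: "finite X"
    and int: "\<And>k l. k \<in> X \<Longrightarrow> l \<in> X \<Longrightarrow> integrable M (\<lambda>z. u k z * cnj (u l z))"
    and orth: "\<And>k l. k \<in> X \<Longrightarrow> l \<in> X \<Longrightarrow> (LINT z|M. u k z * cnj (u l z)) = of_bool (k = l)"
  shows "integrable M (\<lambda>z. (norm (\<Sum>k\<in>X. c k * u k z))\<^sup>2)"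
    and "(LINT z|M. (norm (\<Sum>k\<in>X. c k * u k z))\<^sup>2) = (\<Sum>k\<in>X. (norm (c k))\<^sup>2)"
proof -
  have eq: "complex_of_real ((norm (\<Sum>k\<in>X. c k * u k z))\<^sup>2) = (\<Sum>k\<in>X. \<Sum>l\<in>X. (c k * cnj (c l)) * (u k z * cnj (u l z)))" for z
    unfolding complex_norm_square by (simp add: sum_product mult_ac)
  have i: "integrable M (\<lambda>z. complex_of_real ((norm (\<Sum>k\<in>X. c k * u k z))\<^sup>2))"
    unfolding eq by (intro Bochner_Integration.integrable_sum integrable_mult_right int)
  from integrable_Re[OF i] show "integrable M (\<lambda>z. (norm (\<Sum>k\<in>X. c k * u k z))\<^sup>2)" by simp
  have "complex_of_real (LINT z|M. (norm (\<Sum>k\<in>X. c k * u k z))\<^sup>2) = (LINT z|M. complex_of_real ((norm (\<Sum>k\<in>X. c k * u k z))\<^sup>2))"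
    by (rule integral_complex_of_real[symmetric])
  also have "\<dots> = (\<Sum>k\<in>X. \<Sum>l\<in>X. (c k * cnj (c l)) * of_bool (k = l))"
    unfolding eq by (simp add: int orth integrable_mult_right Bochner_Integration.integral_sum)
  also have "\<dots> = (\<Sum>k\<in>X. c k * cnj (c k))"
    using fin by (intro sum.cong refl) (simp add: of_bool_def if_distrib[of "\<lambda>x. _ * x"] cong: if_cong)
  also have "\<dots> = complex_of_real (\<Sum>k\<in>X. (norm (c k))\<^sup>2)"
    by (simp only: complex_norm_square of_real_sum)
  finally show "(LINT z|M. (norm (\<Sum>k\<in>X. c k * u k z))\<^sup>2) = (\<Sum>k\<in>X. (norm (c k))\<^sup>2)"
    by (simp only: of_real_eq_iff)
qed

section \<open>L2 limits and completeness\<close>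

lemma L2_tendsto_integral:
  assumes M: "prob_space M" and F: "\<And>n. sq_integrable M (F n)" and G: "sq_integrable M G"
    and lim: "(\<lambda>n. LINT z|M. (norm (G z - F n z))\<^sup>2) \<longlonglongrightarrow> 0"
    and u [measurable]: "u \<in> borel_measurable M" and u1: "\<And>z. norm (u z) \<le> 1"
  shows "(\<lambda>n. LINT z|M. u z * F n z) \<longlonglongrightarrow> (LINT z|M. u z * G z)"
proof -
  interpret prob_space M by fact
  have int: "integrable M (\<lambda>z. u z * H z)" if "sq_integrable M H" for H
    by (rule sq_integrable_imp_integrable[OF sq_integrable_mult_bounded[OF that u u1]])
  have bd: "norm ((LINT z|M. u z * F n z) - (LINT z|M. u z * G z)) \<le> sqrt (LINT z|M. (norm (G z - F n z))\<^sup>2)" for n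
  proof -
    have d: "sq_integrable M (\<lambda>z. G z - F n z)" by (intro sq_integrable_diff F G)
    have "(LINT z|M. u z * F n z) - (LINT z|M. u z * G z) = (LINT z|M. u z * (F n z - G z))"
      using int[OF F[of n]] int[OF G] by (simp add: right_diff_distrib)
    also have "norm \<dots> \<le> (LINT z|M. norm (u z * (F n z - G z)))"
      by (rule integral_norm_bound)
    also have "\<dots> \<le> (LINT z|M. norm (G z - F n z))"
    proof (rule integral_mono)
      show "integrable M (\<lambda>z. norm (u z * (F n z - G z)))"
        by (intro integrable_norm int sq_integrable_diff F G)
      show "norm (u z * (F n z - G z)) \<le> norm (G z - F n z)" for z
        using u1[of z] by (simp add: norm_mult norm_minus_commute mult_left_le_one_le)
    qed (intro integrable_norm sq_integrable_imp_integrable d)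
    also have "\<dots> \<le> sqrt (LINT z|M. (norm (G z - F n z))\<^sup>2)"
      by (rule norm_integral_le_L2[OF d])
    finally show ?thesis .
  qed
  have "(\<lambda>n. sqrt (LINT z|M. (norm (G z - F n z))\<^sup>2)) \<longlonglongrightarrow> 0"
    using tendsto_real_sqrt[OF lim] by simp
  with always_eventually[OF allI[OF bd]]
  have "(\<lambda>n. (LINT z|M. u z * F n z) - (LINT z|M. u z * G z)) \<longlonglongrightarrow> 0"
    by (rule Lim_null_comparison)
  then show ?thesis by (simp add: LIM_zero_iff)
qed

lemma L2_tendsto_norm:
  assumes F: "\<And>n. sq_integrable M (F n)" and G: "sq_integrable M G"
    and lim: "(\<lambda>n. LINT z|M. (norm (G z - F n z))\<^sup>2) \<longlonglongrightarrow> 0"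
  shows "(\<lambda>n. LINT z|M. (norm (F n z))\<^sup>2) \<longlonglongrightarrow> (LINT z|M. (norm (G z))\<^sup>2)"
proof -
  define d where "d n = (LINT z|M. (norm (G z - F n z))\<^sup>2)" for n
  let ?g = "LINT z|M. (norm (G z))\<^sup>2"
  have [measurable]: "\<And>n. F n \<in> borel_measurable M" "G \<in> borel_measurable M"
    using F G by (auto simp: sq_integrable_def)
  have bd: "norm ((LINT z|M. (norm (F n z))\<^sup>2) - ?g) \<le> d n + 2 * (sqrt (d n) * sqrt ?g)" for n
  proof -
    have D: "sq_integrable M (\<lambda>z. G z - F n z)" by (intro sq_integrable_diff F G)
    have pt: "\<bar>(norm a)\<^sup>2 - (norm b)\<^sup>2\<bar> \<le> (norm (b - a))\<^sup>2 + 2 * \<bar>norm (b - a) * norm b\<bar>" for a b :: complex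
    proof -
      have "(norm a)\<^sup>2 - (norm b)\<^sup>2 = (norm a - norm b) * (norm a + norm b)"
        by (simp add: power2_eq_square algebra_simps)
      then have "\<bar>(norm a)\<^sup>2 - (norm b)\<^sup>2\<bar> = \<bar>norm a - norm b\<bar> * (norm a + norm b)"
        by (simp add: abs_mult)
      also have "\<dots> \<le> norm (b - a) * (norm (b - a) + 2 * norm b)"
      proof (intro mult_mono)
        show "\<bar>norm a - norm b\<bar> \<le> norm (b - a)"
          by (metis norm_minus_commute norm_triangle_ineq3)
        show "norm a + norm b \<le> norm (b - a) + 2 * norm b"
          using norm_triangle_sub[of a b] by (simp add: norm_minus_commute)
      qed auto
      finally show ?thesis by (simp add: power2_eq_square algebra_simps)
    qed
    have i1: "integrable M (\<lambda>z. (norm (F n z))\<^sup>2)" and i2: "integrable M (\<lambda>z. (norm (G z))\<^sup>2)"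
      and i3: "integrable M (\<lambda>z. (norm (G z - F n z))\<^sup>2)"
      using F G D by (auto simp: sq_integrable_def)
    note cs = Cauchy_Schwarz_integral[of "\<lambda>z. norm (G z - F n z)" M "\<lambda>z. norm (G z)", OF _ _ i3 i2]
    have "(LINT z|M. (norm (F n z))\<^sup>2) - ?g = (LINT z|M. (norm (F n z))\<^sup>2 - (norm (G z))\<^sup>2)"
      using i1 i2 by simp
    also have "\<bar>\<dots>\<bar> \<le> (LINT z|M. \<bar>(norm (F n z))\<^sup>2 - (norm (G z))\<^sup>2\<bar>)"
      using integral_norm_bound[of M "\<lambda>z. (norm (F n z))\<^sup>2 - (norm (G z))\<^sup>2"] by simp
    also have "\<dots> \<le> (LINT z|M. (norm (G z - F n z))\<^sup>2 + 2 * \<bar>norm (G z - F n z) * norm (G z)\<bar>)"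
      using i1 i2 i3 cs(1)[THEN integrable_abs] pt
      by (intro integral_mono) (auto intro!: integrable_abs Bochner_Integration.integrable_add Bochner_Integration.integrable_diff)
    also have "\<dots> = d n + 2 * (LINT z|M. \<bar>norm (G z - F n z) * norm (G z)\<bar>)"
      using i3 cs(1)[THEN integrable_abs] unfolding d_def
      by (subst Bochner_Integration.integral_add) auto
    also have "\<dots> \<le> d n + 2 * (sqrt (d n) * sqrt ?g)"
      using cs(2) by (simp add: d_def)
    finally show ?thesis by simp
  qed
  have "(\<lambda>n. d n + 2 * (sqrt (d n) * sqrt ?g)) \<longlonglongrightarrow> 0 + 2 * (sqrt 0 * sqrt ?g)"
    using lim unfolding d_def by (intro tendsto_intros)
  then have "(\<lambda>n. d n + 2 * (sqrt (d n) * sqrt ?g)) \<longlonglongrightarrow> 0" by simp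
  with always_eventually[OF allI[OF bd]]
  have "(\<lambda>n. (LINT z|M. (norm (F n z))\<^sup>2) - ?g) \<longlonglongrightarrow> 0"
    by (rule Lim_null_comparison)
  then show ?thesis by (simp add: LIM_zero_iff)
qed

text \<open>The Riesz-Fischer theorem, keeping the almost everywhere convergent subsequence: L2
  convergence of the full sequence transports coefficients and norms, while the subsequence
  transports pointwise bounds to the limit.\<close>

lemma L2_Cauchy_converges:
  fixes F :: "nat \<Rightarrow> 'a \<Rightarrow> complex"
  assumes M: "finite_measure M" and F: "\<And>n. sq_integrable M (F n)"
    and Cauchy: "\<And>e. e > 0 \<Longrightarrow> \<exists>n0. \<forall>m\<ge>n0. \<forall>n\<ge>n0. (LINT z|M. (norm (F m z - F n z))\<^sup>2) \<le> e"
  obtains G r where "sq_integrable M G" "strict_mono (r :: nat \<Rightarrow> nat)" "AE z in M. (\<lambda>n. F (r n) z) \<longlonglongrightarrow> G z"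
    "(\<lambda>n. LINT z|M. (norm (G z - F n z))\<^sup>2) \<longlonglongrightarrow> 0"
proof -
  interpret finite_measure M by fact
  have [measurable]: "\<And>n. F n \<in> borel_measurable M"
    using F by (auto simp: sq_integrable_def)
  obtain n0 where n0: "\<And>e m n. e > 0 \<Longrightarrow> m \<ge> n0 e \<Longrightarrow> n \<ge> n0 e \<Longrightarrow> (LINT z|M. (norm (F m z - F n z))\<^sup>2) \<le> e"
    using Cauchy by metis
  \<comment> \<open>Summing the thresholds dominates each of them, and the successors make the
    sequence strictly increasing.\<close>
  define r where "r n = (\<Sum>j\<le>n. Suc (n0 ((1/4)^j)))" for n
  have r_ge: "n0 ((1/4)^n) \<le> r n" for n
    unfolding r_def using member_le_sum[of n "{..n}" "\<lambda>j. Suc (n0 ((1/4)^j))"] by simp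
  have r: "strict_mono r"
    by (rule strict_mono_Suc_iff[THEN iffD2]) (simp add: r_def)
  have step: "(LINT z|M. (norm (F (r (Suc n)) z - F (r n) z))\<^sup>2) \<le> (1/4)^n" for n
    using r_ge[of n] strict_monoD[OF r, of n "Suc n"] by (intro n0) auto
  define D where "D n z = F (r (Suc n)) z - F (r n) z" for n z
  have D: "sq_integrable M (D n)" for n
    unfolding D_def by (intro sq_integrable_diff F)
  have [measurable]: "D n \<in> borel_measurable M" for n
    using D by (simp add: sq_integrable_def)
  have "(\<integral>\<^sup>+z. (\<Sum>n. ennreal (norm (D n z))) \<partial>M) = (\<Sum>n. \<integral>\<^sup>+z. ennreal (norm (D n z)) \<partial>M)"
    by (rule nn_integral_suminf) measurable
  also have "\<dots> \<le> (\<Sum>n. ennreal ((1/2)^n * (1 + measure M (space M))))"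
  proof (intro suminf_le summableI)
    fix n
    \<comment> \<open>Weighted so that a mean square of at most 4^(-n) makes both terms of order
      2^(-n), hence summable.\<close>
    have pt: "x \<le> 2^n * x\<^sup>2 + (1/2)^n" for x :: real
    proof -
      have "0 \<le> (2^n * x - 1)\<^sup>2" "0 \<le> (2^n * x)\<^sup>2" by auto
      then have "2^n * x \<le> 2^n * (2^n * x\<^sup>2) + 1"
        by (simp add: power2_eq_square algebra_simps)
      then have "2^n * x \<le> 2^n * (2^n * x\<^sup>2 + (1/2)^n)"
        by (simp add: distrib_left power_one_over)
      then show ?thesis by simp
    qed
    have "(\<integral>\<^sup>+z. ennreal (norm (D n z)) \<partial>M) = ennreal (LINT z|M. norm (D n z))"
      using sq_integrable_imp_integrable[OF D[of n]] by (intro nn_integral_eq_integral) auto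
    also have "(LINT z|M. norm (D n z)) \<le> (LINT z|M. 2^n * (norm (D n z))\<^sup>2 + (1/2)^n)"
      using sq_integrable_imp_integrable[OF D[of n]] D[of n] pt
      by (intro integral_mono) (auto simp: sq_integrable_def)
    also have "\<dots> = 2^n * (LINT z|M. (norm (D n z))\<^sup>2) + (1/2)^n * measure M (space M)"
      using D[of n] by (simp add: sq_integrable_def)
    also have "\<dots> \<le> 2^n * (1/4)^n + (1/2)^n * measure M (space M)"
      using step[of n] by (simp add: D_def)
    also have "2^n * (1/4)^n = ((1/2)::real)^n"
      by (simp flip: power_mult_distrib)
    finally show "(\<integral>\<^sup>+z. ennreal (norm (D n z)) \<partial>M) \<le> ennreal ((1/2)^n * (1 + measure M (space M)))"
      by (simp add: ennreal_leI distrib_left)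
  qed
  also have "\<dots> = ennreal (\<Sum>n. (1/2)^n * (1 + measure M (space M)))"
    by (intro suminf_ennreal2 summable_mult2) (auto intro: summable_geometric)
  finally have fin: "(\<integral>\<^sup>+z. (\<Sum>n. ennreal (norm (D n z))) \<partial>M) \<noteq> \<infinity>"
    by (auto simp: top_unique)
  have "AE z in M. (\<Sum>n. ennreal (norm (D n z))) \<noteq> \<infinity>"
    by (rule nn_integral_noteq_infinite[OF _ fin]) measurable
  then have conv: "AE z in M. convergent (\<lambda>n. F (r n) z)"
  proof eventually_elim
    case (elim z)
    then have "summable (\<lambda>n. norm (D n z))"
      by (intro summable_suminf_not_top) auto
    then have "summable (\<lambda>n. D n z)" by (rule summable_norm_cancel)
    then have "convergent (\<lambda>n. (\<Sum>j<n. D j z) + F (r 0) z)"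
      by (intro convergent_add convergent_const) (simp add: summable_iff_convergent)
    moreover have "(\<Sum>j<n. D j z) + F (r 0) z = F (r n) z" for n
      unfolding D_def by (subst sum_lessThan_telescope) simp
    ultimately show ?case by simp
  qed
  define G where "G z = lim (\<lambda>n. F (r n) z)" for z
  have [measurable]: "G \<in> borel_measurable M"
    unfolding G_def by measurable
  have lim: "AE z in M. (\<lambda>n. F (r n) z) \<longlonglongrightarrow> G z"
    using conv by eventually_elim (simp add: G_def convergent_LIMSEQ_iff)
  \<comment> \<open>Fatou's lemma with n fixed and the other index running through the subsequence
    turns the Cauchy bound into a bound on the distance to the limit, for the full sequence.\<close>
  have bound: "(\<integral>\<^sup>+z. ennreal ((norm (G z - F n z))\<^sup>2) \<partial>M) \<le> ennreal e" if e: "e > 0" "n \<ge> n0 e" for e n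
  proof -
    have "(\<integral>\<^sup>+z. ennreal ((norm (G z - F n z))\<^sup>2) \<partial>M) = (\<integral>\<^sup>+z. liminf (\<lambda>k. ennreal ((norm (F (r k) z - F n z))\<^sup>2)) \<partial>M)"
    proof (rule nn_integral_cong_AE)
      show "AE z in M. ennreal ((norm (G z - F n z))\<^sup>2) = liminf (\<lambda>k. ennreal ((norm (F (r k) z - F n z))\<^sup>2))"
        using lim
      proof eventually_elim
        case (elim z)
        then have "(\<lambda>k. ennreal ((norm (F (r k) z - F n z))\<^sup>2)) \<longlonglongrightarrow> ennreal ((norm (G z - F n z))\<^sup>2)"
          by (intro tendsto_intros tendsto_ennrealI)
        then show ?case by (rule lim_imp_Liminf[OF sequentially_bot, symmetric])
      qed
    qed
    also have "\<dots> \<le> liminf (\<lambda>k. \<integral>\<^sup>+z. ennreal ((norm (F (r k) z - F n z))\<^sup>2) \<partial>M)"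
      by (rule nn_integral_liminf) measurable
    also have "\<dots> \<le> liminf (\<lambda>k. ennreal e)"
    proof (rule Liminf_mono, rule eventually_sequentiallyI[of "n0 e"])
      fix k assume "n0 e \<le> k"
      then have "n0 e \<le> r k" using seq_suble[OF r, of k] by simp
      then show "(\<integral>\<^sup>+z. ennreal ((norm (F (r k) z - F n z))\<^sup>2) \<partial>M) \<le> ennreal e"
        using n0[OF e(1) _ e(2)] by (subst sq_integrable_nn_integral) (auto intro!: sq_integrable_diff F ennreal_leI)
    qed
    also have "\<dots> = ennreal e" by (simp add: Liminf_const)
    finally show ?thesis .
  qed
  have dG: "sq_integrable M (\<lambda>z. G z - F (n0 1) z)"
    unfolding sq_integrable_iff_finite using bound[of 1 "n0 1"] by (auto simp: order.strict_trans1)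
  from sq_integrable_add[OF this F[of "n0 1"]] have G: "sq_integrable M G" by simp
  show ?thesis
  proof (rule that[OF G r lim])
    show "(\<lambda>n. LINT z|M. (norm (G z - F n z))\<^sup>2) \<longlonglongrightarrow> 0"
    proof (rule LIMSEQ_I)
      fix e :: real assume e: "e > 0"
      have "norm ((LINT z|M. (norm (G z - F n z))\<^sup>2) - 0) < e" if "n \<ge> n0 (e/2)" for n
        using bound[of "e/2" n] that e
        by (subst (asm) sq_integrable_nn_integral) (auto intro!: sq_integrable_diff F G)
      then show "\<exists>no. \<forall>n\<ge>no. norm ((LINT z|M. (norm (G z - F n z))\<^sup>2) - 0) < e"
        by blast
    qed
  qed
qed

subsection \<open>The Zak transform\<close>

lemma nn_integral_IU_shift:
  fixes h :: "real \<Rightarrow> ennreal"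
  assumes [measurable]: "h \<in> borel_measurable borel"
  shows "(\<integral>\<^sup>+x. h (x + of_int k) \<partial>IU) = (\<integral>\<^sup>+t. indicator {of_int k..<of_int k + 1} t * h t \<partial>lborel)"
proof -
  have "(\<integral>\<^sup>+x. h (x + of_int k) \<partial>IU) = (\<integral>\<^sup>+x. indicator {0..<1} x * h (x + of_int k) \<partial>lborel)"
    by (subst nn_integral_IU) auto
  also have "\<dots> = (\<integral>\<^sup>+x. indicator {of_int k..<of_int k + 1} (of_int k + 1 * x) * h (of_int k + 1 * x) \<partial>lborel)"
    by (intro nn_integral_cong) (auto simp: add.commute split: split_indicator)
  also have "\<dots> = (\<integral>\<^sup>+t. indicator {of_int k..<of_int k + 1} t * h t \<partial>lborel)"
    using nn_integral_real_affine[of "\<lambda>t. indicator {of_int k..<of_int k + 1} t * h t" 1 "of_int k"] by simp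
  finally show ?thesis .
qed

lemma sum_indicator_unit_intervals:
  "(\<Sum>k\<in>{- int N..<int N}. indicator {of_int k..<of_int k + 1} t) = (indicator {- real N..<real N} t :: ennreal)"
proof -
  have "(\<Sum>k\<in>{- int N..<int N}. indicator {of_int k..<of_int k + 1} t) = (\<Sum>k\<in>{- int N..<int N}. of_bool (k = \<lfloor>t\<rfloor>) :: ennreal)"
  proof (intro sum.cong refl)
    fix k :: int
    have "t \<in> {of_int k..<of_int k + 1} \<longleftrightarrow> k = \<lfloor>t\<rfloor>"
      using floor_eq_iff[of t k] by auto
    then show "indicator {of_int k..<of_int k + 1} t = (of_bool (k = \<lfloor>t\<rfloor>) :: ennreal)"
      by (simp add: indicator_def)
  qed
  also have "\<dots> = of_bool (\<lfloor>t\<rfloor> \<in> {- int N..<int N})"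
    by (simp add: of_bool_def)
  also have "\<lfloor>t\<rfloor> \<in> {- int N..<int N} \<longleftrightarrow> t \<in> {- real N..<real N}"
    by (auto simp: le_floor_iff floor_less_iff)
  finally show ?thesis by (simp add: indicator_def)
qed

lemma sum_nn_integral_IU_shift:
  assumes [measurable]: "h \<in> borel_measurable borel"
  shows "(\<Sum>k\<in>{- int N..<int N}. \<integral>\<^sup>+x. h (x + of_int k) \<partial>IU) = (\<integral>\<^sup>+t. indicator {- real N..<real N} t * h t \<partial>lborel)"
proof -
  have "(\<Sum>k\<in>{- int N..<int N}. \<integral>\<^sup>+x. h (x + of_int k) \<partial>IU)
      = (\<integral>\<^sup>+t. (\<Sum>k\<in>{- int N..<int N}. indicator {of_int k..<of_int k + 1} t * h t) \<partial>lborel)"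
    unfolding nn_integral_IU_shift[OF assms] by (rule nn_integral_sum[symmetric]) measurable
  also have "\<dots> = (\<integral>\<^sup>+t. indicator {- real N..<real N} t * h t \<partial>lborel)"
    by (simp only: sum_distrib_right[symmetric] sum_indicator_unit_intervals)
  finally show ?thesis .
qed

lemma LIMSEQ_sum_nn_integral_IU:
  assumes [measurable]: "h \<in> borel_measurable borel"
  shows "(\<lambda>N. \<Sum>k\<in>{- int N..<int N}. \<integral>\<^sup>+x. h (x + of_int k) \<partial>IU) \<longlonglongrightarrow> (\<integral>\<^sup>+t. h t \<partial>lborel)"
  unfolding sum_nn_integral_IU_shift[OF assms]
proof (rule nn_integral_LIMSEQ)
  show "incseq (\<lambda>N t. indicator {- real N..<real N} t * h t)"
    by (auto simp: incseq_def le_fun_def split: split_indicator)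
  show "(\<lambda>N. indicator {- real N..<real N} t * h t) \<longlonglongrightarrow> h t" for t
  proof (rule tendsto_eventually)
    obtain n0 where n0: "\<bar>t\<bar> < real n0" using reals_Archimedean2 by blast
    show "\<forall>\<^sub>F N in sequentially. indicator {- real N..<real N} t * h t = h t"
      by (rule eventually_sequentiallyI[of n0]) (use n0 in \<open>auto split: split_indicator\<close>)
  qed
qed measurable

lemma sq_integrable_shift:
  assumes "sq_integrable lborel f"
  shows "sq_integrable IU (\<lambda>x. f (x + of_int k))"
  unfolding sq_integrable_iff_finite
proof
  have [measurable]: "f \<in> borel_measurable borel" using assms by (simp add: sq_integrable_def)
  then show "(\<lambda>x. f (x + of_int k)) \<in> borel_measurable IU" by measurable
  have "(\<integral>\<^sup>+x. ennreal ((norm (f (x + of_int k)))\<^sup>2) \<partial>IU) = (\<integral>\<^sup>+t. indicator {of_int k..<of_int k + 1} t * ennreal ((norm (f t))\<^sup>2) \<partial>lborel)"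
    by (rule nn_integral_IU_shift) measurable
  also have "\<dots> \<le> (\<integral>\<^sup>+t. ennreal ((norm (f t))\<^sup>2) \<partial>lborel)"
    by (intro nn_integral_mono) (auto split: split_indicator)
  also have "\<dots> < \<infinity>" using assms by (simp add: sq_integrable_iff_finite)
  finally show "(\<integral>\<^sup>+x. ennreal ((norm (f (x + of_int k)))\<^sup>2) \<partial>IU) < \<infinity>" .
qed

section \<open>Orthogonality of the characters\<close>

lemma integral_QU_product:
  fixes u v :: "real \<Rightarrow> complex"
  assumes u: "integrable IU u" and v: "integrable IU v"
  shows "integrable QU (\<lambda>z. u (fst z) * v (snd z))"
    and "(LINT z|QU. u (fst z) * v (snd z)) = (LINT x|IU. u x) * (LINT y|IU. v y)"
proof -
  have [measurable]: "u \<in> borel_measurable borel" "v \<in> borel_measurable borel"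
    using borel_measurable_integrable[OF u] borel_measurable_integrable[OF v] by simp_all
  have meas: "(\<lambda>z. u (fst z) * v (snd z)) \<in> borel_measurable (IU \<Otimes>\<^sub>M IU)" by measurable
  show int: "integrable QU (\<lambda>z. u (fst z) * v (snd z))"
    unfolding QU_def
  proof (rule QU.Fubini_integrable[OF meas])
    show "integrable IU (\<lambda>x. LINT y|IU. norm (u (fst (x, y)) * v (snd (x, y))))"
      using u by (simp add: norm_mult)
    show "AE x in IU. integrable IU (\<lambda>y. u (fst (x, y)) * v (snd (x, y)))"
      using v by simp
  qed
  show "(LINT z|QU. u (fst z) * v (snd z)) = (LINT x|IU. u x) * (LINT y|IU. v y)"
    using QU.integral_fst'[OF int[unfolded QU_def]] u v by (simp add: QU_def)
qed

lemma integrable_ee [simp]: "integrable IU (\<lambda>x. ee (c * x))"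
  by (rule IU.integrable_const_bound[of _ 1]) auto

lemma integral_trig_mono: "(LINT z|QU. trig_mono i z) = of_bool (i = (0, 0))"
proof -
  have eq: "trig_mono i = (\<lambda>z. ee (of_int (snd i) * fst z) * ee (of_int (- fst i) * snd z))"
    by (simp add: trig_mono_def ee_diff fun_eq_iff)
  have "(LINT z|QU. trig_mono i z) = of_bool (snd i = 0) * of_bool (- fst i = 0)"
    unfolding eq integral_QU_product(2)[OF integrable_ee integrable_ee] integral_ee ..
  then show ?thesis by (cases i) auto
qed

lemma integral_norm_trig_sum:
  assumes "finite S"
  shows "(LINT z|QU. (norm (\<Sum>i\<in>S. a i * trig_mono i z))\<^sup>2) = (\<Sum>i\<in>S. (norm (a i))\<^sup>2)"
proof (rule orthonormal_sum_norm(2)[OF assms])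
  fix k l :: "int \<times> int"
  have eq: "trig_mono k z * cnj (trig_mono l z) = trig_mono (fst k - fst l, snd k - snd l) z" for z
    by (simp add: cnj_trig_mono trig_mono_mult)
  show "integrable QU (\<lambda>z. trig_mono k z * cnj (trig_mono l z))"
    unfolding eq by (rule Q.integrable_const_bound[of _ 1]) auto
  show "(LINT z|QU. trig_mono k z * cnj (trig_mono l z)) = of_bool (k = l)"
    unfolding eq integral_trig_mono by (auto simp: prod_eq_iff)
qed

lemma integral_norm_ee_sum:
  assumes X: "finite X" "inj_on \<phi> X"
  shows "integrable IU (\<lambda>y. (norm (\<Sum>k\<in>X. c k * ee (of_int (\<phi> k) * y)))\<^sup>2)"
    and "(LINT y|IU. (norm (\<Sum>k\<in>X. c k * ee (of_int (\<phi> k) * y)))\<^sup>2) = (\<Sum>k\<in>X. (norm (c k))\<^sup>2)"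
proof -
  have eq: "ee (of_int (\<phi> k) * y) * cnj (ee (of_int (\<phi> l) * y)) = ee (of_int (\<phi> k - \<phi> l) * y)" for k l y
    by (simp add: cnj_ee left_diff_distrib ee_diff)
  have int: "integrable IU (\<lambda>y. ee (of_int (\<phi> k) * y) * cnj (ee (of_int (\<phi> l) * y)))" for k l
    unfolding eq by simp
  have orth: "(LINT y|IU. ee (of_int (\<phi> k) * y) * cnj (ee (of_int (\<phi> l) * y))) = of_bool (k = l)"
    if "k \<in> X" "l \<in> X" for k l
    unfolding eq integral_ee using inj_on_eq_iff[OF X(2) that] by auto
  show "integrable IU (\<lambda>y. (norm (\<Sum>k\<in>X. c k * ee (of_int (\<phi> k) * y)))\<^sup>2)"
    by (rule orthonormal_sum_norm(1)[OF X(1) int orth])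
  show "(LINT y|IU. (norm (\<Sum>k\<in>X. c k * ee (of_int (\<phi> k) * y)))\<^sup>2) = (\<Sum>k\<in>X. (norm (c k))\<^sup>2)"
    by (rule orthonormal_sum_norm(2)[OF X(1) int orth])
qed

section \<open>Partial sums and formal properties of the Zak transform\<close>

definition zak_sum :: "int \<Rightarrow> (real \<Rightarrow> complex) \<Rightarrow> int set \<Rightarrow> real \<times> real \<Rightarrow> complex" where
  "zak_sum s f X z = (\<Sum>k\<in>X. f (fst z + of_int k) * ee (of_int (s * k) * snd z))"

text \<open>The Zak transform, characterised by its double Fourier coefficients; s is 1 or -1, the sign of the
  frequency in the series over f (x + k) exp (2 pi i s k y).\<close>

definition zak :: "int \<Rightarrow> (real \<Rightarrow> complex) \<Rightarrow> (real \<times> real \<Rightarrow> complex) \<Rightarrow> bool" where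
  "zak s f F \<longleftrightarrow> sq_integrable QU F \<and> (\<forall>k n. (LINT z|QU. trig_mono (s * k, n) z * F z)
      = (LINT x|IU. ee (of_int n * x) * f (x + of_int k)))"

lemma sq_integrable_ee_mult:
  "sq_integrable IU f \<Longrightarrow> sq_integrable IU (\<lambda>x. ee (c * x) * f x)"
  by (rule sq_integrable_mult_bounded[of _ _ _ 1]) auto

lemma integrable_ee_shift:
  "sq_integrable lborel f \<Longrightarrow> integrable IU (\<lambda>x. ee (c * x) * f (x + of_int k))"
  by (intro IU.sq_integrable_imp_integrable sq_integrable_ee_mult sq_integrable_shift)

lemma integrable_trig_mono_mult:
  "sq_integrable QU F \<Longrightarrow> integrable QU (\<lambda>z. trig_mono i z * F z)"
  by (intro Q.sq_integrable_imp_integrable sq_integrable_mult_bounded[of _ _ _ 1]) auto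

lemma zak_unique:
  assumes s: "\<bar>s\<bar> = 1" and F: "zak s f F" and F': "zak s f F'"
  shows "AE z in QU. F z = F' z"
proof -
  have "AE z in QU. F z - F' z = 0"
  proof (rule trig_coeffs_zero_imp_AE_zero)
    show "integrable QU (\<lambda>z. F z - F' z)"
      using F F' by (intro Q.sq_integrable_imp_integrable sq_integrable_diff) (auto simp: zak_def)
    fix i :: "int \<times> int"
    \<comment> \<open>Since s is 1 or -1, every frequency has the form \<open>(s * k, n)\<close>, so
      the prescribed coefficients are all of them.\<close>
    have "i = (s * (s * fst i), snd i)"
      using s by (auto simp: abs_eq_iff[of s 1, simplified] prod_eq_iff)
    then have "(LINT z|QU. trig_mono i z * F z) = (LINT z|QU. trig_mono i z * F' z)"
      using F F' unfolding zak_def by metis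
    then show "(LINT z|QU. trig_mono i z * (F z - F' z)) = 0"
      using F F' by (simp add: right_diff_distrib integrable_trig_mono_mult zak_def)
  qed
  then show ?thesis by eventually_elim simp
qed

lemma zak_add:
  assumes "sq_integrable lborel f" "sq_integrable lborel f'" "zak s f F" "zak s f' F'"
  shows "zak s (\<lambda>t. f t + f' t) (\<lambda>z. F z + F' z)"
  using assms unfolding zak_def
  by (simp add: sq_integrable_add distrib_left integrable_trig_mono_mult integrable_ee_shift)

lemma zak_cmult: "zak s f F \<Longrightarrow> zak s (\<lambda>t. c * f t) (\<lambda>z. c * F z)"
  unfolding zak_def by (simp add: sq_integrable_cmult mult.left_commute[of _ c])

lemma zak_diff:
  assumes "sq_integrable lborel f" "sq_integrable lborel f'" "zak s f F" "zak s f' F'"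
  shows "zak s (\<lambda>t. f t - f' t) (\<lambda>z. F z - F' z)"
  using zak_add[OF assms(1) sq_integrable_cmult[OF assms(2), of "-1"] assms(3) zak_cmult[OF assms(4), of "-1"]]
  by simp

lemma zak_0: "zak s (\<lambda>t. 0) (\<lambda>z. 0)"
  by (simp add: zak_def)

lemma zak_finite_sum:
  assumes "\<And>i. i \<in> S \<Longrightarrow> sq_integrable lborel (f i)" "\<And>i. i \<in> S \<Longrightarrow> zak s (f i) (F i)"
  shows "zak s (\<lambda>t. \<Sum>i\<in>S. f i t) (\<lambda>z. \<Sum>i\<in>S. F i z)"
  using assms by (induction S rule: infinite_finite_induct) (simp_all add: zak_0 zak_add sq_integrable_sum)

text \<open>On the double coefficients a translation shifts k and a modulation shifts n; the
  leftover phase \<open>ee (n * k)\<close> is 1. Gabor sums thereby become trigonometric polynomials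
  times one fixed function.\<close>

lemma zak_modulate_translate:
  assumes F: "zak (- 1) f F"
  shows "zak (- 1) (\<lambda>t. ee (of_int n * t) * f (t - of_int m)) (\<lambda>z. trig_mono (m, n) z * F z)"
  unfolding zak_def
proof (intro conjI allI)
  show "sq_integrable QU (\<lambda>z. trig_mono (m, n) z * F z)"
    using F by (intro sq_integrable_mult_bounded[of _ _ _ 1]) (auto simp: zak_def)
  fix k n' :: int
  have "(LINT z|QU. trig_mono (- 1 * k, n') z * (trig_mono (m, n) z * F z)) = (LINT z|QU. trig_mono (- 1 * (k - m), n' + n) z * F z)"
    by (simp add: mult.assoc[symmetric] trig_mono_mult)
  also have "\<dots> = (LINT x|IU. ee (of_int (n' + n) * x) * f (x + of_int (k - m)))"
    using F by (simp only: zak_def)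
  also have "\<dots> = (LINT x|IU. ee (of_int n' * x) * (ee (of_int n * (x + of_int k)) * f (x + of_int k - of_int m)))"
  proof (intro Bochner_Integration.integral_cong refl)
    fix x
    have "ee (of_int (n' + n) * x) = ee (of_int n' * x) * ee (of_int n * (x + of_int k))"
      using ee_of_int[of "n * k"] by (simp add: distrib_right distrib_left ee_add)
    then show "ee (of_int (n' + n) * x) * f (x + of_int (k - m)) = ee (of_int n' * x) * (ee (of_int n * (x + of_int k)) * f (x + of_int k - of_int m))"
      by (simp add: algebra_simps)
  qed
  finally show "(LINT z|QU. trig_mono (- 1 * k, n') z * (trig_mono (m, n) z * F z)) = \<dots>" .
qed

section \<open>Existence, isometry and fibres of the Zak transform\<close>

lemma zak_sum_measurable [measurable]:
  assumes [measurable]: "f \<in> borel_measurable borel"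
  shows "zak_sum s f X \<in> borel_measurable borel"
proof -
  have "zak_sum s f X \<in> borel_measurable (borel \<Otimes>\<^sub>M borel)"
    unfolding zak_sum_def by measurable
  then show ?thesis by (simp only: borel_prod)
qed

text \<open>Parseval in y for each fixed x, followed by Tonelli in x.\<close>

lemma zak_sum_norm:
  assumes s: "\<bar>s\<bar> = 1" and f: "sq_integrable lborel f" and X: "finite X"
  shows "sq_integrable QU (zak_sum s f X)"
    and "(LINT z|QU. (norm (zak_sum s f X z))\<^sup>2) = (\<Sum>k\<in>X. LINT x|IU. (norm (f (x + of_int k)))\<^sup>2)"
proof -
  have [measurable]: "f \<in> borel_measurable borel" using f by (simp add: sq_integrable_def)
  have [measurable]: "zak_sum s f X \<in> borel_measurable (borel \<Otimes>\<^sub>M borel)"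
    using zak_sum_measurable[of f s X] by (simp add: borel_prod)
  have int: "integrable IU (\<lambda>x. (norm (f (x + of_int k)))\<^sup>2)" for k
    using sq_integrable_shift[OF f, of k] by (simp add: sq_integrable_def)
  have inj: "inj_on (\<lambda>k. s * k) X" using s by (auto simp: inj_on_def)
  have "(\<integral>\<^sup>+z. ennreal ((norm (zak_sum s f X z))\<^sup>2) \<partial>QU)
      = (\<integral>\<^sup>+x. \<integral>\<^sup>+y. ennreal ((norm (zak_sum s f X (x, y)))\<^sup>2) \<partial>IU \<partial>IU)"
    unfolding QU_def by (rule IU.nn_integral_fst[symmetric]) measurable
  also have "\<dots> = (\<integral>\<^sup>+x. ennreal (\<Sum>k\<in>X. (norm (f (x + of_int k)))\<^sup>2) \<partial>IU)"
    by (intro nn_integral_cong)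
       (simp add: zak_sum_def nn_integral_eq_integral integral_norm_ee_sum[OF X inj] del: of_int_mult)
  also have "\<dots> = ennreal (\<Sum>k\<in>X. LINT x|IU. (norm (f (x + of_int k)))\<^sup>2)"
    using int by (subst nn_integral_eq_integral) (auto intro!: sum_nonneg)
  finally have eq: "(\<integral>\<^sup>+z. ennreal ((norm (zak_sum s f X z))\<^sup>2) \<partial>QU) = ennreal (\<Sum>k\<in>X. LINT x|IU. (norm (f (x + of_int k)))\<^sup>2)" .
  then show *: "sq_integrable QU (zak_sum s f X)"
    by (simp add: sq_integrable_iff_finite)
  have "0 \<le> (\<Sum>k\<in>X. LINT x|IU. (norm (f (x + of_int k)))\<^sup>2)"
    by (intro sum_nonneg) simp
  then show "(LINT z|QU. (norm (zak_sum s f X z))\<^sup>2) = (\<Sum>k\<in>X. LINT x|IU. (norm (f (x + of_int k)))\<^sup>2)"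
    using eq sq_integrable_nn_integral[OF *] by simp
qed

lemma zak_sum_coeff:
  assumes s: "\<bar>s\<bar> = 1" and f: "sq_integrable lborel f" and X: "finite X"
  shows "(LINT z|QU. trig_mono (s * k, n) z * zak_sum s f X z)
    = (if k \<in> X then LINT x|IU. ee (of_int n * x) * f (x + of_int k) else 0)"
proof -
  have eq: "trig_mono (s * k, n) z * (f (fst z + of_int j) * ee (of_int (s * j) * snd z))
      = (ee (of_int n * fst z) * f (fst z + of_int j)) * ee (of_int (s * (j - k)) * snd z)" for j z
    by (simp add: trig_mono_def ee_diff left_diff_distrib right_diff_distrib)
  have "(LINT z|QU. trig_mono (s * k, n) z * zak_sum s f X z)
      = (LINT z|QU. (\<Sum>j\<in>X. (ee (of_int n * fst z) * f (fst z + of_int j)) * ee (of_int (s * (j - k)) * snd z)))"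
    unfolding zak_sum_def sum_distrib_left eq ..
  also have "\<dots> = (\<Sum>j\<in>X. (LINT x|IU. ee (of_int n * x) * f (x + of_int j)) * (LINT y|IU. ee (of_int (s * (j - k)) * y)))"
    using integral_QU_product[OF integrable_ee_shift[OF f] integrable_ee] by simp
  also have "\<dots> = (\<Sum>j\<in>X. if j = k then (LINT x|IU. ee (of_int n * x) * f (x + of_int j)) else 0)"
    using s by (intro sum.cong refl) (auto simp: integral_ee simp del: of_int_mult)
  also have "\<dots> = (if k \<in> X then LINT x|IU. ee (of_int n * x) * f (x + of_int k) else 0)"
    using X by simp
  finally show ?thesis .
qed

text \<open>By orthogonality the squared distance of two partial sums is the difference of the
  squared norms of f over the corresponding windows, and these converge. The windows {-N..<N} cover
  exactly [-N, N), so that they later match the truncated Fourier integral.\<close>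

lemma zak_exists:
  assumes s: "\<bar>s\<bar> = 1" and f: "sq_integrable lborel f"
  obtains F r where "zak s f F"
    "(\<lambda>N. LINT z|QU. (norm (F z - zak_sum s f {- int N..<int N} z))\<^sup>2) \<longlonglongrightarrow> 0"
    "strict_mono (r :: nat \<Rightarrow> nat)" "AE z in QU. (\<lambda>N. zak_sum s f {- int (r N)..<int (r N)} z) \<longlonglongrightarrow> F z"
    "(LINT z|QU. (norm (F z))\<^sup>2) = (LINT t|lborel. (norm (f t))\<^sup>2)"
proof -
  have [measurable]: "f \<in> borel_measurable borel" using f by (simp add: sq_integrable_def)
  define a where "a k = (LINT x|IU. (norm (f (x + of_int k)))\<^sup>2)" for k :: int
  define S where "S N = (\<Sum>k\<in>{- int N..<int N}. a k)" for N
  let ?F = "\<lambda>N. zak_sum s f {- int N..<int N}"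
  have a_nonneg: "0 \<le> a k" for k by (simp add: a_def)
  have a_nn: "ennreal (a k) = (\<integral>\<^sup>+x. ennreal ((norm (f (x + of_int k)))\<^sup>2) \<partial>IU)" for k
    unfolding a_def using sq_integrable_nn_integral[OF sq_integrable_shift[OF f]] by simp
  have "(\<lambda>N. ennreal (S N)) \<longlonglongrightarrow> ennreal (LINT t|lborel. (norm (f t))\<^sup>2)"
    unfolding S_def using LIMSEQ_sum_nn_integral_IU[of "\<lambda>t. ennreal ((norm (f t))\<^sup>2)"]
    by (simp add: a_nonneg sum_ennreal[symmetric] a_nn sq_integrable_nn_integral[OF f] del: sum_ennreal)
  then have S_lim: "S \<longlonglongrightarrow> (LINT t|lborel. (norm (f t))\<^sup>2)"
    by (subst (asm) tendsto_ennreal_iff) (auto simp: S_def intro!: always_eventually sum_nonneg a_nonneg)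
  have dist_eq: "(LINT z|QU. (norm (?F m z - ?F n z))\<^sup>2) = S m - S n" if "n \<le> m" for m n
  proof -
    let ?D = "{- int m..<int m} - {- int n..<int n}"
    have sub: "{- int n..<int n} \<subseteq> {- int m..<int m}" using that by auto
    have "?F m z - ?F n z = zak_sum s f ?D z" for z
      unfolding zak_sum_def by (rule sum_diff[OF _ sub, symmetric]) simp
    then have "(LINT z|QU. (norm (?F m z - ?F n z))\<^sup>2) = (\<Sum>k\<in>?D. a k)"
      using zak_sum_norm(2)[OF s f, of ?D] by (simp add: a_def)
    also have "\<dots> = S m - S n"
      unfolding S_def using sum_diff[OF _ sub] by simp
    finally show ?thesis .
  qed
  have sq: "sq_integrable QU (?F N)" for N
    by (rule zak_sum_norm(1)[OF s f]) simp
  have Cauchy: "\<exists>n0. \<forall>m\<ge>n0. \<forall>n\<ge>n0. (LINT z|QU. (norm (?F m z - ?F n z))\<^sup>2) \<le> e" if "e > 0" for e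
  proof -
    have "Cauchy S" using S_lim by (rule LIMSEQ_imp_Cauchy)
    then obtain n0 where n0: "\<And>m n. m \<ge> n0 \<Longrightarrow> n \<ge> n0 \<Longrightarrow> norm (S m - S n) < e"
      using \<open>e > 0\<close> unfolding Cauchy_iff by blast
    have "(LINT z|QU. (norm (?F m z - ?F n z))\<^sup>2) \<le> e" if "m \<ge> n0" "n \<ge> n0" for m n
    proof (cases "n \<le> m")
      case True
      then show ?thesis using n0[OF that] by (simp add: dist_eq)
    next
      case False
      then show ?thesis using n0[OF that(2,1)] dist_eq[of m n] by (simp add: norm_minus_commute)
    qed
    then show ?thesis by blast
  qed
  obtain F r where F: "sq_integrable QU F" and r: "strict_mono r"
    and AE: "AE z in QU. (\<lambda>n. ?F (r n) z) \<longlonglongrightarrow> F z"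
    and lim: "(\<lambda>n. LINT z|QU. (norm (F z - ?F n z))\<^sup>2) \<longlonglongrightarrow> 0"
    using L2_Cauchy_converges[of QU ?F, OF Q.finite_measure_axioms sq Cauchy] by blast
  have "(LINT z|QU. trig_mono (s * k, n) z * F z) = (LINT x|IU. ee (of_int n * x) * f (x + of_int k))" for k n
  proof (rule LIMSEQ_unique)
    show "(\<lambda>N. LINT z|QU. trig_mono (s * k, n) z * ?F N z) \<longlonglongrightarrow> (LINT z|QU. trig_mono (s * k, n) z * F z)"
      by (rule L2_tendsto_integral[OF prob_space_QU sq F lim]) auto
    show "(\<lambda>N. LINT z|QU. trig_mono (s * k, n) z * ?F N z) \<longlonglongrightarrow> (LINT x|IU. ee (of_int n * x) * f (x + of_int k))"
    proof (rule tendsto_eventually, rule eventually_sequentiallyI[of "Suc (nat \<bar>k\<bar>)"])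
      fix N assume "Suc (nat \<bar>k\<bar>) \<le> N"
      then have "k \<in> {- int N..<int N}" by auto
      then show "(LINT z|QU. trig_mono (s * k, n) z * ?F N z) = (LINT x|IU. ee (of_int n * x) * f (x + of_int k))"
        using zak_sum_coeff[OF s f, of "{- int N..<int N}" k n] by simp
    qed
  qed
  then have "zak s f F" using F by (simp add: zak_def)
  moreover have "(LINT z|QU. (norm (F z))\<^sup>2) = (LINT t|lborel. (norm (f t))\<^sup>2)"
  proof (rule LIMSEQ_unique)
    show "(\<lambda>N. LINT z|QU. (norm (?F N z))\<^sup>2) \<longlonglongrightarrow> (LINT z|QU. (norm (F z))\<^sup>2)"
      by (rule L2_tendsto_norm[OF sq F lim])
    have "(LINT z|QU. (norm (?F N z))\<^sup>2) = S N" for N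
      using zak_sum_norm(2)[OF s f, of "{- int N..<int N}"] by (simp add: S_def a_def)
    then show "(\<lambda>N. LINT z|QU. (norm (?F N z))\<^sup>2) \<longlonglongrightarrow> (LINT t|lborel. (norm (f t))\<^sup>2)"
      using S_lim by simp
  qed
  ultimately show ?thesis using that[of F r] lim r AE by blast
qed

lemma zak_isometry:
  assumes s: "\<bar>s\<bar> = 1" and f: "sq_integrable lborel f" and F: "zak s f F"
  shows "(LINT z|QU. (norm (F z))\<^sup>2) = (LINT t|lborel. (norm (f t))\<^sup>2)"
proof -
  obtain F' where F': "zak s f F'" "(LINT z|QU. (norm (F' z))\<^sup>2) = (LINT t|lborel. (norm (f t))\<^sup>2)"
    using zak_exists[OF s f] by metis
  have [measurable]: "F \<in> borel_measurable borel" "F' \<in> borel_measurable borel"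
    using F F'(1) by (auto simp: zak_def sq_integrable_def)
  have "AE z in QU. F z = F' z" by (rule zak_unique[OF s F F'(1)])
  then have "(LINT z|QU. (norm (F z))\<^sup>2) = (LINT z|QU. (norm (F' z))\<^sup>2)"
    by (intro integral_cong_AE) (auto elim: eventually_mono)
  with F'(2) show ?thesis by simp
qed

text \<open>Smoothing acts in y with x fixed, whereas \<open>zak\<close> only gives coefficients in
  both variables. The discrepancy of the two sides is an integrable function of x whose Fourier
  coefficients all vanish.\<close>

lemma zak_fiber_coeff:
  assumes s: "\<bar>s\<bar> = 1" and f: "sq_integrable lborel f" and F: "zak s f F"
  shows "AE x in IU. integrable IU (\<lambda>y. F (x, y)) \<and> (LINT y|IU. ee (- of_int (s * k) * y) * F (x, y)) = f (x + of_int k)"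
proof -
  have [measurable]: "F \<in> borel_measurable (borel \<Otimes>\<^sub>M borel)" "f \<in> borel_measurable borel"
    using F f by (auto simp: zak_def sq_integrable_def borel_prod)
  have F2: "sq_integrable QU F" using F by (simp add: zak_def)
  then have Fint: "integrable (IU \<Otimes>\<^sub>M IU) F"
    using Q.sq_integrable_imp_integrable by (simp add: QU_def)
  define H where "H z = ee (- of_int (s * k) * snd z) * F z" for z
  have [measurable]: "H \<in> borel_measurable (borel \<Otimes>\<^sub>M borel)" unfolding H_def by measurable
  have Hint: "integrable (IU \<Otimes>\<^sub>M IU) H"
    unfolding H_def by (rule Bochner_Integration.integrable_bound[OF Fint]) (auto simp: norm_mult)
  define \<phi> where "\<phi> x = (LINT y|IU. H (x, y))" for x
  have \<phi>: "integrable IU \<phi>" unfolding \<phi>_def by (rule QU.integrable_fst'[OF Hint])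
  have fk: "integrable IU (\<lambda>x. f (x + of_int k))"
    by (intro IU.sq_integrable_imp_integrable sq_integrable_shift f)
  define W where "W x = \<phi> x - f (x + of_int k)" for x
  have W: "integrable IU W" unfolding W_def using \<phi> fk by simp
  have eeW: "(LINT x|IU. ee (of_int n * x) * W x) = 0" for n
  proof -
    have eint: "integrable IU (\<lambda>x. ee (of_int n * x) * v x)" if "integrable IU v" for v
      using that borel_measurable_integrable[OF that]
      by (intro Bochner_Integration.integrable_bound[OF that]) (auto simp: norm_mult)
    have i: "integrable (IU \<Otimes>\<^sub>M IU) (\<lambda>z. ee (of_int n * fst z) * H z)"
      by (rule Bochner_Integration.integrable_bound[OF Hint]) (auto simp: norm_mult)
    have "(LINT x|IU. ee (of_int n * x) * \<phi> x) = (LINT x|IU. LINT y|IU. ee (of_int n * x) * H (x, y))"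
      by (simp add: \<phi>_def)
    also have "\<dots> = (LINT z|QU. ee (of_int n * fst z) * H z)"
      using QU.integral_fst'[OF i] by (simp add: QU_def)
    also have "\<dots> = (LINT z|QU. trig_mono (s * k, n) z * F z)"
      by (intro Bochner_Integration.integral_cong) (auto simp: H_def trig_mono_def ee_diff)
    also have "\<dots> = (LINT x|IU. ee (of_int n * x) * f (x + of_int k))"
      using F by (simp only: zak_def)
    finally show ?thesis
      using eint[OF \<phi>] eint[OF fk] by (simp add: W_def right_diff_distrib)
  qed
  \<comment> \<open>Regarding W as a function on the square makes the two-variable uniqueness result
    serve in one variable; the factor 1 fits the product formula.\<close>
  have "AE z in QU. W (fst z) * 1 = 0"
  proof (rule trig_coeffs_zero_imp_AE_zero)
    show "integrable QU (\<lambda>z. W (fst z) * 1)"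
      using integral_QU_product(1)[OF W, of "\<lambda>_. 1"] by simp
    fix i :: "int \<times> int"
    have eeWi: "integrable IU (\<lambda>x. ee (of_int (snd i) * x) * W x)"
      using borel_measurable_integrable[OF W]
      by (intro Bochner_Integration.integrable_bound[OF W]) (auto simp: norm_mult)
    have "(LINT z|QU. trig_mono i z * (W (fst z) * 1)) = (LINT z|QU. (ee (of_int (snd i) * fst z) * W (fst z)) * ee (- of_int (fst i) * snd z))"
      by (intro Bochner_Integration.integral_cong) (auto simp: trig_mono_def ee_diff)
    also have "\<dots> = (LINT x|IU. ee (of_int (snd i) * x) * W x) * (LINT y|IU. ee (- of_int (fst i) * y))"
      by (rule integral_QU_product(2)[OF eeWi integrable_ee])
    finally show "(LINT z|QU. trig_mono i z * (W (fst z) * 1)) = 0"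
      by (simp add: eeW)
  qed
  then have "AE x in IU. AE y in IU. W (fst (x, y)) * 1 = 0"
    unfolding QU_def by (rule QU.AE_pair)
  then have "AE x in IU. W x = 0"
    by eventually_elim (simp add: eventually_const_iff IU.ae_filter_bot)
  moreover have "AE x in IU. integrable IU (\<lambda>y. F (x, y))"
    by (rule QU.AE_integrable_fst'[OF Fint])
  ultimately show ?thesis
    by eventually_elim (simp add: W_def \<phi>_def H_def)
qed

subsection \<open>Jumps of quasi-periodic functions\<close>

lemma sum_cyclic:
  fixes f :: "nat \<Rightarrow> 'a::comm_monoid_add"
  assumes "M > 0"
  shows "(\<Sum>j<M. f (Suc j mod M)) = (\<Sum>j<M. f j)"
proof -
  obtain m where M: "M = Suc m" using assms by (cases M) auto
  have "(\<Sum>j<M. f (Suc j mod M)) = (\<Sum>j<m. f (Suc j mod M)) + f (Suc m mod M)"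
    unfolding M by simp
  also have "(\<Sum>j<m. f (Suc j mod M)) = (\<Sum>j<m. f (Suc j))"
    by (intro sum.cong) (auto simp: M)
  also have "(\<Sum>j<m. f (Suc j)) + f (Suc m mod M) = (\<Sum>j<M. f j)"
    unfolding M sum.lessThan_Suc_shift by (simp add: add.commute)
  finally show ?thesis .
qed

lemma cyclic_grid_step:
  assumes "j < M"
  shows "x + real (Suc j mod M) / real M = x + real j / real M + 1 / real M - of_bool (Suc j = M)"
proof (cases "Suc j = M")
  case True
  then have mod: "Suc j mod M = 0" and "real M = real j + 1"
    by (simp, metis of_nat_Suc add.commute)
  then show ?thesis unfolding mod using True by (simp add: field_simps)
next
  case False
  then show ?thesis using assms by (simp add: add_divide_distrib)
qed

definition phase_step :: "complex \<Rightarrow> complex \<Rightarrow> real" where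
  "phase_step z w = Im (Ln (w / z))"

text \<open>The quotient w / z lies in the disc of radius 1/2 about 1, where the logarithm of 1 + u
  has modulus at most twice that of u, hence below 1.\<close>

lemma phase_step:
  assumes "norm (w - z) < norm z / 2"
  shows "\<bar>phase_step z w\<bar> \<le> 1" and "cis (phase_step z w) * sgn z = sgn w"
proof -
  have z: "z \<noteq> 0" using assms by auto
  define u where "u = (w - z) / z"
  have wz: "w / z = 1 + u" using z by (simp add: u_def field_simps)
  have u: "norm u < 1 / 2" using assms z by (simp add: u_def norm_divide field_simps)
  then have "norm (Ln (1 + u)) \<le> 2 * norm u" by (rule norm_Ln_le)
  then show "\<bar>phase_step z w\<bar> \<le> 1"
    using u abs_Im_le_cmod[of "Ln (1 + u)"] by (simp add: phase_step_def wz)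
  have "w / z \<noteq> 0" using u by (auto simp: wz add_eq_0_iff)
  then have "w / z = exp (Ln (w / z))" by simp
  also have "\<dots> = of_real (exp (Re (Ln (w / z)))) * cis (phase_step z w)"
    by (simp add: exp_eq_polar phase_step_def)
  finally have "w = of_real (exp (Re (Ln (w / z)))) * cis (phase_step z w) * z"
    using z by (simp add: field_simps)
  then have "sgn w = sgn (complex_of_real (exp (Re (Ln (w / z))))) * sgn (cis (phase_step z w)) * sgn z"
    by (metis sgn_mult)
  also have "sgn (complex_of_real (exp (Re (Ln (w / z))))) = 1"
    by (simp add: sgn_of_real)
  also have "sgn (cis (phase_step z w)) = cis (phase_step z w)"
    by (simp add: sgn_div_norm)
  finally show "cis (phase_step z w) * sgn z = sgn w" by simp
qed

lemma cis_eq_ee: "cis t = ee (t / (2 * pi))"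
  by (simp add: ee_def)

lemma sgn_ee_mult: "sgn (ee t * z) = ee t * sgn z"
proof -
  have "sgn (ee t) = ee t" by (simp add: sgn_div_norm)
  then show ?thesis by (simp add: sgn_mult)
qed

text \<open>A discrete form of the fact that a nowhere vanishing continuous function on the plane cannot be
  quasi-periodic. If all steps were small, the discrete mixed difference of the phases over each grid
  cell would be determined exactly, and these differences would add up to both 0 and 1 over the torus.\<close>

lemma quasi_periodic_grid_jump:
  fixes a :: "nat \<Rightarrow> nat \<Rightarrow> complex" and x y :: real
  assumes M: "M \<ge> 7" and N: "N \<ge> 7"
    and vert: "\<And>j l. j < M \<Longrightarrow> l < N \<Longrightarrow> norm (a j (Suc l mod N) - a j l) < norm (a j l) / 2"
    and b: "\<And>j l. b j l = ee (- ((x + real j / real M) * (y + real l / real N))) * a j l"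
    and horiz: "\<And>j l. j < M \<Longrightarrow> l < N \<Longrightarrow> norm (b (Suc j mod M) l - b j l) < norm (b j l) / 2"
  shows False
proof -
  define X where "X j = x + real j / real M" for j
  define Y where "Y l = y + real l / real N" for l
  \<comment> \<open>Quasi-periodicity is encoded in the indices: \<open>a\<close> closes up
    cyclically in l and \<open>b\<close> in j, while the factor \<open>ee (- (X j * Y l))\<close>
    between them closes up in neither.\<close>
  define \<alpha> where "\<alpha> j l = phase_step (a j l) (a j (Suc l mod N))" for j l
  define \<beta> where "\<beta> j l = phase_step (b j l) (b (Suc j mod M) l)" for j l
  \<comment> \<open>Marks the single cell at which both indices wrap around; it carries the whole
    winding.\<close>
  define c where "c j l = of_bool (Suc j = M) * (of_bool (Suc l = N) :: real)" for j l
  define \<Delta> where "\<Delta> j l = (X (Suc j mod M) - X j) * (Y (Suc l mod N) - Y l)" for j l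
  define D where "D j l = (\<alpha> (Suc j mod M) l - \<alpha> j l - (\<beta> j (Suc l mod N) - \<beta> j l)) / (2 * pi)" for j l
  have sb: "sgn (b j l) = ee (- (X j * Y l)) * sgn (a j l)" for j l
    unfolding b X_def Y_def by (rule sgn_ee_mult)
  have sa: "sgn (a j l) = ee (X j * Y l) * sgn (b j l)" for j l
    unfolding sb by (simp add: mult.assoc[symmetric] ee_add[symmetric])
  have \<alpha>: "\<bar>\<alpha> j l\<bar> \<le> 1" "cis (\<alpha> j l) * sgn (a j l) = sgn (a j (Suc l mod N))" if "j < M" "l < N" for j l
    using phase_step[OF vert[OF that]] by (auto simp: \<alpha>_def)
  have \<beta>: "\<bar>\<beta> j l\<bar> \<le> 1" "cis (\<beta> j l) * sgn (b j l) = sgn (b (Suc j mod M) l)" if "j < M" "l < N" for j l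
    using phase_step[OF horiz[OF that]] by (auto simp: \<beta>_def)
  have D: "D j l = \<Delta> j l - c j l" if j: "j < M" and l: "l < N" for j l
  proof -
    let ?j = "Suc j mod M" and ?l = "Suc l mod N"
    have j': "?j < M" and l': "?l < N" using M N by auto
    have a0: "sgn (a j l) \<noteq> 0" using vert[OF j l] by (auto simp: sgn_zero_iff)
    \<comment> \<open>The opposite corner of the cell is reached along its two pairs of sides.
      Equating the phases shows that \<open>D j l\<close> and \<open>\<Delta> j l\<close> agree up
      to an integer.\<close>
    have "sgn (a ?j ?l) = cis (\<alpha> ?j l) * (ee (X ?j * Y l) * (cis (\<beta> j l) * (ee (- (X j * Y l)) * sgn (a j l))))"
      by (simp only: \<alpha>(2)[OF j' l] \<beta>(2)[OF j l] sa[symmetric] sb[symmetric])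
    moreover have "sgn (a ?j ?l) = ee (X ?j * Y ?l) * (cis (\<beta> j ?l) * (ee (- (X j * Y ?l)) * (cis (\<alpha> j l) * sgn (a j l))))"
      by (simp only: \<alpha>(2)[OF j l] \<beta>(2)[OF j l'] sa[symmetric] sb[symmetric])
    ultimately have "ee (\<alpha> ?j l / (2 * pi) + (X ?j * Y l + (\<beta> j l / (2 * pi) + - (X j * Y l)))) * sgn (a j l)
        = ee (X ?j * Y ?l + (\<beta> j ?l / (2 * pi) + (- (X j * Y ?l) + \<alpha> j l / (2 * pi)))) * sgn (a j l)"
      by (simp only: ee_add cis_eq_ee mult.assoc)
    then have "ee (\<alpha> ?j l / (2 * pi) + (X ?j * Y l + (\<beta> j l / (2 * pi) + - (X j * Y l))))
        = ee (X ?j * Y ?l + (\<beta> j ?l / (2 * pi) + (- (X j * Y ?l) + \<alpha> j l / (2 * pi))))"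
      using a0 by (simp only: mult_right_cancel[OF a0])
    then obtain n :: int where
      "\<alpha> ?j l / (2 * pi) + (X ?j * Y l + (\<beta> j l / (2 * pi) + - (X j * Y l)))
        = X ?j * Y ?l + (\<beta> j ?l / (2 * pi) + (- (X j * Y ?l) + \<alpha> j l / (2 * pi))) + of_int n"
      unfolding ee_eq_iff by blast
    then have n: "D j l - \<Delta> j l = of_int n"
      unfolding D_def \<Delta>_def by (simp add: diff_divide_distrib add_divide_distrib algebra_simps)
    \<comment> \<open>Four phases of size at most 1, divided by 2 pi > 6, stay below 2/3.\<close>
    have "\<bar>\<alpha> ?j l - \<alpha> j l - (\<beta> j ?l - \<beta> j l)\<bar> \<le> 4"
      using \<alpha>(1)[OF j' l] \<alpha>(1)[OF j l] \<beta>(1)[OF j l'] \<beta>(1)[OF j l] by linarith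
    then have "\<bar>D j l\<bar> \<le> 4 / (2 * pi)"
      unfolding D_def abs_divide using pi_gt_zero by (simp add: field_simps)
    also have "\<dots> < 2 / 3" using pi_gt3 by (simp add: field_simps)
    finally have Dbd: "\<bar>D j l\<bar> < 2 / 3" .
    define u v where "u = 1 / real M" and "v = 1 / real N"
    have uv: "0 \<le> u" "u \<le> 1 / 7" "0 \<le> v" "v \<le> 1 / 7"
      using M N by (auto simp: u_def v_def field_simps)
    have uvm: "0 \<le> u * v" "u * v \<le> u" "u * v \<le> v"
      using uv by (auto intro: mult_left_le mult_left_le_one_le)
    have dX: "X ?j - X j = u - of_bool (Suc j = M)"
      unfolding X_def cyclic_grid_step[OF j] by (simp add: u_def)
    have dY: "Y ?l - Y l = v - of_bool (Suc l = N)"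
      unfolding Y_def cyclic_grid_step[OF l] by (simp add: v_def)
    \<comment> \<open>Each increment is u or v, less 1 at a wrap. If both wrap, removing
      \<open>c\<close> leaves u v - u - v; otherwise the product is at most 1/7 in size. Since 2/3 +
      2/7 < 1, the integer is pinned down to \<open>- c j l\<close>.\<close>
    have "\<bar>\<Delta> j l - c j l\<bar> \<le> 2 / 7"
      unfolding \<Delta>_def c_def dX dY using uv uvm
      by (cases "Suc j = M"; cases "Suc l = N") (simp_all add: algebra_simps abs_le_iff)
    with Dbd n have "\<bar>of_int n + c j l\<bar> < 1" by linarith
    moreover have "of_int n + c j l = of_int (n + of_bool (Suc j = M) * of_bool (Suc l = N))"
      by (simp add: c_def)
    ultimately have "\<bar>n + of_bool (Suc j = M) * of_bool (Suc l = N)\<bar> < 1"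
      by (metis of_int_abs of_int_less_1_iff)
    then have "n + of_bool (Suc j = M) * of_bool (Suc l = N) = 0" by simp
    with \<open>of_int n + c j l = _\<close> have "of_int n + c j l = 0" by simp
    with n show ?thesis by simp
  qed
  have M0: "M > 0" and N0: "N > 0" using M N by auto
  have "(\<Sum>j<M. \<Sum>l<N. D j l) = 0"
  proof -
    have "(\<Sum>j<M. \<Sum>l<N. \<alpha> (Suc j mod M) l) = (\<Sum>j<M. \<Sum>l<N. \<alpha> j l)"
      by (rule sum_cyclic[OF M0])
    moreover have "(\<Sum>j<M. \<Sum>l<N. \<beta> j (Suc l mod N)) = (\<Sum>j<M. \<Sum>l<N. \<beta> j l)"
      by (intro sum.cong refl sum_cyclic N0)
    ultimately show ?thesis
      by (simp add: D_def sum_subtractf flip: sum_divide_distrib)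
  qed
  \<comment> \<open>The double sum factors, and the increments of X around a full cycle cancel. The
    cells then give 0 = 0 - 1.\<close>
  moreover have "(\<Sum>j<M. \<Sum>l<N. \<Delta> j l) = 0"
  proof -
    have "(\<Sum>j<M. X (Suc j mod M) - X j) = 0"
      by (simp add: sum_subtractf sum_cyclic[OF M0])
    then show ?thesis by (simp add: \<Delta>_def flip: sum_product)
  qed
  moreover have "(\<Sum>j<M. \<Sum>l<N. c j l) = 1"
  proof -
    have one: "(\<Sum>j<M. of_bool (Suc j = M) :: real) = 1" if "M > 0" for M :: nat
    proof -
      have "{..<M} \<inter> {j. Suc j = M} = {M - 1}" using that by auto
      then show ?thesis by simp
    qed
    show ?thesis
      unfolding c_def sum_product[symmetric] one[OF M0] one[OF N0] by simp
  qed
  moreover have "(\<Sum>j<M. \<Sum>l<N. D j l) = (\<Sum>j<M. \<Sum>l<N. \<Delta> j l) - (\<Sum>j<M. \<Sum>l<N. c j l)"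
    by (simp add: D flip: sum_subtractf)
  ultimately show False by simp
qed

subsection \<open>De la Vallee Poussin smoothing\<close>

text \<open>The weights are a convolution of two windows, so that the kernel is a product of two Dirichlet kernels
  and its L1 modulus of continuity follows from the Cauchy-Schwarz inequality.\<close>

definition vp_weight :: "nat \<Rightarrow> int \<Rightarrow> real" where
  "vp_weight K k = (\<Sum>j<K. of_bool (k + int j \<in> {- int K..<2 * int K})) / real K"

lemma vp_weight_nonneg: "0 \<le> vp_weight K k"
  by (simp add: vp_weight_def sum_nonneg)

lemma vp_weight_le_1: "vp_weight K k \<le> 1"
proof -
  have "(\<Sum>j<K. of_bool (k + int j \<in> {- int K..<2 * int K})) \<le> (\<Sum>j<K. 1 :: real)"
    by (intro sum_mono) auto
  then show ?thesis by (cases "K = 0") (simp_all add: vp_weight_def)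
qed

text \<open>The window is asymmetric because the shifts j run over 0..K-1 only: for k between -K and
  K, \<open>k + j\<close> ranges from -K to 2 K - 1, which are exactly the ends of the window.
  Equality at both ends matters for the tail condition.\<close>

lemma vp_weight_eq_1:
  assumes "K \<ge> 1" "\<bar>k\<bar> \<le> int K"
  shows "vp_weight K k = 1"
proof -
  have "(\<Sum>j<K. of_bool (k + int j \<in> {- int K..<2 * int K})) = (\<Sum>j<K. 1 :: real)"
    using assms by (intro sum.cong) auto
  then show ?thesis using assms by (simp add: vp_weight_def)
qed

lemma vp_weight_eq_0:
  assumes "k \<notin> {- 2 * int K..2 * int K}"
  shows "vp_weight K k = 0"
proof -
  have "(\<Sum>j<K. of_bool (k + int j \<in> {- int K..<2 * int K})) = (\<Sum>j<K. 0 :: real)"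
    using assms by (intro sum.cong) auto
  then show ?thesis by (simp add: vp_weight_def)
qed

text \<open>Unfolds the weights into an average over K shifts of a plain window sum. When
  \<open>c\<close> consists of Fourier coefficients times characters, the two summations become two
  separate Dirichlet kernels.\<close>

lemma vp_weight_sum:
  "(\<Sum>k\<in>{- 2 * int K..2 * int K}. of_real (vp_weight K k) * c k)
    = (1 / of_nat K) * (\<Sum>j<K. \<Sum>i\<in>{- int K..<2 * int K}. (c (i - int j) :: complex))"
proof -
  let ?W = "{- int K..<2 * int K}" and ?X = "{- 2 * int K..2 * int K}"
  have inner: "(\<Sum>i\<in>?W. c (i - int j)) = (\<Sum>k\<in>?X. of_bool (k + int j \<in> ?W) * c k)" if "j < K" for j
  proof -
    have "(\<Sum>k\<in>?X. of_bool (k + int j \<in> ?W) * c k) = (\<Sum>k\<in>?X. if k + int j \<in> ?W then c k else 0)"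
      by (intro sum.cong) auto
    also have "\<dots> = (\<Sum>k\<in>{k \<in> ?X. k + int j \<in> ?W}. c k)"
      by (rule sum.inter_filter[symmetric]) simp
    also have "\<dots> = (\<Sum>i\<in>?W. c (i - int j))"
      using that by (intro sum.reindex_bij_witness[where i = "\<lambda>i. i - int j" and j = "\<lambda>k. k + int j"]) auto
    finally show ?thesis ..
  qed
  have ob: "complex_of_real (of_bool P) = of_bool P" for P by (cases P) auto
  have "(\<Sum>k\<in>?X. of_real (vp_weight K k) * c k) = (\<Sum>k\<in>?X. \<Sum>j<K. (1 / of_nat K) * (of_bool (k + int j \<in> ?W) * c k))"
  proof (intro sum.cong refl)
    fix k
    let ?S = "\<Sum>j<K. of_bool (k + int j \<in> ?W) :: complex"
    have "of_real (vp_weight K k) * c k = (?S / of_nat K) * c k"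
      unfolding vp_weight_def of_real_divide of_real_sum ob of_real_of_nat_eq ..
    also have "\<dots> = (1 / of_nat K) * (?S * c k)"
      by (simp only: divide_inverse mult_1 mult_ac)
    finally show "of_real (vp_weight K k) * c k = (\<Sum>j<K. (1 / of_nat K) * (of_bool (k + int j \<in> ?W) * c k))"
      unfolding sum_distrib_right sum_distrib_left .
  qed
  also have "\<dots> = (\<Sum>j<K. \<Sum>k\<in>?X. (1 / of_nat K) * (of_bool (k + int j \<in> ?W) * c k))"
    by (rule sum.swap)
  also have "\<dots> = (1 / of_nat K) * (\<Sum>j<K. \<Sum>k\<in>?X. of_bool (k + int j \<in> ?W) * c k)"
    by (simp only: sum_distrib_left)
  also have "\<dots> = (1 / of_nat K) * (\<Sum>j<K. \<Sum>i\<in>?W. c (i - int j))"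
    using inner by simp
  finally show ?thesis .
qed

lemma sqrt_integral_ee_sum_le:
  assumes X: "finite X" "inj_on \<phi> X" and c: "\<And>k. k \<in> X \<Longrightarrow> norm (c k) \<le> C" and C: "C \<ge> 0"
    and card: "real (card X) \<le> n"
  shows "sqrt (LINT y|IU. (norm (\<Sum>k\<in>X. c k * ee (of_int (\<phi> k) * y)))\<^sup>2) \<le> sqrt n * C"
proof -
  have "(\<Sum>k\<in>X. (norm (c k))\<^sup>2) \<le> (\<Sum>k\<in>X. C\<^sup>2)"
    using c by (intro sum_mono power_mono) auto
  also have "\<dots> \<le> n * C\<^sup>2" using card by (simp add: mult_right_mono)
  finally have "sqrt (\<Sum>k\<in>X. (norm (c k))\<^sup>2) \<le> sqrt (n * C\<^sup>2)"
    by (rule real_sqrt_le_mono)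
  then show ?thesis
    using C by (simp add: integral_norm_ee_sum(2)[OF X] real_sqrt_mult)
qed

text \<open>U is 1 / K times the integral of \<open>P y * Q y * F\<close>, with Dirichlet kernels of
  K and 3 K terms. Their L2 norms are of order sqrt K, and a step in y costs one of them a further
  factor K |y' - y|. Cauchy-Schwarz and the factor 1 / K leave order b K |y' - y|, without a
  logarithm.\<close>

lemma vp_sum_increment:
  fixes F :: "real \<Rightarrow> complex"
  assumes s: "\<bar>s\<bar> = 1" and K: "K \<ge> 1" and F: "integrable IU F" and Fb: "AE y in IU. norm (F y) \<le> b" and b: "b \<ge> 0"
    and c: "\<And>k. c k = (LINT y|IU. ee (- of_int (s * k) * y) * F y)"
  defines "U \<equiv> \<lambda>y. \<Sum>k\<in>{- 2 * int K..2 * int K}. of_real (vp_weight K k) * (c k * ee (of_int (s * k) * y))"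
  shows "norm (U y' - U y) \<le> 48 * b * real K * \<bar>y' - y\<bar>"
proof -
  let ?W = "{- int K..<2 * int K}"
  \<comment> \<open>Both kernels depend on y - v only, but the characters are kept split so that y
    sits in the coefficients and Parseval applies in v.\<close>
  define P where "P y v = (\<Sum>j<K. ee (- of_int (s * int j) * y) * ee (of_int (s * int j) * v))" for y v
  define Q where "Q y v = (\<Sum>i\<in>?W. ee (of_int (s * i) * y) * ee (of_int (- (s * i)) * v))" for y v
  have [measurable]: "F \<in> borel_measurable borel" using borel_measurable_integrable[OF F] by simp
  have [measurable]: "P y \<in> borel_measurable borel" "Q y \<in> borel_measurable borel" for y
    unfolding P_def Q_def by measurable
  have eeF: "integrable IU (\<lambda>v. ee (u * v) * F v)" for u
    by (rule Bochner_Integration.integrable_bound[OF F]) (auto simp: norm_mult)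
  have PQ: "P y v * Q y v * F v = (\<Sum>j<K. \<Sum>i\<in>?W. ee (of_int (s * (i - int j)) * y) * (ee (- of_int (s * (i - int j)) * v) * F v))" for y v
  proof -
    have "ee (- of_int (s * int j) * y) * ee (of_int (s * int j) * v) * (ee (of_int (s * i) * y) * ee (of_int (- (s * i)) * v)) * F v
        = ee (of_int (s * (i - int j)) * y) * (ee (- of_int (s * (i - int j)) * v) * F v)" for i j
    proof -
      have "ee (- of_int (s * int j) * y) * ee (of_int (s * int j) * v) * (ee (of_int (s * i) * y) * ee (of_int (- (s * i)) * v))
          = ee (of_int (s * (i - int j)) * y) * ee (- of_int (s * (i - int j)) * v)"
        unfolding ee_add[symmetric] by (rule arg_cong[where f = ee]) (simp add: algebra_simps)
      then show ?thesis by (simp only: mult.assoc)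
    qed
    then show ?thesis
      unfolding P_def Q_def sum_product unfolding sum_distrib_right by (simp only: )
  qed
  have PQint: "integrable IU (\<lambda>v. P y v * Q y v * F v)" for y
    unfolding PQ by (intro Bochner_Integration.integrable_sum integrable_mult_right eeF)
  have U: "U y = (1 / of_nat K) * (LINT v|IU. P y v * Q y v * F v)" for y
  proof -
    have "U y = (1 / of_nat K) * (\<Sum>j<K. \<Sum>i\<in>?W. c (i - int j) * ee (of_int (s * (i - int j)) * y))"
      unfolding U_def by (rule vp_weight_sum)
    also have "(\<Sum>j<K. \<Sum>i\<in>?W. c (i - int j) * ee (of_int (s * (i - int j)) * y)) = (LINT v|IU. P y v * Q y v * F v)"
      unfolding PQ c
      by (subst Bochner_Integration.integral_sum, intro Bochner_Integration.integrable_sum integrable_mult_right eeF,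
          subst Bochner_Integration.integral_sum, intro integrable_mult_right eeF) (simp add: mult.commute)
    finally show ?thesis .
  qed
  define A where "A = sqrt (real K)"
  \<comment> \<open>Bounds the increment of a single character of frequency at most K. The
    frequencies in Q reach 2 K in absolute value, hence \<open>2 * d\<close> there.\<close>
  define d where "d = 2 * pi * real K * \<bar>y' - y\<bar>"
  have d0: "d \<ge> 0" by (simp add: d_def)
  have A0: "A \<ge> 0" "A * A = real K" by (simp_all add: A_def)
  have inj: "inj_on (\<lambda>j. s * int j) {..<K}" "inj_on (\<lambda>i. - (s * i)) ?W"
    using s by (auto simp: inj_on_def)
  \<comment> \<open>The window has 3 K elements; 4 K is used for its simple square root.\<close>
  have cardW: "real (card ?W) \<le> 4 * real K" by simp
  have sqrt4: "sqrt (4 * real K) = 2 * A"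
    by (simp add: A_def real_sqrt_mult)
  have s_abs: "\<bar>of_int s :: real\<bar> = 1" using s by (metis of_int_abs of_int_1)
  have Pdiff: "P y' v - P y v = (\<Sum>j<K. (ee (- of_int (s * int j) * y') - ee (- of_int (s * int j) * y)) * ee (of_int (s * int j) * v))" for v
    unfolding P_def by (simp add: sum_subtractf left_diff_distrib)
  have Qdiff: "Q y' v - Q y v = (\<Sum>i\<in>?W. (ee (of_int (s * i) * y') - ee (of_int (s * i) * y)) * ee (of_int (- (s * i)) * v))" for v
    unfolding Q_def by (simp add: sum_subtractf left_diff_distrib)
  have step: "norm (ee (of_int m * y') - ee (of_int m * y)) \<le> 2 * pi * real_of_int \<bar>m\<bar> * \<bar>y' - y\<bar>" for m
    using norm_ee_diff_le[of "of_int m * y'" "of_int m * y"] by (simp add: abs_mult flip: right_diff_distrib)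
  have nP: "sqrt (LINT v|IU. (norm (P z v))\<^sup>2) \<le> A * 1" for z
    unfolding P_def A_def by (rule sqrt_integral_ee_sum_le[OF _ inj(1)]) auto
  have nQ: "sqrt (LINT v|IU. (norm (Q z v))\<^sup>2) \<le> 2 * A * 1" for z
    unfolding Q_def sqrt4[symmetric] by (rule sqrt_integral_ee_sum_le[OF _ inj(2)]) (use cardW in auto)
  have nP': "sqrt (LINT v|IU. (norm (P y' v - P y v))\<^sup>2) \<le> A * d"
    unfolding Pdiff A_def
  proof (rule sqrt_integral_ee_sum_le[OF _ inj(1) _ d0])
    fix j assume "j \<in> {..<K}"
    then have "real_of_int \<bar>- (s * int j)\<bar> \<le> real K"
      using s by (simp add: abs_mult)
    then have "2 * pi * real_of_int \<bar>- (s * int j)\<bar> * \<bar>y' - y\<bar> \<le> d"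
      unfolding d_def by (intro mult_right_mono mult_left_mono) auto
    then show "norm (ee (- of_int (s * int j) * y') - ee (- of_int (s * int j) * y)) \<le> d"
      using step[of "- (s * int j)"] by simp
  qed auto
  have nQ': "sqrt (LINT v|IU. (norm (Q y' v - Q y v))\<^sup>2) \<le> 2 * A * (2 * d)"
    unfolding Qdiff sqrt4[symmetric]
  proof (rule sqrt_integral_ee_sum_le[OF _ inj(2)])
    fix i assume "i \<in> ?W"
    then have "\<bar>s * i\<bar> \<le> 2 * int K"
      using s by (simp add: abs_mult abs_le_iff)
    then have "real_of_int \<bar>s * i\<bar> \<le> 2 * real K" by linarith
    then have "2 * pi * real_of_int \<bar>s * i\<bar> * \<bar>y' - y\<bar> \<le> 2 * pi * (2 * real K) * \<bar>y' - y\<bar>"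
      by (intro mult_right_mono mult_left_mono) auto
    then show "norm (ee (of_int (s * i) * y') - ee (of_int (s * i) * y)) \<le> 2 * d"
      using order.trans[OF step[of "s * i"]] by (simp only: d_def mult_ac)
  qed (use cardW d0 in auto)
  have sq: "integrable IU (\<lambda>v. (norm (P z v))\<^sup>2)" "integrable IU (\<lambda>v. (norm (Q z v))\<^sup>2)" for z
    unfolding P_def Q_def using integral_norm_ee_sum(1)[OF _ inj(1)] integral_norm_ee_sum(1)[OF _ inj(2)] by auto
  have sq': "integrable IU (\<lambda>v. (norm (P y' v - P y v))\<^sup>2)" "integrable IU (\<lambda>v. (norm (Q y' v - Q y v))\<^sup>2)"
    unfolding Pdiff Qdiff using integral_norm_ee_sum(1)[OF _ inj(1)] integral_norm_ee_sum(1)[OF _ inj(2)] by auto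
  note cs1 = Cauchy_Schwarz_integral[of "\<lambda>v. norm (P y' v - P y v)" IU "\<lambda>v. norm (Q y' v)", OF _ _ sq'(1) sq(2)]
  note cs2 = Cauchy_Schwarz_integral[of "\<lambda>v. norm (P y v)" IU "\<lambda>v. norm (Q y' v - Q y v)", OF _ _ sq(1) sq'(2)]
  have t1: "(LINT v|IU. norm (P y' v - P y v) * norm (Q y' v)) \<le> (A * d) * (2 * A)"
  proof -
    have "(LINT v|IU. norm (P y' v - P y v) * norm (Q y' v))
        \<le> sqrt (LINT v|IU. (norm (P y' v - P y v))\<^sup>2) * sqrt (LINT v|IU. (norm (Q y' v))\<^sup>2)"
      using cs1(2) by simp
    also have "\<dots> \<le> (A * d) * (2 * A)"
      using nP' nQ[of y'] A0 d0 by (intro mult_mono) auto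
    finally show ?thesis .
  qed
  have t2: "(LINT v|IU. norm (P y v) * norm (Q y' v - Q y v)) \<le> A * (2 * A * (2 * d))"
  proof -
    have "(LINT v|IU. norm (P y v) * norm (Q y' v - Q y v))
        \<le> sqrt (LINT v|IU. (norm (P y v))\<^sup>2) * sqrt (LINT v|IU. (norm (Q y' v - Q y v))\<^sup>2)"
      using cs2(2) by simp
    also have "\<dots> \<le> A * (2 * A * (2 * d))"
      using nQ' nP[of y] A0 d0 by (intro mult_mono) auto
    finally show ?thesis .
  qed
  have i1: "integrable IU (\<lambda>v. norm (P y' v - P y v) * norm (Q y' v))"
    and i2: "integrable IU (\<lambda>v. norm (P y v) * norm (Q y' v - Q y v))"
    using cs1(1) cs2(1) by simp_all
  let ?R = "\<lambda>v. norm (P y' v - P y v) * norm (Q y' v) + norm (P y v) * norm (Q y' v - Q y v)"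
  have "norm ((LINT v|IU. P y' v * Q y' v * F v) - (LINT v|IU. P y v * Q y v * F v))
      = norm (LINT v|IU. P y' v * Q y' v * F v - P y v * Q y v * F v)"
    using PQint by simp
  also have "\<dots> \<le> (LINT v|IU. norm (P y' v * Q y' v * F v - P y v * Q y v * F v))"
    by (rule integral_norm_bound)
  also have "\<dots> \<le> (LINT v|IU. b * ?R v)"
  proof (rule integral_mono_AE)
    show "integrable IU (\<lambda>v. norm (P y' v * Q y' v * F v - P y v * Q y v * F v))"
      by (intro integrable_norm Bochner_Integration.integrable_diff PQint)
    show "integrable IU (\<lambda>v. b * ?R v)"
      using i1 i2 by simp
    show "AE v in IU. norm (P y' v * Q y' v * F v - P y v * Q y v * F v) \<le> b * ?R v"
      using Fb
    proof eventually_elim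
      case (elim v)
      have "P y' v * Q y' v * F v - P y v * Q y v * F v = F v * ((P y' v - P y v) * Q y' v + P y v * (Q y' v - Q y v))"
        by (simp add: algebra_simps)
      also have "norm \<dots> \<le> b * ?R v"
        unfolding norm_mult[of "F v"] using elim b
        by (intro mult_mono order.trans[OF norm_triangle_ineq]) (simp_all add: norm_mult)
      finally show ?case .
    qed
  qed
  also have "\<dots> = b * ((LINT v|IU. norm (P y' v - P y v) * norm (Q y' v)) + (LINT v|IU. norm (P y v) * norm (Q y' v - Q y v)))"
    using i1 i2 by simp
  also have "\<dots> \<le> b * ((A * d) * (2 * A) + A * (2 * A * (2 * d)))"
    using t1 t2 b by (intro mult_left_mono add_mono)
  also have "(A * d) * (2 * A) + A * (2 * A * (2 * d)) = 6 * real K * d"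
    using A0(2) by (simp add: algebra_simps)
  finally have main: "norm ((LINT v|IU. P y' v * Q y' v * F v) - (LINT v|IU. P y v * Q y v * F v)) \<le> b * (6 * real K * d)" .
  have "norm (U y' - U y) = (1 / real K) * norm ((LINT v|IU. P y' v * Q y' v * F v) - (LINT v|IU. P y v * Q y v * F v))"
    unfolding U right_diff_distrib[symmetric] norm_mult by (simp add: norm_divide)
  also have "\<dots> \<le> (1 / real K) * (b * (6 * real K * d))"
    by (intro mult_left_mono main) simp
  also have "\<dots> = (12 * pi) * (b * real K * \<bar>y' - y\<bar>)"
    using K by (simp add: d_def)
  \<comment> \<open>Origin of the constant 48: it is 12 pi with pi < 4.\<close>
  also have "\<dots> \<le> 48 * (b * real K * \<bar>y' - y\<bar>)"
    using b pi_less_4 by (intro mult_right_mono) auto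
  finally show ?thesis by (simp add: mult.assoc)
qed

subsection \<open>Tails, Riesz bounds and the Fourier transform\<close>

lemma floor_add_int_unit: "x \<in> {0..<1} \<Longrightarrow> \<lfloor>x + of_int k\<rfloor> = k" for x :: real
  by (simp add: floor_eq_iff)

lemma zak_finite_support:
  assumes s: "\<bar>s\<bar> = 1" and f: "sq_integrable lborel f" and X: "finite X"
    and supp: "\<And>k x. k \<notin> X \<Longrightarrow> x \<in> {0..<1} \<Longrightarrow> f (x + of_int k) = 0"
  shows "zak s f (zak_sum s f X)"
  unfolding zak_def
proof (intro conjI allI)
  show "sq_integrable QU (zak_sum s f X)" by (rule zak_sum_norm(1)[OF s f X])
  have [measurable]: "f \<in> borel_measurable borel" using f by (simp add: sq_integrable_def)
  fix k n
  have "(LINT x|IU. ee (of_int n * x) * f (x + of_int k)) = 0" if "k \<notin> X"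
  proof -
    have "(LINT x|IU. ee (of_int n * x) * f (x + of_int k)) = (LINT x|IU. 0)"
    proof (rule integral_cong_AE)
      show "AE x in IU. ee (of_int n * x) * f (x + of_int k) = 0"
        using AE_IU_mem by eventually_elim (simp add: supp[OF that])
    qed measurable
    then show ?thesis by simp
  qed
  then show "(LINT z|QU. trig_mono (s * k, n) z * zak_sum s f X z) = (LINT x|IU. ee (of_int n * x) * f (x + of_int k))"
    by (simp add: zak_sum_coeff[OF s f X])
qed

text \<open>The transform is almost everywhere a limit of partial sums along a subsequence, and each
  of these is dominated by a finite sum of the interval-wise bounds on f.\<close>

lemma zak_bound:
  fixes l :: "int \<Rightarrow> real"
  assumes s: "\<bar>s\<bar> = 1" and f: "sq_integrable lborel f" and F: "zak s f F"
    and bd: "AE t in lborel. norm (f t) \<le> l \<lfloor>t\<rfloor>" and sum: "\<And>X. finite X \<Longrightarrow> sum l X \<le> c"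
  shows "AE z in QU. norm (F z) \<le> c"
proof -
  have [measurable]: "f \<in> borel_measurable borel" using f by (simp add: sq_integrable_def)
  have pred [measurable]: "Measurable.pred borel (\<lambda>t. norm (f t) \<le> l \<lfloor>t\<rfloor>)" by measurable
  obtain F' r where F': "zak s f F'"
    and lim: "AE z in QU. (\<lambda>N. zak_sum s f {- int (r N)..<int (r N)} z) \<longlonglongrightarrow> F' z"
    by (rule zak_exists[OF s f])
  \<comment> \<open>The bound is needed at all integer translates of x at once; only countably many
    null sets are discarded.\<close>
  have "AE x in lborel. norm (f (of_int k + 1 * x)) \<le> l \<lfloor>of_int k + 1 * x\<rfloor>" for k :: int
    by (rule AE_borel_affine[OF _ pred bd]) simp
  then have "AE x in lborel. \<forall>k::int. norm (f (of_int k + 1 * x)) \<le> l \<lfloor>of_int k + 1 * x\<rfloor>"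
    by (simp only: AE_all_countable) blast
  then have ae: "AE x in IU. \<forall>k::int. norm (f (x + of_int k)) \<le> l k"
    unfolding AE_IU
  proof eventually_elim
    case (elim x)
    show ?case
    proof (intro impI allI)
      fix k :: int assume "x \<in> {0..<1}"
      then show "norm (f (x + of_int k)) \<le> l k"
        using elim[rule_format, of k] floor_add_int_unit[of x k] by (simp add: add.commute)
    qed
  qed
  have "AE z in QU. \<forall>k::int. norm (f (fst z + of_int k)) \<le> l k"
    unfolding QU_def
  proof (rule QU.AE_pair_measure)
    show "AE x in IU. AE y in IU. \<forall>k::int. norm (f (fst (x, y) + of_int k)) \<le> l k"
      using ae by eventually_elim simp
  qed measurable
  then show ?thesis
    using lim zak_unique[OF s F F'(1)]
  proof eventually_elim
    case (elim z)
    have "norm (zak_sum s f {- int (r N)..<int (r N)} z) \<le> c" for N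
    proof -
      have "norm (zak_sum s f {- int (r N)..<int (r N)} z) \<le> (\<Sum>k\<in>{- int (r N)..<int (r N)}. norm (f (fst z + of_int k)))"
        unfolding zak_sum_def by (rule order.trans[OF norm_sum]) (simp add: norm_mult)
      also have "\<dots> \<le> (\<Sum>k\<in>{- int (r N)..<int (r N)}. l k)"
        using elim(1) by (intro sum_mono) auto
      also have "\<dots> \<le> c" by (rule sum) simp
      finally show ?thesis .
    qed
    with elim(2) have "norm (F' z) \<le> c"
      by (intro LIMSEQ_le_const2[OF tendsto_norm]) auto
    with elim(3) show ?case by simp
  qed
qed

text \<open>Above a height l, |f|^2 is at most l^(2 - q) |f|^q because 2 - q is not positive. Taking
  l proportional to m makes the powers of m combine to m^(2 - q) m^(q - 1) = m, so the bound is
  linear in m and can be summed over the intervals. Here m stands for the p-th power of the L^q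
  norm, whence the exponent \<open>q - 1\<close> = q / p.\<close>

lemma nn_integral_large_part:
  fixes f fl :: "real \<Rightarrow> complex" and m d T q :: real
  assumes [measurable]: "f \<in> borel_measurable borel" "fl \<in> borel_measurable borel"
    and q: "q \<ge> 2" and d: "d > 0" and T: "T > 0" and m: "m \<ge> 0"
    and fl: "\<And>t. t \<in> {of_int k..<of_int k + 1} \<Longrightarrow> fl t = (if norm (f t) > d * m / (2 * T) then f t else 0)"
    and Lq: "(\<integral>\<^sup>+t. indicator {of_int k..of_int k + 1} t * ennreal (norm (f t) powr q) \<partial>lborel) \<le> ennreal (m powr (q - 1))"
  shows "(\<integral>\<^sup>+t. indicator {of_int k..<of_int k + 1} t * ennreal ((norm (fl t))\<^sup>2) \<partial>lborel) \<le> ennreal ((d / (2 * T)) powr (2 - q) * m)"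
proof (cases "m = 0")
  \<comment> \<open>The height is then 0 and a negative power of it is useless; instead f vanishes
    almost everywhere on the interval.\<close>
  case True
  with q Lq have "(\<integral>\<^sup>+t. indicator {of_int k..of_int k + 1} t * ennreal (norm (f t) powr q) \<partial>lborel) = 0"
    by simp
  then have "AE t in lborel. indicator {of_int k..of_int k + 1} t * ennreal (norm (f t) powr q) = 0"
    by (subst (asm) nn_integral_0_iff_AE) auto
  then have "AE t in lborel. indicator {of_int k..<of_int k + 1} t * ennreal ((norm (fl t))\<^sup>2) = 0"
  proof eventually_elim
    case (elim t)
    then show ?case
      using fl[of t] by (auto simp: ennreal_eq_0_iff split: split_indicator split_indicator_asm)
  qed
  then have "(\<integral>\<^sup>+t. indicator {of_int k..<of_int k + 1} t * ennreal ((norm (fl t))\<^sup>2) \<partial>lborel) = (\<integral>\<^sup>+t. 0 \<partial>(lborel :: real measure))"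
    by (intro nn_integral_cong_AE)
  then show ?thesis by simp
next
  case False
  then have m0: "m > 0" using m by simp
  define l where "l = d * m / (2 * T)"
  have l: "l > 0" using m0 d T by (simp add: l_def)
  have "indicator {of_int k..<of_int k + 1} t * ennreal ((norm (fl t))\<^sup>2)
      \<le> ennreal (l powr (2 - q)) * (indicator {of_int k..of_int k + 1} t * ennreal (norm (f t) powr q))" for t
  proof (cases "t \<in> {of_int k..<of_int k + 1} \<and> norm (f t) > l")
    case True
    then have "norm (f t) > 0" using l by linarith
    have "(norm (f t))\<^sup>2 = norm (f t) powr (2 - q) * norm (f t) powr q"
      using \<open>norm (f t) > 0\<close> by (simp flip: powr_add)
    also have "\<dots> \<le> l powr (2 - q) * norm (f t) powr q"
      using True l q by (intro mult_right_mono powr_mono2') auto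
    finally have "ennreal ((norm (f t))\<^sup>2) \<le> ennreal (l powr (2 - q)) * ennreal (norm (f t) powr q)"
      by (simp add: ennreal_leI flip: ennreal_mult)
    then show ?thesis using True fl[of t] by (auto simp: l_def split: split_indicator)
  next
    case False
    then have "indicator {of_int k..<of_int k + 1} t * ennreal ((norm (fl t))\<^sup>2) = 0"
      using fl[of t] by (auto simp: l_def split: split_indicator)
    then show ?thesis by (simp only: zero_le)
  qed
  then have "(\<integral>\<^sup>+t. indicator {of_int k..<of_int k + 1} t * ennreal ((norm (fl t))\<^sup>2) \<partial>lborel)
      \<le> (\<integral>\<^sup>+t. ennreal (l powr (2 - q)) * (indicator {of_int k..of_int k + 1} t * ennreal (norm (f t) powr q)) \<partial>lborel)"
    by (intro nn_integral_mono)
  also have "\<dots> = ennreal (l powr (2 - q)) * (\<integral>\<^sup>+t. indicator {of_int k..of_int k + 1} t * ennreal (norm (f t) powr q) \<partial>lborel)"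
    by (rule nn_integral_cmult) measurable
  also have "\<dots> \<le> ennreal (l powr (2 - q)) * ennreal (m powr (q - 1))"
    by (intro mult_left_mono Lq) simp
  also have "\<dots> = ennreal (l powr (2 - q) * m powr (q - 1))"
    by (simp add: ennreal_mult)
  also have "l powr (2 - q) * m powr (q - 1) = (d / (2 * T)) powr (2 - q) * (m powr (2 - q) * m powr (q - 1))"
    using powr_mult[of "d / (2 * T)" m "2 - q"] d T m0 by (simp add: l_def)
  also have "m powr (2 - q) * m powr (q - 1) = m"
    using m0 by (simp flip: powr_add)
  finally show ?thesis .
qed

text \<open>A weak-type bound that replaces the Hausdorff-Young inequality: on the k-th unit interval f is cut at
  height d * m k / (2 * T). The lower part contributes at most d / 2 to the Zak transform pointwise,
  the upper part is small in the L2 norm.\<close>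

lemma zak_weak_type:
  fixes m :: "int \<Rightarrow> real"
  assumes s: "\<bar>s\<bar> = 1" and f: "sq_integrable lborel f" and F: "zak s f F"
    and q: "q \<ge> 2" and d: "d > 0" and T: "T > 0" and m: "\<And>k. m k \<ge> 0"
    and sum: "\<And>X. finite X \<Longrightarrow> sum m X \<le> T"
    and Lq: "\<And>k. (\<integral>\<^sup>+t. indicator {of_int k..of_int k + 1} t * ennreal (norm (f t) powr q) \<partial>lborel) \<le> ennreal (m k powr (q - 1))"
  shows "measure QU {z. d \<le> norm (F z)} \<le> 4 / d\<^sup>2 * ((d / (2 * T)) powr (2 - q) * T)"
proof -
  have [measurable]: "f \<in> borel_measurable borel" using f by (simp add: sq_integrable_def)
  define l where "l k = d * m k / (2 * T)" for k
  define fl where "fl t = (if norm (f t) > l \<lfloor>t\<rfloor> then f t else 0)" for t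
  define fs where "fs t = f t - fl t" for t
  define C where "C = (d / (2 * T)) powr (2 - q)"
  have C: "C \<ge> 0" by (simp add: C_def)
  have l0: "l k \<ge> 0" for k using m[of k] d T by (simp add: l_def)
  have [measurable]: "fl \<in> borel_measurable borel" unfolding fl_def by measurable
  have fl: "sq_integrable lborel fl"
    by (rule sq_integrable_bound[OF f]) (auto simp: fl_def)
  have fs: "sq_integrable lborel fs"
    unfolding fs_def by (intro sq_integrable_diff f fl)
  obtain Fs where Fs: "zak s fs Fs" using zak_exists[OF s fs] by metis
  obtain Fl where Fl: "zak s fl Fl" "(LINT z|QU. (norm (Fl z))\<^sup>2) = (LINT t|lborel. (norm (fl t))\<^sup>2)"
    using zak_exists[OF s fl] by metis
  have [measurable]: "F \<in> borel_measurable borel" "Fl \<in> borel_measurable borel"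
    using F Fl(1) by (auto simp: zak_def sq_integrable_def)
  have FlF: "AE z in QU. F z = Fs z + Fl z"
    using zak_unique[OF s F, of "\<lambda>z. Fs z + Fl z"] zak_add[OF fs fl Fs Fl(1)] by (simp add: fs_def)
  have Fs_bd: "AE z in QU. norm (Fs z) \<le> d / 2"
  proof (rule zak_bound[OF s fs Fs])
    show "AE t in lborel. norm (fs t) \<le> l \<lfloor>t\<rfloor>"
      by (intro AE_I2) (auto simp: fs_def fl_def l0)
    show "sum l X \<le> d / 2" if "finite X" for X
    proof -
      have "sum l X = d / (2 * T) * sum m X" by (simp add: l_def sum_distrib_left)
      also have "\<dots> \<le> d / (2 * T) * T" using d T by (intro mult_left_mono sum that) auto
      finally show ?thesis using T by simp
    qed
  qed
  have part: "(\<Sum>k\<in>{- int N..<int N}. \<integral>\<^sup>+x. ennreal ((norm (fl (x + of_int k)))\<^sup>2) \<partial>IU) \<le> ennreal (C * T)" for N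
  proof -
    have "(\<integral>\<^sup>+x. ennreal ((norm (fl (x + of_int k)))\<^sup>2) \<partial>IU) \<le> ennreal (C * m k)" for k
    proof -
      have "(\<integral>\<^sup>+x. ennreal ((norm (fl (x + of_int k)))\<^sup>2) \<partial>IU) = (\<integral>\<^sup>+t. indicator {of_int k..<of_int k + 1} t * ennreal ((norm (fl t))\<^sup>2) \<partial>lborel)"
        by (rule nn_integral_IU_shift) measurable
      also have "\<dots> \<le> ennreal (C * m k)"
        unfolding C_def
      proof (rule nn_integral_large_part[OF _ _ q d T m _ Lq])
        fix t :: real assume "t \<in> {of_int k..<of_int k + 1}"
        then have "\<lfloor>t\<rfloor> = k" by (simp add: floor_eq_iff)
        then show "fl t = (if norm (f t) > d * m k / (2 * T) then f t else 0)"
          by (simp add: fl_def l_def)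
      qed measurable
      finally show ?thesis .
    qed
    then have "(\<Sum>k\<in>{- int N..<int N}. \<integral>\<^sup>+x. ennreal ((norm (fl (x + of_int k)))\<^sup>2) \<partial>IU) \<le> (\<Sum>k\<in>{- int N..<int N}. ennreal (C * m k))"
      by (intro sum_mono)
    also have "\<dots> = ennreal (C * (\<Sum>k\<in>{- int N..<int N}. m k))"
      using C m by (simp add: sum_distrib_left)
    also have "\<dots> \<le> ennreal (C * T)"
      using C by (intro ennreal_leI mult_left_mono sum) auto
    finally show ?thesis .
  qed
  have "(\<integral>\<^sup>+t. ennreal ((norm (fl t))\<^sup>2) \<partial>lborel) \<le> ennreal (C * T)"
    by (rule LIMSEQ_le_const2[OF LIMSEQ_sum_nn_integral_IU]) (use part in auto)
  then have L2: "(LINT z|QU. (norm (Fl z))\<^sup>2) \<le> C * T"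
    using C T by (simp add: sq_integrable_nn_integral[OF fl] Fl(2))
  \<comment> \<open>Where F reaches d, the lower part contributes at most d / 2, so the upper part
    reaches d / 2. Chebyshev for its square gives the factor 4 / d^2.\<close>
  have "measure QU {z. d \<le> norm (F z)} \<le> measure QU {z \<in> space QU. (d / 2)\<^sup>2 \<le> (norm (Fl z))\<^sup>2}"
  proof (rule Q.finite_measure_mono_AE)
    show "AE z in QU. z \<in> {z. d \<le> norm (F z)} \<longrightarrow> z \<in> {z \<in> space QU. (d / 2)\<^sup>2 \<le> (norm (Fl z))\<^sup>2}"
      using FlF Fs_bd
    proof eventually_elim
      case (elim z)
      have "d / 2 \<le> norm (Fl z)" if "d \<le> norm (F z)"
        using that elim norm_triangle_ineq[of "Fs z" "Fl z"] by simp
      then show ?case using d by (auto intro!: power_mono)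
    qed
  qed measurable
  also have "\<dots> \<le> (LINT z|QU. (norm (Fl z))\<^sup>2) / (d / 2)\<^sup>2"
    using Fl(1) d by (intro integral_Markov_inequality_measure[where A = "{}"]) (auto simp: zak_def sq_integrable_def)
  also have "\<dots> \<le> (C * T) / (d / 2)\<^sup>2"
    using L2 by (intro divide_right_mono) auto
  also have "\<dots> = 4 / d\<^sup>2 * (C * T)" by (simp add: power_divide)
  finally show ?thesis by (simp add: C_def)
qed

section \<open>From Riesz bounds to bounds on the Zak transform\<close>

lemma sq_integrable_lborel_translate:
  fixes f :: "real \<Rightarrow> complex"
  assumes f: "sq_integrable lborel f"
  shows "sq_integrable lborel (\<lambda>t. f (t - a))"
proof -
  have [measurable]: "f \<in> borel_measurable borel" using f by (simp add: sq_integrable_def)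
  have "integrable lborel (\<lambda>t. (norm (f (- a + 1 * t)))\<^sup>2)"
    using f by (intro lborel_integrable_real_affine[of "\<lambda>t. (norm (f t))\<^sup>2"]) (auto simp: sq_integrable_def)
  then show ?thesis by (simp add: sq_integrable_def)
qed

lemma integral_gabor_sum:
  fixes a :: "int \<times> int \<Rightarrow> complex"
  assumes g: "sq_integrable lborel g" and G: "zak (- 1) g G"
  shows "(LINT t|lborel. (norm (\<Sum>i\<in>S. a i * (ee (of_int (snd i) * t) * g (t - of_int (fst i)))))\<^sup>2)
    = (LINT z|QU. (norm ((\<Sum>i\<in>S. a i * trig_mono i z) * G z))\<^sup>2)"
    and "sq_integrable QU (\<lambda>z. (\<Sum>i\<in>S. a i * trig_mono i z) * G z)"
proof -
  let ?h = "\<lambda>i t. ee (of_int (snd i) * t) * g (t - of_int (fst i))"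
  have sq: "sq_integrable lborel (?h i)" for i
    by (rule sq_integrable_mult_bounded[of _ _ _ 1]) (auto intro: sq_integrable_lborel_translate g)
  have z: "zak (- 1) (?h i) (\<lambda>z. trig_mono i z * G z)" for i
    using zak_modulate_translate[OF G, of "snd i" "fst i"] by simp
  have "zak (- 1) (\<lambda>t. \<Sum>i\<in>S. a i * ?h i t) (\<lambda>z. \<Sum>i\<in>S. a i * (trig_mono i z * G z))"
    by (intro zak_finite_sum zak_cmult z sq_integrable_cmult sq)
  then have *: "zak (- 1) (\<lambda>t. \<Sum>i\<in>S. a i * ?h i t) (\<lambda>z. (\<Sum>i\<in>S. a i * trig_mono i z) * G z)"
    by (simp add: sum_distrib_right mult.assoc)
  then show "sq_integrable QU (\<lambda>z. (\<Sum>i\<in>S. a i * trig_mono i z) * G z)"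
    by (simp add: zak_def)
  have "sq_integrable lborel (\<lambda>t. \<Sum>i\<in>S. a i * ?h i t)"
    by (intro sq_integrable_sum sq_integrable_cmult sq)
  from zak_isometry[OF _ this *]
  show "(LINT t|lborel. (norm (\<Sum>i\<in>S. a i * ?h i t))\<^sup>2) = (LINT z|QU. (norm ((\<Sum>i\<in>S. a i * trig_mono i z) * G z))\<^sup>2)"
    by simp
qed

text \<open>A Gabor sum has Zak transform P G with P a trigonometric polynomial, and the sum of
  squared coefficients is the integral of |P|^2. The Riesz inequalities therefore say that |G|^2 - A
  and B - |G|^2 have nonnegative integral against every |P|^2.\<close>

lemma zak_riesz_bounds:
  assumes g: "sq_integrable lborel g" and G: "zak (- 1) g G"
    and lower: "\<And>S a. finite S \<Longrightarrow> A * (\<Sum>i\<in>S. (cmod (a i))\<^sup>2) \<le> (LINT t|lborel. (norm (\<Sum>i\<in>S. a i * (ee (of_int (snd i) * t) * g (t - of_int (fst i)))))\<^sup>2)"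
    and upper: "\<And>S a. finite S \<Longrightarrow> (LINT t|lborel. (norm (\<Sum>i\<in>S. a i * (ee (of_int (snd i) * t) * g (t - of_int (fst i)))))\<^sup>2) \<le> B * (\<Sum>i\<in>S. (cmod (a i))\<^sup>2)"
  shows "AE z in QU. A \<le> (norm (G z))\<^sup>2 \<and> (norm (G z))\<^sup>2 \<le> B"
proof -
  have G2: "integrable QU (\<lambda>z. (norm (G z))\<^sup>2)" using G by (simp add: zak_def sq_integrable_def)
  have P: "\<exists>w. integrable QU (\<lambda>z. (norm (P z))\<^sup>2) \<and> (LINT z|QU. (norm (P z))\<^sup>2) = w
      \<and> integrable QU (\<lambda>z. (norm (P z))\<^sup>2 * (norm (G z))\<^sup>2)
      \<and> A * w \<le> (LINT z|QU. (norm (P z))\<^sup>2 * (norm (G z))\<^sup>2)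
      \<and> (LINT z|QU. (norm (P z))\<^sup>2 * (norm (G z))\<^sup>2) \<le> B * w" if "P \<in> trig_poly" for P
  proof -
    obtain S a where S: "finite S" and P: "P = (\<lambda>z. \<Sum>i\<in>S. a i * trig_mono i z)"
      using \<open>P \<in> trig_poly\<close> unfolding trig_poly_def by blast
    have [measurable]: "P \<in> borel_measurable borel" by (rule measurable_trig_poly[OF that])
    have "norm (P z) \<le> (\<Sum>i\<in>S. norm (a i))" for z
      unfolding P by (rule order.trans[OF norm_sum]) (simp add: norm_mult)
    then have "integrable QU (\<lambda>z. (norm (P z))\<^sup>2)"
      by (intro Q.integrable_const_bound[of _ "(\<Sum>i\<in>S. norm (a i))\<^sup>2"]) (auto intro!: power_mono)
    moreover have "integrable QU (\<lambda>z. (norm (P z))\<^sup>2 * (norm (G z))\<^sup>2)"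
      using integral_gabor_sum(2)[OF g G, of a S] by (simp add: sq_integrable_def P norm_mult power_mult_distrib)
    ultimately show ?thesis
      using lower[OF S, of a] upper[OF S, of a] integral_gabor_sum(1)[OF g G, of a S] integral_norm_trig_sum[OF S, of a]
      by (intro exI[of _ "\<Sum>i\<in>S. (cmod (a i))\<^sup>2"]) (simp add: P norm_mult power_mult_distrib)
  qed
  have "AE z in QU. 0 \<le> (norm (G z))\<^sup>2 - A"
  proof (rule trig_poly_nonneg_imp_AE_nonneg)
    show "integrable QU (\<lambda>z. (norm (G z))\<^sup>2 - A)" using G2 by simp
    show "0 \<le> (LINT z|QU. (norm (P z))\<^sup>2 * ((norm (G z))\<^sup>2 - A))" if "P \<in> trig_poly" for P
      using P[OF that] by (auto simp: right_diff_distrib mult.commute[of A])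
  qed
  moreover have "AE z in QU. 0 \<le> B - (norm (G z))\<^sup>2"
  proof (rule trig_poly_nonneg_imp_AE_nonneg)
    show "integrable QU (\<lambda>z. B - (norm (G z))\<^sup>2)" using G2 by simp
    show "0 \<le> (LINT z|QU. (norm (P z))\<^sup>2 * (B - (norm (G z))\<^sup>2))" if "P \<in> trig_poly" for P
      using P[OF that] by (auto simp: right_diff_distrib mult.commute[of B])
  qed
  ultimately show ?thesis by eventually_elim simp
qed

section \<open>Poisson summation\<close>

lemma QU_swap: "distr QU QU (\<lambda>z. (snd z, fst z)) = QU"
proof -
  have "(\<lambda>(x, y). (y, x)) = (\<lambda>z::real \<times> real. (snd z, fst z))" by (auto simp: fun_eq_iff)
  then show ?thesis
    using QU.distr_pair_swap unfolding QU_def by simp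
qed

lemma measurable_swap_borel [measurable]: "(\<lambda>z. (snd z, fst z)) \<in> measurable QU QU"
  unfolding QU_def by measurable

lemma integral_QU_swap:
  fixes f :: "real \<times> real \<Rightarrow> 'b::{banach, second_countable_topology}"
  assumes "f \<in> borel_measurable borel"
  shows "(LINT z|QU. f (snd z, fst z)) = (LINT z|QU. f z)"
    and "integrable QU (\<lambda>z. f (snd z, fst z)) = integrable QU f"
proof -
  have [measurable]: "f \<in> borel_measurable QU" using assms by simp
  show "(LINT z|QU. f (snd z, fst z)) = (LINT z|QU. f z)"
    using integral_distr[OF measurable_swap_borel, of f] by (simp add: QU_swap)
  show "integrable QU (\<lambda>z. f (snd z, fst z)) = integrable QU f"
    using integrable_distr_eq[OF measurable_swap_borel, of f] by (simp add: QU_swap)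
qed

lemma integral_IU_shift:
  fixes h :: "real \<Rightarrow> complex"
  assumes [measurable]: "h \<in> borel_measurable borel"
  shows "(LINT x|IU. h (x + of_int k)) = (LINT t|lborel. indicator {of_int k..<of_int k + 1} t *\<^sub>R h t)"
proof -
  have "(LINT x|IU. h (x + of_int k)) = (LINT x|lborel. indicator {of_int k..<of_int k + 1} (of_int k + 1 * x) *\<^sub>R h (of_int k + 1 * x))"
    by (subst integral_IU) (auto intro!: Bochner_Integration.integral_cong simp: add.commute split: split_indicator)
  also have "\<dots> = (LINT t|lborel. indicator {of_int k..<of_int k + 1} t *\<^sub>R h t)"
    using lborel_integral_real_affine[of 1 "\<lambda>t. indicator {of_int k..<of_int k + 1} t *\<^sub>R h t" "of_int k"] by simp
  finally show ?thesis .
qed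

definition fourier_trunc :: "(real \<Rightarrow> complex) \<Rightarrow> nat \<Rightarrow> real \<Rightarrow> complex" where
  "fourier_trunc g N w = (LINT t|lborel. indicator {- real N..real N} t *\<^sub>R (ee (- (w * t)) * g t))"

lemma sq_integrable_imp_integrable_Icc:
  assumes g: "sq_integrable lborel g"
  shows "integrable lborel (\<lambda>t. indicator {- real N..real N} t *\<^sub>R g t)"
proof (rule Bochner_Integration.integrable_bound)
  have [measurable]: "g \<in> borel_measurable borel" using g by (simp add: sq_integrable_def)
  show "integrable lborel (\<lambda>t. indicator {- real N..real N} t + (norm (g t))\<^sup>2 :: real)"
    using g by (auto simp: sq_integrable_def)
  show "(\<lambda>t. indicator {- real N..real N} t *\<^sub>R g t) \<in> borel_measurable lborel" by measurable
  show "AE t in lborel. norm (indicator {- real N..real N} t *\<^sub>R g t) \<le> norm (indicator {- real N..real N} t + (norm (g t))\<^sup>2 :: real)"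
    by (intro AE_I2) (use le_one_plus_square in \<open>auto split: split_indicator\<close>)
qed

lemma fourier_trunc_measurable [measurable]:
  assumes [measurable]: "g \<in> borel_measurable borel"
  shows "fourier_trunc g N \<in> borel_measurable borel"
  unfolding fourier_trunc_def by measurable

lemma norm_fourier_trunc_le:
  assumes g: "sq_integrable lborel g"
  shows "norm (fourier_trunc g N w) \<le> (LINT t|lborel. norm (indicator {- real N..real N} t *\<^sub>R g t))"
proof -
  have "norm (fourier_trunc g N w) \<le> (LINT t|lborel. norm (indicator {- real N..real N} t *\<^sub>R (ee (- (w * t)) * g t)))"
    unfolding fourier_trunc_def by (rule integral_norm_bound)
  then show ?thesis by (simp add: norm_mult)
qed

text \<open>The unit intervals indexed by {-N..<N} tile [-N, N), which differs from the closed
  interval by one null point. This matches the truncated Fourier integral with the N-th partial sum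
  of the Zak series.\<close>

lemma fourier_trunc_eq_sum:
  assumes g: "sq_integrable lborel g"
  shows "fourier_trunc g N w = (\<Sum>j\<in>{- int N..<int N}. LINT x|IU. ee (- (w * (x + of_int j))) * g (x + of_int j))"
proof -
  have [measurable]: "g \<in> borel_measurable borel" using g by (simp add: sq_integrable_def)
  let ?h = "\<lambda>t. ee (- (w * t)) * g t"
  have int: "integrable lborel (\<lambda>t. indicator {of_int j..<of_int j + 1} t *\<^sub>R ?h t)" if "j \<in> {- int N..<int N}" for j
  proof (rule Bochner_Integration.integrable_bound[OF sq_integrable_imp_integrable_Icc[OF g, of N]])
    show "AE t in lborel. norm (indicator {of_int j..<of_int j + 1} t *\<^sub>R ?h t) \<le> norm (indicator {- real N..real N} t *\<^sub>R g t)"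
      using that by (intro AE_I2) (auto simp: norm_mult split: split_indicator)
  qed measurable
  have ind: "(\<Sum>j\<in>{- int N..<int N}. indicator {of_int j..<of_int j + 1} t) = (indicator {- real N..<real N} t :: real)" for t
  proof -
    have "ennreal (\<Sum>j\<in>{- int N..<int N}. indicator {of_int j..<of_int j + 1} t) = ennreal (indicator {- real N..<real N} t)"
      using sum_indicator_unit_intervals[where t = t and N = N] by (simp flip: sum_ennreal ennreal_indicator)
    then show ?thesis by (subst (asm) ennreal_inj) (auto intro: sum_nonneg)
  qed
  have "AE t in lborel. t \<noteq> real N" by (rule AE_lborel_singleton)
  then have "fourier_trunc g N w = (LINT t|lborel. indicator {- real N..<real N} t *\<^sub>R ?h t)"
    unfolding fourier_trunc_def by (intro integral_cong_AE) (auto elim!: eventually_mono split: split_indicator)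
  also have "\<dots> = (LINT t|lborel. (\<Sum>j\<in>{- int N..<int N}. indicator {of_int j..<of_int j + 1} t *\<^sub>R ?h t))"
    by (simp only: ind scaleR_left.sum[symmetric])
  also have "\<dots> = (\<Sum>j\<in>{- int N..<int N}. LINT t|lborel. indicator {of_int j..<of_int j + 1} t *\<^sub>R ?h t)"
    using int by (rule Bochner_Integration.integral_sum)
  also have "\<dots> = (\<Sum>j\<in>{- int N..<int N}. LINT x|IU. ?h (x + of_int j))"
    by (intro sum.cong refl integral_IU_shift[symmetric]) measurable
  finally show ?thesis .
qed

text \<open>Poisson summation: the Fourier coefficients in x of exp (- 2 pi i x w) G (x, w) are the values of
  the Fourier transform of g at w + k.\<close>

lemma zak_fourier:
  assumes g: "sq_integrable lborel g" and gh: "sq_integrable lborel gh"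
    and G: "zak (- 1) g G"
    and Glim: "(\<lambda>N. LINT z|QU. (norm (G z - zak_sum (- 1) g {- int N..<int N} z))\<^sup>2) \<longlonglongrightarrow> 0"
    and four: "(\<lambda>N. \<integral>\<^sup>+w. ennreal ((norm (gh w - fourier_trunc g N w))\<^sup>2) \<partial>lborel) \<longlonglongrightarrow> 0"
  shows "zak 1 gh (\<lambda>z. ee (- (fst z * snd z)) * G (snd z, fst z))"
  unfolding zak_def
proof (intro conjI allI)
  have [measurable]: "g \<in> borel_measurable borel" "gh \<in> borel_measurable borel"
    using g gh by (auto simp: sq_integrable_def)
  have G2: "sq_integrable QU G" using G by (simp add: zak_def)
  then have Gm [measurable]: "G \<in> borel_measurable borel"
    by (auto simp: sq_integrable_def)
  have cont: "continuous_on UNIV (\<lambda>z. ee (of_int n * snd z - of_int k * fst z - fst z * snd z))" for n k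
    by (intro continuous_intros)
  have "sq_integrable QU (\<lambda>z. G (snd z, fst z))"
    using G2 integral_QU_swap(2)[of "\<lambda>z. (norm (G z))\<^sup>2"] measurable_compose[OF measurable_swap_borel, of G borel]
    by (simp add: sq_integrable_def)
  then show "sq_integrable QU (\<lambda>z. ee (- (fst z * snd z)) * G (snd z, fst z))"
    by (rule sq_integrable_mult_bounded[of _ _ _ 1])
       (auto intro!: borel_measurable_continuous_onI continuous_intros simp: measurable_cong_sets[OF sets_QU refl])
  fix k n :: int
  \<comment> \<open>The test character and the quasi-periodicity factor are merged, in the
    coordinates of G, into one unimodular multiplier against which the L2 limit can be
    taken.\<close>
  define u where "u z = ee (of_int n * snd z - of_int k * fst z - fst z * snd z)" for z
  have [measurable]: "u \<in> borel_measurable borel"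
    unfolding u_def by (rule borel_measurable_continuous_onI[OF cont])
  have sqF: "sq_integrable QU (zak_sum (- 1) g {- int N..<int N})" for N
    by (rule zak_sum_norm(1)) (use g in auto)
  have lhs: "(LINT z|QU. trig_mono (1 * k, n) z * (ee (- (fst z * snd z)) * G (snd z, fst z))) = (LINT z|QU. u z * G z)"
  proof -
    have "(LINT z|QU. trig_mono (1 * k, n) z * (ee (- (fst z * snd z)) * G (snd z, fst z))) = (LINT z|QU. u (snd z, fst z) * G (snd z, fst z))"
    proof (rule arg_cong[where f = "integral\<^sup>L QU"], rule ext)
      fix z
      have "trig_mono (1 * k, n) z * ee (- (fst z * snd z)) = u (snd z, fst z)"
        unfolding trig_mono_def u_def ee_add[symmetric] by (rule arg_cong[where f = ee]) (simp add: algebra_simps)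
      then show "trig_mono (1 * k, n) z * (ee (- (fst z * snd z)) * G (snd z, fst z)) = u (snd z, fst z) * G (snd z, fst z)"
        by (simp only: mult.assoc[symmetric])
    qed
    also have "\<dots> = (LINT z|QU. u z * G z)"
      by (rule integral_QU_swap(1)[of "\<lambda>z. u z * G z"]) measurable
    finally show ?thesis .
  qed
  have lim1: "(\<lambda>N. LINT z|QU. u z * zak_sum (- 1) g {- int N..<int N} z) \<longlonglongrightarrow> (LINT z|QU. u z * G z)"
  proof (rule L2_tendsto_integral[OF prob_space_QU sqF G2 Glim])
    show "norm (u z) \<le> 1" for z by (simp add: u_def)
  qed measurable
  have eq: "(LINT z|QU. u z * zak_sum (- 1) g {- int N..<int N} z) = (LINT w|IU. ee (of_int n * w) * fourier_trunc g N (w + of_int k))" for N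
  proof -
    define h where "h j z = ee (of_int n * snd z) * (ee (- ((snd z + of_int k) * (fst z + of_int j))) * g (fst z + of_int j))" for j and z :: "real \<times> real"
    have hm [measurable]: "h j \<in> borel_measurable (borel \<Otimes>\<^sub>M borel)" for j
      unfolding h_def by measurable
    have hint: "integrable (IU \<Otimes>\<^sub>M IU) (h j)" for j
    proof (rule Bochner_Integration.integrable_bound)
      show "integrable (IU \<Otimes>\<^sub>M IU) (\<lambda>z. g (fst z + of_int j) * 1)"
        using integral_QU_product(1)[of "\<lambda>x. g (x + of_int j)" "\<lambda>_. 1"] IU.sq_integrable_imp_integrable[OF sq_integrable_shift[OF g]]
        by (simp add: QU_def)
    qed (auto simp: h_def norm_mult)
    have "u z * zak_sum (- 1) g {- int N..<int N} z = (\<Sum>j\<in>{- int N..<int N}. h j z)" for z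
    proof -
      have "u z * ee (of_int (- 1 * j) * snd z) = ee (of_int n * snd z) * ee (- ((snd z + of_int k) * (fst z + of_int j)))" for j
      proof -
        \<comment> \<open>Completing the product (w + k) (x + j) costs only the integer j k, which
          the character does not see; this moves the frequency from w to w + k.\<close>
        have "u z * ee (of_int (- 1 * j) * snd z) = ee (of_int n * snd z - (snd z + of_int k) * (fst z + of_int j) + of_int (j * k))"
          unfolding u_def ee_add[symmetric] by (rule arg_cong[where f = ee]) (simp add: algebra_simps)
        also have "\<dots> = ee (of_int n * snd z) * ee (- ((snd z + of_int k) * (fst z + of_int j)))"
          unfolding ee_add_int ee_diff ..
        finally show ?thesis .
      qed
      then show ?thesis
        unfolding zak_sum_def h_def sum_distrib_left mult.assoc[symmetric]
        by (simp only: mult.assoc[of "u z"] mult.commute[of "g v" for v] mult.assoc[symmetric])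
    qed
    then have "(LINT z|QU. u z * zak_sum (- 1) g {- int N..<int N} z) = (\<Sum>j\<in>{- int N..<int N}. LINT z|QU. h j z)"
      using hint by (simp add: QU_def)
    also have "\<dots> = (\<Sum>j\<in>{- int N..<int N}. (LINT w|IU. (LINT x|IU. h j (x, w))))"
    proof (intro sum.cong refl)
      fix j
      show "(LINT z|QU. h j z) = (LINT w|IU. (LINT x|IU. h j (x, w)))"
        using QU.integral_snd[of "\<lambda>x w. h j (x, w)"] hint[of j] by (simp add: QU_def)
    qed
    also have "\<dots> = (LINT w|IU. (\<Sum>j\<in>{- int N..<int N}. (LINT x|IU. h j (x, w))))"
    proof (rule Bochner_Integration.integral_sum[symmetric])
      fix j
      show "integrable IU (\<lambda>w. LINT x|IU. h j (x, w))"
        using QU.integrable_snd[of "\<lambda>x w. h j (x, w)"] hint[of j] by simp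
    qed
    also have "\<dots> = (LINT w|IU. ee (of_int n * w) * fourier_trunc g N (w + of_int k))"
      by (simp add: fourier_trunc_eq_sum[OF g] sum_distrib_left h_def)
    finally show ?thesis .
  qed
  have tr: "sq_integrable IU (\<lambda>w. fourier_trunc g N (w + of_int k))" for N
    unfolding sq_integrable_def
  proof
    show "integrable IU (\<lambda>w. (norm (fourier_trunc g N (w + of_int k)))\<^sup>2)"
    proof (rule IU.integrable_const_bound)
      show "AE w in IU. norm ((norm (fourier_trunc g N (w + of_int k)))\<^sup>2)
          \<le> (LINT t|lborel. norm (indicator {- real N..real N} t *\<^sub>R g t))\<^sup>2"
        unfolding real_norm_def abs_power2
        by (intro AE_I2 power_mono norm_fourier_trunc_le[OF g] norm_ge_zero)
    qed measurable
  qed measurable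
  \<comment> \<open>L2 convergence on the line restricts to the k-th unit interval, which is all
    that one row of coefficients involves.\<close>
  have "(\<lambda>N. ennreal (LINT w|IU. (norm (gh (w + of_int k) - fourier_trunc g N (w + of_int k)))\<^sup>2)) \<longlonglongrightarrow> ennreal 0"
  proof (rule tendsto_sandwich[OF _ _ tendsto_const])
    show "\<forall>\<^sub>F N in sequentially. ennreal (LINT w|IU. (norm (gh (w + of_int k) - fourier_trunc g N (w + of_int k)))\<^sup>2)
        \<le> (\<integral>\<^sup>+w. ennreal ((norm (gh w - fourier_trunc g N w))\<^sup>2) \<partial>lborel)"
    proof (intro always_eventually allI)
      fix N
      have "ennreal (LINT w|IU. (norm (gh (w + of_int k) - fourier_trunc g N (w + of_int k)))\<^sup>2)
          = (\<integral>\<^sup>+w. ennreal ((norm (gh (w + of_int k) - fourier_trunc g N (w + of_int k)))\<^sup>2) \<partial>IU)"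
        by (intro sq_integrable_nn_integral[symmetric] sq_integrable_diff sq_integrable_shift gh tr)
      also have "\<dots> = (\<integral>\<^sup>+w. indicator {of_int k..<of_int k + 1} w * ennreal ((norm (gh w - fourier_trunc g N w))\<^sup>2) \<partial>lborel)"
        by (rule nn_integral_IU_shift) measurable
      also have "\<dots> \<le> (\<integral>\<^sup>+w. ennreal ((norm (gh w - fourier_trunc g N w))\<^sup>2) \<partial>lborel)"
        by (intro nn_integral_mono) (auto split: split_indicator)
      finally show "ennreal (LINT w|IU. (norm (gh (w + of_int k) - fourier_trunc g N (w + of_int k)))\<^sup>2)
        \<le> (\<integral>\<^sup>+w. ennreal ((norm (gh w - fourier_trunc g N w))\<^sup>2) \<partial>lborel)" .
    qed
  qed (use four in auto)
  then have "(\<lambda>N. LINT w|IU. (norm (gh (w + of_int k) - fourier_trunc g N (w + of_int k)))\<^sup>2) \<longlonglongrightarrow> 0"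
    by (subst (asm) tendsto_ennreal_iff) auto
  then have "(\<lambda>N. LINT w|IU. ee (of_int n * w) * fourier_trunc g N (w + of_int k)) \<longlonglongrightarrow> (LINT w|IU. ee (of_int n * w) * gh (w + of_int k))"
    by (intro L2_tendsto_integral prob_space_IU tr sq_integrable_shift gh) auto
  with lim1 show "(LINT z|QU. trig_mono (1 * k, n) z * (ee (- (fst z * snd z)) * G (snd z, fst z))) = (LINT w|IU. ee (of_int n * w) * gh (w + of_int k))"
    unfolding lhs eq by (rule LIMSEQ_unique)
qed

subsection \<open>Measure of the jump set\<close>

lemma nn_integral_IU_split:
  fixes h :: "real \<Rightarrow> ennreal"
  assumes [measurable]: "h \<in> borel_measurable borel" and M: "M > 0"
  shows "(\<integral>\<^sup>+x. h x \<partial>IU) = (\<integral>\<^sup>+x. indicator {0..<1 / real M} x * (\<Sum>j<M. h (x + real j / real M)) \<partial>lborel)"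
proof -
  have ind: "indicator {0..<1} x = (\<Sum>j<M. indicator {real j / real M..<(real j + 1) / real M} x :: ennreal)" for x :: real
  proof -
    have "(\<Sum>j<M. indicator {real j / real M..<(real j + 1) / real M} x :: ennreal) = (\<Sum>j<M. of_bool (int j = \<lfloor>real M * x\<rfloor>))"
    proof (intro sum.cong refl)
      fix j
      have "x \<in> {real j / real M..<(real j + 1) / real M} \<longleftrightarrow> int j = \<lfloor>real M * x\<rfloor>"
        using M by (auto simp: eq_commute[of "int j"] floor_eq_iff field_simps)
      then show "indicator {real j / real M..<(real j + 1) / real M} x = (of_bool (int j = \<lfloor>real M * x\<rfloor>) :: ennreal)"
        by (simp add: indicator_def)
    qed
    also have "\<dots> = of_bool (0 \<le> \<lfloor>real M * x\<rfloor> \<and> \<lfloor>real M * x\<rfloor> < int M)"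
    proof -
      define k where "k = \<lfloor>real M * x\<rfloor>"
      have "{..<M} \<inter> {j. int j = k} = (if 0 \<le> k \<and> k < int M then {nat k} else {})" by auto
      then show ?thesis by (simp add: k_def[symmetric])
    qed
    also have "0 \<le> \<lfloor>real M * x\<rfloor> \<and> \<lfloor>real M * x\<rfloor> < int M \<longleftrightarrow> x \<in> {0..<1}"
      using M by (auto simp: floor_less_iff zero_le_mult_iff)
    finally show ?thesis by (simp add: indicator_def)
  qed
  have "(\<integral>\<^sup>+x. h x \<partial>IU) = (\<integral>\<^sup>+x. (\<Sum>j<M. indicator {real j / real M..<(real j + 1) / real M} x * h x) \<partial>lborel)"
    by (subst nn_integral_IU) (simp_all only: ind sum_distrib_right assms)
  also have "\<dots> = (\<Sum>j<M. \<integral>\<^sup>+x. indicator {real j / real M..<(real j + 1) / real M} x * h x \<partial>lborel)"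
    by (rule nn_integral_sum) measurable
  also have "\<dots> = (\<Sum>j<M. \<integral>\<^sup>+x. indicator {0..<1 / real M} x * h (x + real j / real M) \<partial>lborel)"
  proof (intro sum.cong refl)
    fix j
    have "(\<integral>\<^sup>+x. indicator {real j / real M..<(real j + 1) / real M} x * h x \<partial>lborel)
        = (\<integral>\<^sup>+x. indicator {real j / real M..<(real j + 1) / real M} (real j / real M + 1 * x) * h (real j / real M + 1 * x) \<partial>lborel)"
      using nn_integral_real_affine[of "\<lambda>x. indicator {real j / real M..<(real j + 1) / real M} x * h x" 1 "real j / real M"] by simp
    also have "\<dots> = (\<integral>\<^sup>+x. indicator {0..<1 / real M} x * h (x + real j / real M) \<partial>lborel)"
      by (intro nn_integral_cong) (auto simp: add.commute add_divide_distrib split: split_indicator)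
    finally show "(\<integral>\<^sup>+x. indicator {real j / real M..<(real j + 1) / real M} x * h x \<partial>lborel)
        = (\<integral>\<^sup>+x. indicator {0..<1 / real M} x * h (x + real j / real M) \<partial>lborel)" .
  qed
  also have "\<dots> = (\<integral>\<^sup>+x. (\<Sum>j<M. indicator {0..<1 / real M} x * h (x + real j / real M)) \<partial>lborel)"
    by (rule nn_integral_sum[symmetric]) measurable
  finally show ?thesis by (simp only: sum_distrib_left)
qed

text \<open>The translates of the base cell by the M N grid points tile the square, so the measure
  of E is the integral over that cell of the number of translated grid points in E. The covering
  hypothesis makes this number at least 1.\<close>

lemma grid_cover:
  fixes E :: "(real \<times> real) set" and M N :: nat
  assumes E: "E \<in> sets borel" and M: "M > 0" and N: "N > 0"
    and cover: "\<And>x y. x \<in> {0..<1 / real M} \<Longrightarrow> y \<in> {0..<1 / real N} \<Longrightarrow>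
      \<exists>j<M. \<exists>l<N. (x + real j / real M, y + real l / real N) \<in> E"
  shows "1 / (real M * real N) \<le> measure QU E"
proof -
  have [measurable]: "E \<in> sets (borel \<Otimes>\<^sub>M borel)" using E by (simp only: borel_prod)
  have ind_le: "(1::ennreal) \<le> (\<Sum>j<M. \<Sum>l<N. indicator E (x + real j / real M, y + real l / real N))"
    if xy: "x \<in> {0..<1 / real M}" "y \<in> {0..<1 / real N}" for x y
  proof -
    obtain j l where jl: "j < M" "l < N" "(x + real j / real M, y + real l / real N) \<in> E"
      using cover[OF xy] by blast
    have "(1::ennreal) = indicator E (x + real j / real M, y + real l / real N)" using jl by simp
    also have "\<dots> \<le> (\<Sum>l<N. indicator E (x + real j / real M, y + real l / real N))"
      using jl by (intro member_le_sum) auto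
    also have "\<dots> \<le> (\<Sum>j<M. \<Sum>l<N. indicator E (x + real j / real M, y + real l / real N))"
      using jl by (intro member_le_sum[where f = "\<lambda>j. \<Sum>l<N. indicator E (x + real j / real M, y + real l / real N)"]) auto
    finally show ?thesis .
  qed
  have cell: "(\<integral>\<^sup>+x. indicator {0..<1 / real M} x \<partial>lborel) = ennreal (1 / real M)" if "M > 0" for M :: nat
    using that by simp
  have "ennreal (1 / (real M * real N)) = (\<integral>\<^sup>+x. indicator {0..<1 / real M} x * ennreal (1 / real N) \<partial>lborel)"
    using M N by (simp add: nn_integral_multc flip: ennreal_mult)
  also have "\<dots> = (\<integral>\<^sup>+x. indicator {0..<1 / real M} x * (\<integral>\<^sup>+y. indicator {0..<1 / real N} y \<partial>lborel) \<partial>lborel)"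
    by (simp only: cell[OF N])
  also have "\<dots> \<le> (\<integral>\<^sup>+x. indicator {0..<1 / real M} x * (\<Sum>j<M. \<integral>\<^sup>+y. indicator E (x + real j / real M, y) \<partial>IU) \<partial>lborel)"
  proof (rule nn_integral_mono)
    fix x :: real
    have "(\<integral>\<^sup>+y. indicator {0..<1 / real N} y \<partial>lborel)
      \<le> (\<Sum>j<M. \<integral>\<^sup>+y. indicator E (x + real j / real M, y) \<partial>IU)" if x: "x \<in> {0..<1 / real M}"
    proof -
      have "(\<integral>\<^sup>+y. indicator {0..<1 / real N} y \<partial>lborel)
        \<le> (\<integral>\<^sup>+y. (\<Sum>j<M. indicator {0..<1 / real N} y * (\<Sum>l<N. indicator E (x + real j / real M, y + real l / real N))) \<partial>lborel)"
        unfolding sum_distrib_left[symmetric]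
        by (intro nn_integral_mono) (use ind_le[OF x] in \<open>auto split: split_indicator\<close>)
      also have "\<dots> = (\<Sum>j<M. \<integral>\<^sup>+y. indicator {0..<1 / real N} y * (\<Sum>l<N. indicator E (x + real j / real M, y + real l / real N)) \<partial>lborel)"
        by (rule nn_integral_sum) measurable
      also have "\<dots> = (\<Sum>j<M. \<integral>\<^sup>+y. indicator E (x + real j / real M, y) \<partial>IU)"
        by (intro sum.cong refl nn_integral_IU_split[symmetric] N) measurable
      finally show ?thesis .
    qed
    then show "indicator {0..<1 / real M} x * (\<integral>\<^sup>+y. indicator {0..<1 / real N} y \<partial>lborel)
      \<le> indicator {0..<1 / real M} x * (\<Sum>j<M. \<integral>\<^sup>+y. indicator E (x + real j / real M, y) \<partial>IU)"
      by (cases "x \<in> {0..<1 / real M}") auto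
  qed
  also have "\<dots> = (\<integral>\<^sup>+x. \<integral>\<^sup>+y. indicator E (x, y) \<partial>IU \<partial>IU)"
    by (rule nn_integral_IU_split[OF _ M, symmetric]) measurable
  also have "\<dots> = (\<integral>\<^sup>+z. indicator E z \<partial>(IU \<Otimes>\<^sub>M IU))"
    by (rule IU.nn_integral_fst) measurable
  also have "\<dots> = ennreal (measure QU E)"
    using E by (simp add: Q.emeasure_eq_measure flip: QU_def)
  finally show ?thesis by simp
qed

lemma AE_QU_fst:
  assumes "AE x in IU. P x"
  shows "AE z in QU. P (fst z)"
proof -
  obtain N where N: "{x \<in> space IU. \<not> P x} \<subseteq> N" "emeasure IU N = 0" "N \<in> sets IU"
    using assms by (rule AE_E)
  have [measurable]: "N \<in> sets borel" using N(3) by simp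
  have ae: "AE x in IU. x \<notin> N" using N(2,3) by (intro AE_not_in) auto
  have "AE z in QU. fst z \<notin> N"
    unfolding QU_def
  proof (rule QU.AE_pair_measure)
    show "{z \<in> space (IU \<Otimes>\<^sub>M IU). fst z \<notin> N} \<in> sets (IU \<Otimes>\<^sub>M IU)" by measurable
  qed (use ae in simp)
  then show ?thesis by eventually_elim (use N(1) in auto)
qed

lemma AE_QU_snd:
  assumes "AE x in IU. P x"
  shows "AE z in QU. P (snd z)"
proof -
  obtain N where N: "{x \<in> space IU. \<not> P x} \<subseteq> N" "emeasure IU N = 0" "N \<in> sets IU"
    using assms by (rule AE_E)
  have [measurable]: "N \<in> sets borel" using N(3) by simp
  have ae: "AE x in IU. x \<notin> N" using N(2,3) by (intro AE_not_in) auto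
  have "AE z in QU. snd z \<notin> N"
    unfolding QU_def
  proof (rule QU.AE_pair_measure)
    show "{z \<in> space (IU \<Otimes>\<^sub>M IU). snd z \<notin> N} \<in> sets (IU \<Otimes>\<^sub>M IU)" by measurable
  qed (use ae in simp)
  then show ?thesis by eventually_elim (use N(1) in auto)
qed

section \<open>The smoothed Zak transform\<close>

definition vp_cut :: "nat \<Rightarrow> (real \<Rightarrow> complex) \<Rightarrow> real \<Rightarrow> complex" where
  "vp_cut K f t = of_real (vp_weight K \<lfloor>t\<rfloor>) * f t"

definition zak_low :: "int \<Rightarrow> (real \<Rightarrow> complex) \<Rightarrow> nat \<Rightarrow> real \<times> real \<Rightarrow> complex" where
  "zak_low s f K = zak_sum s (vp_cut K f) {- 2 * int K..2 * int K}"

lemma sq_integrable_vp_cut: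
  assumes f: "sq_integrable lborel f"
  shows "sq_integrable lborel (vp_cut K f)"
  unfolding vp_cut_def
proof (rule sq_integrable_mult_bounded[OF f])
  show "(\<lambda>t::real. complex_of_real (vp_weight K \<lfloor>t\<rfloor>)) \<in> borel_measurable lborel" by measurable
  show "norm (complex_of_real (vp_weight K \<lfloor>t\<rfloor>)) \<le> 1" for t :: real
    using vp_weight_nonneg[of K "\<lfloor>t\<rfloor>"] vp_weight_le_1[of K "\<lfloor>t\<rfloor>"] by simp
qed

lemma zak_zak_low:
  assumes s: "\<bar>s\<bar> = 1" and f: "sq_integrable lborel f"
  shows "zak s (vp_cut K f) (zak_low s f K)"
  unfolding zak_low_def
proof (rule zak_finite_support[OF s sq_integrable_vp_cut[OF f]])
  fix k :: int and x :: real
  assume "k \<notin> {- 2 * int K..2 * int K}" "x \<in> {0..<1}"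
  then show "vp_cut K f (x + of_int k) = 0"
    by (simp only: vp_cut_def floor_add_int_unit) (simp add: vp_weight_eq_0)
qed simp

text \<open>A finite sum of characters is periodic at every point, not merely almost everywhere, so
  a grid step that wraps around may be replaced by an ordinary small step.\<close>

lemma zak_low_periodic: "zak_low s f K (x, y + of_int n) = zak_low s f K (x, y)"
proof -
  have "ee (of_int (s * k) * (y + of_int n)) = ee (of_int (s * k) * y)" for k
    using ee_add_int[of "of_int (s * k) * y" "s * k * n"] by (simp add: distrib_left)
  then show ?thesis by (simp add: zak_low_def zak_sum_def del: of_int_mult)
qed

text \<open>For almost every x the values f (x + k) are the Fourier coefficients of a bounded fibre,
  to which the kernel estimate applies. The exceptional set of x does not depend on y and y', as is
  needed to compare arbitrary points of one grid column.\<close>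

lemma zak_low_increment:
  assumes s: "\<bar>s\<bar> = 1" and K: "K \<ge> 1" and f: "sq_integrable lborel f" and F: "zak s f F"
    and b: "b \<ge> 0" and Fb: "AE z in QU. norm (F z) \<le> b"
  shows "AE x in IU. \<forall>y y'. norm (zak_low s f K (x, y') - zak_low s f K (x, y)) \<le> 48 * b * real K * \<bar>y' - y\<bar>"
proof -
  have "AE x in IU. \<forall>k. integrable IU (\<lambda>y. F (x, y)) \<and> (LINT y|IU. ee (- of_int (s * k) * y) * F (x, y)) = f (x + of_int k)"
    unfolding AE_all_countable using zak_fiber_coeff[OF s f F] by blast
  moreover have "AE x in IU. AE y in IU. norm (F (x, y)) \<le> b"
    using Fb unfolding QU_def by (rule QU.AE_pair)
  ultimately show ?thesis using AE_IU_mem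
  proof eventually_elim
    case (elim x)
    have eq: "zak_low s f K (x, y) = (\<Sum>k\<in>{- 2 * int K..2 * int K}. of_real (vp_weight K k) *
        ((LINT y|IU. ee (- of_int (s * k) * y) * F (x, y)) * ee (of_int (s * k) * y)))" for y
      unfolding zak_low_def zak_sum_def
    proof (intro sum.cong refl)
      fix k
      have "vp_cut K f (x + of_int k) = of_real (vp_weight K k) * (LINT y|IU. ee (- of_int (s * k) * y) * F (x, y))"
        using elim(1)[rule_format, of k] floor_add_int_unit[OF elim(3)] by (simp only: vp_cut_def)
      then show "vp_cut K f (fst (x, y) + of_int k) * ee (of_int (s * k) * snd (x, y)) =
        of_real (vp_weight K k) * ((LINT y|IU. ee (- of_int (s * k) * y) * F (x, y)) * ee (of_int (s * k) * y))"
        by (simp only: fst_conv snd_conv mult.assoc)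
    qed
    show ?case
      unfolding eq
      by (intro allI vp_sum_increment[OF s K _ _ b refl]) (use elim in auto)
  qed
qed

text \<open>If a translated grid met only good points with both remainders below sqrt A / 8, every
  step of G in the second variable and of H in the first would be less than half the modulus,
  against the winding argument. So every translate meets the bad set.\<close>

lemma zak_jump_measure:
  assumes A: "A > 0" and g: "sq_integrable lborel g" and gh: "sq_integrable lborel gh"
    and G: "zak (- 1) g G" and H: "zak 1 gh (\<lambda>z. ee (- (fst z * snd z)) * G (snd z, fst z))"
    and GAB: "AE z in QU. A \<le> (norm (G z))\<^sup>2 \<and> (norm (G z))\<^sup>2 \<le> B"
    and K1: "K1 \<ge> 1" and K2: "K2 \<ge> 1" and N: "N \<ge> 7" and M: "M \<ge> 7"
    and N': "48 * sqrt B * real K1 / real N \<le> sqrt A / 8" and M': "48 * sqrt B * real K2 / real M \<le> sqrt A / 8"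
  shows "1 / (real M * real N) \<le> measure QU {z. sqrt A / 8 \<le> norm (G z - zak_low (- 1) g K1 z)}
     + measure QU {z. sqrt A / 8 \<le> norm (ee (- (fst z * snd z)) * G (snd z, fst z) - zak_low 1 gh K2 z)}"
proof -
  define H where "H z = ee (- (fst z * snd z)) * G (snd z, fst z)" for z
  have Hz: "zak 1 gh H" using H by (simp add: H_def[abs_def])
  define U1 where "U1 = zak_low (- 1) g K1"
  define U2 where "U2 = zak_low 1 gh K2"
  define d where "d = sqrt A / 8"
  have d: "d > 0" using A by (simp add: d_def)
  define E1 where "E1 = {z. d \<le> norm (G z - U1 z)}"
  define E2 where "E2 = {z. d \<le> norm (H z - U2 z)}"
  have zU: "zak (- 1) (vp_cut K1 g) U1" "zak 1 (vp_cut K2 gh) U2"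
    unfolding U1_def U2_def using zak_zak_low g gh by simp_all
  have [measurable]: "G \<in> borel_measurable borel" "H \<in> borel_measurable borel" "U1 \<in> borel_measurable borel" "U2 \<in> borel_measurable borel"
    using G Hz zU by (auto simp: zak_def sq_integrable_def)
  have E [measurable]: "E1 \<in> sets borel" "E2 \<in> sets borel"
    unfolding E1_def E2_def by measurable
  have normH: "norm (H z) = norm (G (snd z, fst z))" for z
    by (simp add: H_def norm_mult)
  have Gb: "AE z in QU. norm (G z) \<le> sqrt B"
    using GAB by eventually_elim (auto intro: real_le_rsqrt)
  have Hb: "AE z in QU. norm (H z) \<le> sqrt B"
  proof -
    have "AE z in distr QU QU (\<lambda>z. (snd z, fst z)). norm (G z) \<le> sqrt B"
      unfolding QU_swap by (rule Gb)
    then show ?thesis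
      unfolding normH by (subst (asm) AE_distr_iff) auto
  qed
  obtain z0 where "A \<le> (norm (G z0))\<^sup>2 \<and> (norm (G z0))\<^sup>2 \<le> B"
    using eventually_happens[OF GAB] Q.ae_filter_bot by auto
  then have B0: "sqrt B \<ge> 0" using A by (auto intro: order.trans)
  \<comment> \<open>The second Lipschitz estimate is taken on the fibre over \<open>snd z\<close>,
    since H has the two variables exchanged.\<close>
  define good where "good z \<longleftrightarrow> A \<le> (norm (G z))\<^sup>2 \<and>
      (\<forall>y y'. norm (U1 (fst z, y') - U1 (fst z, y)) \<le> 48 * sqrt B * real K1 * \<bar>y' - y\<bar>) \<and>
      (\<forall>x x'. norm (U2 (snd z, x') - U2 (snd z, x)) \<le> 48 * sqrt B * real K2 * \<bar>x' - x\<bar>)" for z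
  have "AE z in QU. good z"
  proof -
    have "AE z in QU. \<forall>y y'. norm (U1 (fst z, y') - U1 (fst z, y)) \<le> 48 * sqrt B * real K1 * \<bar>y' - y\<bar>"
      unfolding U1_def by (rule AE_QU_fst, rule zak_low_increment[OF _ K1 g G B0 Gb]) simp
    moreover have "AE z in QU. \<forall>x x'. norm (U2 (snd z, x') - U2 (snd z, x)) \<le> 48 * sqrt B * real K2 * \<bar>x' - x\<bar>"
      unfolding U2_def by (rule AE_QU_snd, rule zak_low_increment[OF _ K2 gh Hz B0 Hb]) simp
    ultimately show ?thesis
      using GAB by eventually_elim (simp add: good_def)
  qed
  then obtain Z where Z: "{z \<in> space QU. \<not> good z} \<subseteq> Z" "emeasure QU Z = 0" "Z \<in> sets QU"
    by (rule AE_E)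
  \<comment> \<open>Brings the bad set of H into the coordinates of G; exchanging the variables
    preserves the measure.\<close>
  define E2' where "E2' = {z. (snd z, fst z) \<in> E2}"
  have E2' [measurable]: "E2' \<in> sets borel"
    using measurable_sets[OF measurable_swap_borel, of E2] by (simp add: E2'_def vimage_def)
  have mE2': "measure QU E2' = measure QU E2"
  proof -
    have "measure QU E2 = measure (distr QU QU (\<lambda>z. (snd z, fst z))) E2" unfolding QU_swap ..
    also have "\<dots> = measure QU E2'"
      by (subst measure_distr) (auto simp: E2'_def vimage_def)
    finally show ?thesis ..
  qed
  \<comment> \<open>Adding the null set Z costs no measure and ensures that a grid avoiding E
    consists of good points throughout.\<close>
  define E where "E = E1 \<union> E2' \<union> Z"
  have "1 / (real M * real N) \<le> measure QU E"
  proof (rule grid_cover)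
    show "E \<in> sets borel" unfolding E_def using Z(3) by auto
    show "M > 0" "N > 0" using M N by auto
    fix x y :: real
    assume x: "x \<in> {0..<1 / real M}" and y: "y \<in> {0..<1 / real N}"
    define X where "X j = x + real j / real M" for j
    define Y where "Y l = y + real l / real N" for l
    show "\<exists>j<M. \<exists>l<N. (x + real j / real M, y + real l / real N) \<in> E"
    proof (rule ccontr)
      assume "\<not> (\<exists>j<M. \<exists>l<N. (x + real j / real M, y + real l / real N) \<in> E)"
      then have notE: "(X j, Y l) \<notin> E" if "j < M" "l < N" for j l
        using that by (auto simp: X_def Y_def)
      have gd: "good (X j, Y l)" "norm (G (X j, Y l) - U1 (X j, Y l)) < d" "norm (H (Y l, X j) - U2 (Y l, X j)) < d"
        if "j < M" "l < N" for j l
        using notE[OF that] Z(1) by (auto simp: E_def E1_def E2'_def E2_def not_le)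
      \<comment> \<open>Reason for the threshold sqrt A / 8: a step is made of two remainders below
        d and one smooth increment of at most d, thus stays below 4 d = sqrt A / 2.\<close>
      have big: "4 * d \<le> norm (G (X j, Y l)) / 2" if "j < M" "l < N" for j l
      proof -
        have "sqrt A \<le> norm (G (X j, Y l))"
          using gd(1)[OF that] by (auto simp: good_def intro: real_le_lsqrt)
        then show ?thesis by (simp add: d_def)
      qed
      have stepY: "\<exists>n::int. Y (Suc l mod N) = Y l + 1 / real N + of_int n" if "l < N" for l
        unfolding Y_def cyclic_grid_step[OF that] by (intro exI[of _ "- of_bool (Suc l = N)"]) simp
      have stepX: "\<exists>n::int. X (Suc j mod M) = X j + 1 / real M + of_int n" if "j < M" for j
        unfolding X_def cyclic_grid_step[OF that] by (intro exI[of _ "- of_bool (Suc j = M)"]) simp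
      have tri: "norm (a' - a) < 4 * d" if "norm (a' - u') < d" "norm (a - u) < d" "norm (u' - u) \<le> d" for a a' u u' :: complex
      proof -
        have "a' - a = (a' - u') + (u' - u) - (a - u)" by simp
        then have "norm (a' - a) \<le> norm (a' - u') + norm (u' - u) + norm (a - u)"
          by (metis add_mono_thms_linordered_semiring(3) norm_triangle_ineq norm_triangle_ineq4 order.trans)
        with that d show ?thesis by linarith
      qed
      show False
      proof (rule quasi_periodic_grid_jump[where a = "\<lambda>j l. G (X j, Y l)" and b = "\<lambda>j l. H (Y l, X j)"])
        show "M \<ge> 7" "N \<ge> 7" by fact+
        show "H (Y l, X j) = ee (- ((x + real j / real M) * (y + real l / real N))) * G (X j, Y l)" for j l
          by (simp add: H_def X_def Y_def mult.commute)
        fix j l assume j: "j < M" and l: "l < N"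
        have j': "Suc j mod M < M" and l': "Suc l mod N < N" using M N by auto
        show "norm (G (X j, Y (Suc l mod N)) - G (X j, Y l)) < norm (G (X j, Y l)) / 2"
        proof -
          obtain n :: int where n: "Y (Suc l mod N) = Y l + 1 / real N + of_int n" using stepY[OF l] by blast
          have "U1 (X j, Y (Suc l mod N)) = U1 (X j, Y l + 1 / real N)"
            unfolding n U1_def by (rule zak_low_periodic)
          moreover have "norm (U1 (X j, Y l + 1 / real N) - U1 (X j, Y l)) \<le> 48 * sqrt B * real K1 * \<bar>(Y l + 1 / real N) - Y l\<bar>"
            using gd(1)[OF j l] unfolding good_def fst_conv by blast
          moreover have "\<dots> \<le> d" using N' by (simp add: d_def)
          ultimately have "norm (U1 (X j, Y (Suc l mod N)) - U1 (X j, Y l)) \<le> d" by simp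
          from tri[OF gd(2)[OF j l'] gd(2)[OF j l] this] big[OF j l] show ?thesis by linarith
        qed
        show "norm (H (Y l, X (Suc j mod M)) - H (Y l, X j)) < norm (H (Y l, X j)) / 2"
        proof -
          obtain n :: int where n: "X (Suc j mod M) = X j + 1 / real M + of_int n" using stepX[OF j] by blast
          have "U2 (Y l, X (Suc j mod M)) = U2 (Y l, X j + 1 / real M)"
            unfolding n U2_def by (rule zak_low_periodic)
          moreover have "norm (U2 (Y l, X j + 1 / real M) - U2 (Y l, X j)) \<le> 48 * sqrt B * real K2 * \<bar>(X j + 1 / real M) - X j\<bar>"
            using gd(1)[OF j l] unfolding good_def snd_conv by blast
          moreover have "\<dots> \<le> d" using M' by (simp add: d_def)
          ultimately have "norm (U2 (Y l, X (Suc j mod M)) - U2 (Y l, X j)) \<le> d" by simp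
          from tri[OF gd(3)[OF j' l] gd(3)[OF j l] this] big[OF j l] show ?thesis by (simp add: normH)
        qed
      qed
    qed
  qed
  also have "measure QU E \<le> measure QU E1 + measure QU E2' + measure QU Z"
    unfolding E_def using E(1) E2' Z(3)
    by (intro order.trans[OF measure_Un_le] add_right_mono measure_Un_le) auto
  also have "measure QU Z = 0" using Z(2) by (simp add: measure_def)
  finally show ?thesis
    unfolding mE2' by (simp add: E1_def E2_def U1_def U2_def H_def d_def)
qed

subsection \<open>The lower bound\<close>

lemma infsum_ennreal_le_finite_sums:
  fixes f :: "'a \<Rightarrow> ennreal"
  assumes le: "infsum f A \<le> ennreal T" and T: "T \<ge> 0"
    and m: "\<And>k. m k = (if k \<in> A then enn2real (f k) else 0)"
  shows "k \<in> A \<Longrightarrow> f k = ennreal (m k)" and "finite X \<Longrightarrow> sum m X \<le> T"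
proof -
  have fin: "sum f Y \<le> ennreal T" if "finite Y" "Y \<subseteq> A" for Y
  proof -
    have "sum f Y \<le> (SUP F\<in>{F. finite F \<and> F \<subseteq> A}. sum f F)"
      using that by (intro SUP_upper) auto
    also have "\<dots> = infsum f A" by (rule nonneg_infsum_complete[symmetric]) simp
    finally show ?thesis using le by (rule order.trans)
  qed
  have fk: "f k = ennreal (m k)" if "k \<in> A" for k
  proof -
    have "f k \<le> ennreal T" using fin[of "{k}"] that by simp
    then have "f k < \<infinity>" by (auto simp: order.strict_trans1)
    then show ?thesis using that by (simp add: m)
  qed
  then show "k \<in> A \<Longrightarrow> f k = ennreal (m k)" .
  assume X: "finite X"
  have "sum m X = sum m (X \<inter> A)"
    using X by (intro sum.mono_neutral_right) (auto simp: m)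
  also have "ennreal (sum m (X \<inter> A)) = (\<Sum>k\<in>X \<inter> A. ennreal (m k))"
    by (rule sum_ennreal[symmetric]) (simp add: m)
  then have "ennreal (sum m (X \<inter> A)) = sum f (X \<inter> A)"
    using fk by simp
  then have "ennreal (sum m (X \<inter> A)) \<le> ennreal T"
    using fin[of "X \<inter> A"] X by simp
  then have "sum m (X \<inter> A) \<le> T" using T by (simp add: ennreal_le_iff)
  finally show "sum m X \<le> T" .
qed

text \<open>For p = 1 the terms of the tail sum are themselves essential suprema on unit intervals,
  so they serve directly as the interval-wise bounds for the transform.\<close>

lemma zak_tail_small_sup:
  assumes s: "\<bar>s\<bar> = 1" and f: "sq_integrable lborel f" and F: "zak s f F"
    and fg: "AE t in lborel. norm (f t) \<le> norm (g t)"
    and f0: "\<And>k t. \<not> \<bar>real_of_int k\<bar> > R \<Longrightarrow> t \<in> {of_int k..<of_int k + 1} \<Longrightarrow> f t = 0"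
    and T: "T \<ge> 0" and S: "(\<Sum>\<^sub>\<infinity>k\<in>{k::int. \<bar>real_of_int k\<bar> > R}. Lq_pow_p 1 g k) \<le> ennreal T"
  shows "AE z in QU. norm (F z) \<le> T"
proof -
  let ?A = "{k::int. \<bar>real_of_int k\<bar> > R}"
  define m where "m k = (if k \<in> ?A then enn2real (Lq_pow_p 1 g k) else 0)" for k
  note m = infsum_ennreal_le_finite_sums[OF S T m_def]
  have "AE t in lborel. t \<in> {of_int k..<of_int k + 1} \<longrightarrow> norm (f t) \<le> m k" for k
  proof (cases "k \<in> ?A")
    case True
    have "AE t in restrict_space lebesgue {real_of_int k..real_of_int k + 1}. ennreal (norm (g t)) \<le> ennreal (m k)"
      using esssup_AE[of "\<lambda>t. ennreal (norm (g t))" "restrict_space lebesgue {real_of_int k..real_of_int k + 1}"] m(1)[OF True]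
      by (simp add: Lq_pow_p_def)
    then have "AE t in lborel. t \<in> {real_of_int k..real_of_int k + 1} \<longrightarrow> ennreal (norm (g t)) \<le> ennreal (m k)"
      by (simp add: AE_restrict_space_iff AE_completion_iff)
    with fg show ?thesis
    proof eventually_elim
      case (elim t)
      have "0 \<le> m k" by (simp add: m_def)
      with elim show ?case by (auto simp: ennreal_le_iff)
    qed
  next
    case False
    then show ?thesis using f0[of k] by (intro AE_I2) (auto simp: m_def)
  qed
  then have "AE t in lborel. \<forall>k::int. t \<in> {of_int k..<of_int k + 1} \<longrightarrow> norm (f t) \<le> m k"
    unfolding AE_all_countable by blast
  then have "AE t in lborel. norm (f t) \<le> m \<lfloor>t\<rfloor>"
  proof eventually_elim
    case (elim t)
    have "t \<in> {of_int \<lfloor>t\<rfloor>..<of_int \<lfloor>t\<rfloor> + 1}" by simp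
    with elim show ?case by blast
  qed
  from zak_bound[OF s f F this m(2)] show ?thesis .
qed

lemma enn_powr_eq_ennreal:
  assumes "enn_powr x a = ennreal m" "m \<ge> 0" "a * b = 1"
  shows "x = ennreal (m powr b)"
proof -
  have x: "x \<noteq> \<infinity>" using assms(1) by (auto simp: enn_powr_def)
  then have "m = enn2real x powr a"
    using assms(1,2) by (simp add: enn_powr_def)
  then have "m powr b = enn2real x"
    using assms(3) by (simp add: powr_powr)
  with x show ?thesis by (simp add: top.not_eq_extremum)
qed

lemma zak_tail_small_Lq:
  assumes p: "1 < p" "p \<le> 2" and d: "d > 0" and s: "\<bar>s\<bar> = 1" and f: "sq_integrable lborel f" and F: "zak s f F"
    and fg: "AE t in lborel. norm (f t) \<le> norm (g t)"
    and f0: "\<And>k t. \<not> \<bar>real_of_int k\<bar> > R \<Longrightarrow> t \<in> {of_int k..<of_int k + 1} \<Longrightarrow> f t = 0"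
    and T: "T > 0" and S: "(\<Sum>\<^sub>\<infinity>k\<in>{k::int. \<bar>real_of_int k\<bar> > R}. Lq_pow_p p g k) \<le> ennreal T"
  shows "measure QU {z. d \<le> norm (F z)} \<le> 4 / d\<^sup>2 * ((d / (2 * T)) powr (2 - p / (p - 1)) * T)"
proof -
  let ?A = "{k::int. \<bar>real_of_int k\<bar> > R}"
  define q where "q = p / (p - 1)"
  \<comment> \<open>The outer exponent in \<open>Lq_pow_p\<close> is p - 1, with inverse q - 1;
    raising \<open>m k\<close> to the latter recovers the integral of the q-th power.\<close>
  have q: "q \<ge> 2" "p / q = p - 1" "q - 1 = 1 / (p - 1)" "(p - 1) * (q - 1) = 1"
    using p by (auto simp: q_def field_simps)
  define m where "m k = (if k \<in> ?A then enn2real (Lq_pow_p p g k) else 0)" for k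
  note m = infsum_ennreal_le_finite_sums[OF S less_imp_le[OF T] m_def]
  have m0: "m k \<ge> 0" for k by (simp add: m_def)
  have "(\<integral>\<^sup>+t. indicator {of_int k..of_int k + 1} t * ennreal (norm (f t) powr q) \<partial>lborel) \<le> ennreal (m k powr (q - 1))" for k
  proof (cases "k \<in> ?A")
    case True
    have "Lq_pow_p p g k = enn_powr (\<integral>\<^sup>+t. indicator {real_of_int k..real_of_int k + 1} t * ennreal (norm (g t) powr q) \<partial>lborel) (p - 1)"
      using p q(2) by (simp add: Lq_pow_p_def Let_def nn_integral_completion flip: q_def)
    then have I: "(\<integral>\<^sup>+t. indicator {real_of_int k..real_of_int k + 1} t * ennreal (norm (g t) powr q) \<partial>lborel) = ennreal (m k powr (q - 1))"
      using m(1)[OF True] m0 q(4) by (intro enn_powr_eq_ennreal[where a = "p - 1"]) auto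
    have "(\<integral>\<^sup>+t. indicator {of_int k..of_int k + 1} t * ennreal (norm (f t) powr q) \<partial>lborel)
        \<le> (\<integral>\<^sup>+t. indicator {real_of_int k..real_of_int k + 1} t * ennreal (norm (g t) powr q) \<partial>lborel)"
    proof (rule nn_integral_mono_AE)
      show "AE t in lborel. indicator {of_int k..of_int k + 1} t * ennreal (norm (f t) powr q)
          \<le> indicator {real_of_int k..real_of_int k + 1} t * ennreal (norm (g t) powr q)"
        using fg by eventually_elim (use q in \<open>auto intro!: mult_left_mono ennreal_leI powr_mono2\<close>)
    qed
    then show ?thesis unfolding I .
  next
    case False
    \<comment> \<open>The right endpoint belongs to the next half-open interval, where f need not
      vanish.\<close>
    have "AE t in lborel. t \<noteq> real_of_int k + 1" by (rule AE_lborel_singleton)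
    then have "AE t in lborel. indicator {of_int k..of_int k + 1} t * ennreal (norm (f t) powr q) = 0"
    proof eventually_elim
      case (elim t)
      then show ?case using f0[of k t] False by (auto split: split_indicator)
    qed
    then have "(\<integral>\<^sup>+t. indicator {of_int k..of_int k + 1} t * ennreal (norm (f t) powr q) \<partial>lborel) = (\<integral>\<^sup>+t. 0 \<partial>(lborel :: real measure))"
      by (rule nn_integral_cong_AE)
    then show ?thesis by simp
  qed
  from zak_weak_type[OF s f F q(1) d T m0 m(2) this] show ?thesis by (simp add: q_def)
qed

text \<open>Packages the uniformity: one C serves all functions, both signs s and all cutoffs R. V
  is independent of R because the product of both cutoffs will be inserted for it. The majorant g,
  unlike f, is the function whose tail sum is measured.\<close>

definition tail_constant :: "real \<Rightarrow> real \<Rightarrow> real \<Rightarrow> real \<Rightarrow> bool" where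
  "tail_constant p d c C \<longleftrightarrow> (\<forall>s f F g R V. \<bar>s\<bar> = 1 \<longrightarrow> sq_integrable lborel f \<longrightarrow> zak s f F \<longrightarrow>
      (AE t in lborel. norm (f t) \<le> norm (g t)) \<longrightarrow>
      (\<forall>k t. \<not> \<bar>real_of_int k\<bar> > R \<longrightarrow> t \<in> {of_int k..<of_int k + 1} \<longrightarrow> f t = 0) \<longrightarrow> V \<ge> 1 \<longrightarrow>
      (\<Sum>\<^sub>\<infinity>k\<in>{k::int. \<bar>real_of_int k\<bar> > R}. Lq_pow_p p g k) \<le> ennreal (C / V powr (p - 1)) \<longrightarrow>
      measure QU {z. d \<le> norm (F z)} < 1 / (c * V))"

text \<open>The weak-type bound is a constant times T^(q - 1), and T = C / V^(p - 1) turns it into a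
  constant times C^(q - 1) / V because (p - 1) (q - 1) = 1. For p = 1 the power of V disappears and
  the superlevel set is null as soon as T is at most d / 2.\<close>

lemma tail_constant_exists:
  assumes p: "1 \<le> p" "p \<le> 2" and d: "d > 0" and c: "c > 0"
  shows "\<exists>C>0. tail_constant p d c C"
proof (cases "p = 1")
  case True
  show ?thesis
    unfolding tail_constant_def
  proof (intro exI[of _ "d / 2"] conjI allI impI)
    fix s f F g R and V :: real
    assume *: "\<bar>s\<bar> = 1" "sq_integrable lborel f" "zak s f F" "AE t in lborel. norm (f t) \<le> norm (g t)"
      "\<forall>k t. \<not> \<bar>real_of_int k\<bar> > R \<longrightarrow> t \<in> {of_int k..<of_int k + 1} \<longrightarrow> f t = 0" "V \<ge> 1"
      "(\<Sum>\<^sub>\<infinity>k\<in>{k::int. \<bar>real_of_int k\<bar> > R}. Lq_pow_p p g k) \<le> ennreal (d / 2 / V powr (p - 1))"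
    have V: "V > 0" using *(6) by simp
    have F [measurable]: "F \<in> borel_measurable borel" using *(3) by (auto simp: zak_def sq_integrable_def)
    have "AE z in QU. norm (F z) \<le> d / 2"
      by (rule zak_tail_small_sup[OF *(1-4) *(5)[rule_format]]) (use *(7) d True V in auto)
    then have "AE z in QU. z \<notin> {z. d \<le> norm (F z)}"
      by eventually_elim (use d in auto)
    then have "emeasure QU {z. d \<le> norm (F z)} = 0"
      by (subst (asm) AE_iff_measurable[OF _ refl]) auto
    then have "measure QU {z. d \<le> norm (F z)} = 0" by (simp add: measure_def)
    then show "measure QU {z. d \<le> norm (F z)} < 1 / (c * V)" using c V by simp
  qed (use d in simp)
next
  case False
  with p have p1: "1 < p" by simp
  define q where "q = p / (p - 1)"
  have q: "(p - 1) * (q - 1) = 1" using p1 by (auto simp: q_def field_simps)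
  \<comment> \<open>Chosen so that the weak-type bound reads W / c times T^(q - 1).\<close>
  define W where "W = c * (4 / d\<^sup>2 * (d / 2) powr (2 - q))"
  have W: "W > 0" using c d by (simp add: W_def)
  \<comment> \<open>Solves T^(q - 1) = 1 / (2 W V); the factor 2 makes the final inequality
    strict.\<close>
  define C where "C = (1 / (2 * W)) powr (p - 1)"
  have C: "C > 0" using W by (simp add: C_def)
  show ?thesis
    unfolding tail_constant_def
  proof (intro exI[of _ C] conjI allI impI C)
    fix s f F g R and V :: real
    assume *: "\<bar>s\<bar> = 1" "sq_integrable lborel f" "zak s f F" "AE t in lborel. norm (f t) \<le> norm (g t)"
      "\<forall>k t. \<not> \<bar>real_of_int k\<bar> > R \<longrightarrow> t \<in> {of_int k..<of_int k + 1} \<longrightarrow> f t = 0" "V \<ge> 1"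
      "(\<Sum>\<^sub>\<infinity>k\<in>{k::int. \<bar>real_of_int k\<bar> > R}. Lq_pow_p p g k) \<le> ennreal (C / V powr (p - 1))"
    define T where "T = C / V powr (p - 1)"
    have V: "V > 0" using *(6) by simp
    have T: "T > 0" using C V by (simp add: T_def)
    have Tq: "T powr (q - 1) = 1 / (2 * W) / V"
    proof -
      have "T powr (q - 1) = C powr (q - 1) / (V powr (p - 1)) powr (q - 1)"
        unfolding T_def by (rule powr_divide)
      also have "\<dots> = 1 / (2 * W) / V"
        unfolding C_def powr_powr q using W V by simp
      finally show ?thesis .
    qed
    have "(d / (2 * T)) powr (2 - q) * T = (d / 2) powr (2 - q) * (T powr (q - 2) * T)"
    proof -
      have "(d / (2 * T)) powr (2 - q) = ((d / 2) / T) powr (2 - q)" by simp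
      also have "\<dots> = (d / 2) powr (2 - q) / T powr (2 - q)"
        by (rule powr_divide)
      also have "\<dots> = (d / 2) powr (2 - q) * T powr (q - 2)"
        using powr_minus_divide[of T "2 - q"] by simp
      finally show ?thesis by simp
    qed
    also have "T powr (q - 2) * T = T powr (q - 1)"
      using T powr_add[of T "q - 2" 1] by simp
    finally have eq: "(d / (2 * T)) powr (2 - q) * T = (d / 2) powr (2 - q) * (1 / (2 * W) / V)"
      unfolding Tq .
    have "measure QU {z. d \<le> norm (F z)} \<le> 4 / d\<^sup>2 * ((d / (2 * T)) powr (2 - q) * T)"
      unfolding q_def by (rule zak_tail_small_Lq[OF p1 p(2) d *(1-4) *(5)[rule_format] T]) (use *(7) in \<open>auto simp: T_def\<close>)
    also have "\<dots> = (W / c) * (1 / (2 * W) / V)"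
      unfolding eq using c by (simp add: W_def)
    also have "\<dots> = 1 / (2 * (c * V))" using W c by simp
    also have "\<dots> < 1 / (c * V)" using c V by (intro divide_strict_left_mono) auto
    finally show "measure QU {z. d \<le> norm (F z)} < 1 / (c * V)" .
  qed
qed

section \<open>Borel representatives of Lebesgue measurable data\<close>

lemma L2_borel_version:
  assumes "L2 f"
  obtains f' where "sq_integrable lborel f'" "AE t in lborel. f t = f' t"
proof -
  have f: "f \<in> borel_measurable lebesgue" and int: "integrable lebesgue (\<lambda>t. (norm (f t))\<^sup>2)"
    using assms by (auto simp: L2_def)
  have "(\<lambda>t. Re (f t)) \<in> borel_measurable (completion lborel)" "(\<lambda>t. Im (f t)) \<in> borel_measurable (completion lborel)"
    using f by measurable
  from this[THEN completion_ex_borel_measurable_real] obtain r i where [measurable]: "r \<in> borel_measurable lborel" "i \<in> borel_measurable lborel"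
    and ae: "AE t in lborel. Re (f t) = r t" "AE t in lborel. Im (f t) = i t"
    by blast
  define f' where "f' t = complex_of_real (r t) + \<i> * complex_of_real (i t)" for t
  have ff': "AE t in lborel. f t = f' t"
    using ae by eventually_elim (simp add: f'_def complex_eq_iff)
  have meas [measurable]: "f' \<in> borel_measurable borel"
    unfolding f'_def by measurable
  have "integrable lebesgue (\<lambda>t. (norm (f' t))\<^sup>2)"
  proof (rule integrable_cong_AE_imp[OF int])
    show "AE t in lebesgue. (norm (f t))\<^sup>2 = (norm (f' t))\<^sup>2"
      unfolding AE_completion_iff using ff' by eventually_elim simp
    show "(\<lambda>t. (norm (f' t))\<^sup>2) \<in> borel_measurable lebesgue"
      by (intro measurable_completion) measurable
  qed
  then have "integrable lborel (\<lambda>t. (norm (f' t))\<^sup>2)"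
    by (subst (asm) integrable_completion) measurable
  then show thesis using ff' meas by (intro that[of f']) (auto simp: sq_integrable_def)
qed

lemma AE_lborel_translate:
  fixes P :: "real \<Rightarrow> bool"
  assumes "AE t in lborel. P t"
  shows "AE t in lborel. P (t - a)"
proof -
  obtain N where N: "{t \<in> space lborel. \<not> P t} \<subseteq> N" "emeasure lborel N = 0" "N \<in> sets lborel"
    using assms by (rule AE_E)
  have "AE t in lborel. t \<notin> N" using N(2,3) by (intro AE_not_in) auto
  then have "AE t in lborel. - a + 1 * t \<notin> N"
    using N(3) by (intro AE_borel_affine[where P = "\<lambda>t. t \<notin> N"]) auto
  then show ?thesis by eventually_elim (use N(1) in auto)
qed

lemma L2_norm_sq_cong:
  assumes "AE t in lborel. f t = f' t"
  shows "L2_norm_sq f = (\<integral>\<^sup>+t. ennreal ((norm (f' t))\<^sup>2) \<partial>lborel)"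
  unfolding L2_norm_sq_def nn_integral_completion
  using assms by (intro nn_integral_cong_AE) (auto elim: eventually_mono)

lemma L2_norm_sq_gabor_sum:
  assumes gg': "AE t in lborel. g t = g' t" and g': "sq_integrable lborel g'" and S: "finite S"
  shows "L2_norm_sq (\<lambda>t. \<Sum>i\<in>S. a i * gabor g i t)
    = ennreal (LINT t|lborel. (norm (\<Sum>i\<in>S. a i * (ee (of_int (snd i) * t) * g' (t - of_int (fst i)))))\<^sup>2)"
proof -
  have "AE t in lborel. \<forall>m::int. g (t - of_int m) = g' (t - of_int m)"
    unfolding AE_all_countable using AE_lborel_translate[OF gg'] by blast
  then have "AE t in lborel. (\<Sum>i\<in>S. a i * gabor g i t) = (\<Sum>i\<in>S. a i * (ee (of_int (snd i) * t) * g' (t - of_int (fst i))))"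
    by eventually_elim (simp add: gabor_def ee_eq_exp case_prod_beta)
  then have "L2_norm_sq (\<lambda>t. \<Sum>i\<in>S. a i * gabor g i t)
      = (\<integral>\<^sup>+t. ennreal ((norm (\<Sum>i\<in>S. a i * (ee (of_int (snd i) * t) * g' (t - of_int (fst i)))))\<^sup>2) \<partial>lborel)"
    by (rule L2_norm_sq_cong)
  also have "\<dots> = ennreal (LINT t|lborel. (norm (\<Sum>i\<in>S. a i * (ee (of_int (snd i) * t) * g' (t - of_int (fst i)))))\<^sup>2)"
    by (intro sq_integrable_nn_integral sq_integrable_sum sq_integrable_cmult
          sq_integrable_mult_bounded[OF sq_integrable_lborel_translate[OF g'], of _ 1]) auto
  finally show ?thesis .
qed

lemma fourier_trunc_eq_set_integral:
  assumes g: "g \<in> borel_measurable lebesgue" and gg': "AE t in lborel. g t = g' t"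
    and g' [measurable]: "g' \<in> borel_measurable borel"
  shows "(LINT t:{- real N..real N}|lebesgue. g t * exp (- 2 * pi * \<i> * complex_of_real (\<xi> * t))) = fourier_trunc g' N \<xi>"
proof -
  have "(LINT t:{- real N..real N}|lebesgue. g t * exp (- 2 * pi * \<i> * complex_of_real (\<xi> * t)))
      = (LINT t|lebesgue. indicator {- real N..real N} t *\<^sub>R (ee (- (\<xi> * t)) * g' t))"
    unfolding set_lebesgue_integral_def
  proof (rule integral_cong_AE)
    have ae: "AE t in lebesgue. indicator {- real N..real N} t *\<^sub>R (g t * exp (- 2 * pi * \<i> * complex_of_real (\<xi> * t)))
        = indicator {- real N..real N} t *\<^sub>R (ee (- (\<xi> * t)) * g' t)"
      unfolding AE_completion_iff using gg' by eventually_elim (simp add: ee_eq_exp mult.commute)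
    show "(\<lambda>t. indicator {- real N..real N} t *\<^sub>R (ee (- (\<xi> * t)) * g' t)) \<in> borel_measurable lebesgue"
      by (intro measurable_completion) measurable
    show "(\<lambda>t. indicator {- real N..real N} t *\<^sub>R (g t * exp (- 2 * pi * \<i> * complex_of_real (\<xi> * t)))) \<in> borel_measurable lebesgue"
    proof -
      have "(\<lambda>t. exp (- 2 * pi * \<i> * complex_of_real (\<xi> * t))) \<in> borel_measurable lebesgue"
        by (intro measurable_completion) measurable
      then show ?thesis
        by (intro borel_measurable_scaleR borel_measurable_times g borel_measurable_indicator) auto
    qed
    show "AE t in lebesgue. indicator {- real N..real N} t *\<^sub>R (g t * exp (- 2 * pi * \<i> * complex_of_real (\<xi> * t)))
        = indicator {- real N..real N} t *\<^sub>R (ee (- (\<xi> * t)) * g' t)" by (rule ae)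
  qed
  also have "\<dots> = fourier_trunc g' N \<xi>"
    unfolding fourier_trunc_def by (rule integral_completion) measurable
  finally show ?thesis .
qed

text \<open>The weights lie in [0, 1], so subtracting the smoothed part never enlarges the modulus.
  An integer k with |k| at most R also satisfies |k| at most K, where the weight is 1, so the
  remainder lives exactly on intervals counted by the tail sum.\<close>

lemma zak_high:
  assumes s: "\<bar>s\<bar> = 1" and f: "sq_integrable lborel f" and F: "zak s f F" and fg: "AE t in lborel. g t = f t"
    and R: "R \<ge> 1"
  defines "K \<equiv> nat \<lfloor>R\<rfloor>"
  shows "sq_integrable lborel (\<lambda>t. f t - vp_cut K f t)"
    and "zak s (\<lambda>t. f t - vp_cut K f t) (\<lambda>z. F z - zak_low s f K z)"
    and "AE t in lborel. norm (f t - vp_cut K f t) \<le> norm (g t)"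
    and "\<not> \<bar>real_of_int k\<bar> > R \<Longrightarrow> t \<in> {of_int k..<of_int k + 1} \<Longrightarrow> f t - vp_cut K f t = 0"
proof -
  show "sq_integrable lborel (\<lambda>t. f t - vp_cut K f t)"
    by (intro sq_integrable_diff f sq_integrable_vp_cut)
  show "zak s (\<lambda>t. f t - vp_cut K f t) (\<lambda>z. F z - zak_low s f K z)"
    by (intro zak_diff f sq_integrable_vp_cut F zak_zak_low s)
  show "AE t in lborel. norm (f t - vp_cut K f t) \<le> norm (g t)"
    using fg
  proof eventually_elim
    case (elim t)
    have "f t - vp_cut K f t = of_real (1 - vp_weight K \<lfloor>t\<rfloor>) * f t"
      by (simp add: vp_cut_def left_diff_distrib)
    then have "norm (f t - vp_cut K f t) = \<bar>1 - vp_weight K \<lfloor>t\<rfloor>\<bar> * norm (f t)"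
      by (simp only: norm_mult norm_of_real)
    also have "\<dots> \<le> 1 * norm (f t)"
      using vp_weight_nonneg[of K "\<lfloor>t\<rfloor>"] vp_weight_le_1[of K "\<lfloor>t\<rfloor>"] by (intro mult_right_mono) auto
    finally show ?case by (simp add: elim)
  qed
  assume k: "\<not> \<bar>real_of_int k\<bar> > R" and t: "t \<in> {of_int k..<of_int k + 1}"
  have "\<lfloor>t\<rfloor> = k" using t by (simp add: floor_eq_iff)
  moreover have "\<bar>k\<bar> \<le> int K" "K \<ge> 1"
    using k R by (auto simp: K_def le_floor_iff le_nat_iff)
  ultimately show "f t - vp_cut K f t = 0"
    by (simp add: vp_cut_def vp_weight_eq_1)
qed

lemma exists_grid_size:
  fixes a b R :: real
  assumes a: "a > 0" and b: "b \<ge> 0" and R: "R \<ge> 1"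
  obtains N :: nat where "N \<ge> 7" "48 * b * real (nat \<lfloor>R\<rfloor>) / real N \<le> a / 8" "real N \<le> (8 + 384 * b / a) * R"
proof -
  \<comment> \<open>With 384 = 8 * 48, u points suffice for increments of at most a / 8. The 7 comes
    from the winding argument, one more from rounding up, and R at least 1 absorbs the sum 8 into
    the factor.\<close>
  define u where "u = 384 * b / a * R"
  have u: "u \<ge> 0" using a b R by (simp add: u_def)
  define N where "N = nat \<lceil>7 + u\<rceil>"
  have N: "7 + u \<le> real N" "real N \<le> 8 + u"
    using u of_int_ceiling_le_add_one[of "7 + u"] by (auto simp: N_def le_of_int_ceiling)
  show thesis
  proof (rule that[of N])
    show "N \<ge> 7" using N(1) u by linarith
    have "48 * b * real (nat \<lfloor>R\<rfloor>) \<le> 48 * b * R"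
      using b R by (intro mult_left_mono) auto
    also have "\<dots> = a / 8 * u" using a by (simp add: u_def)
    also have "\<dots> \<le> a / 8 * real N" using a N(1) by (intro mult_left_mono) auto
    finally show "48 * b * real (nat \<lfloor>R\<rfloor>) / real N \<le> a / 8"
      using N(1) u by (simp add: divide_le_eq)
    show "real N \<le> (8 + 384 * b / a) * R"
      using N(2) R by (simp add: u_def distrib_right)
  qed
qed

theorem mainTheorem10:
  fixes p A B :: real
  assumes "1 \<le> p" and "p \<le> 2"
  shows "\<exists>C>0. \<forall>g gh. L2 g \<and> riesz_basis_bounds (gabor g) A B \<and> is_fourier_L2 g gh \<longrightarrow>
           (\<forall>R L. R \<ge> 1 \<longrightarrow> L \<ge> 1 \<longrightarrow>
              ennreal (C / (R * L) powr (p - 1)) <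
                (\<Sum>\<^sub>\<infinity>k\<in>{k::int. \<bar>real_of_int k\<bar> > R}. Lq_pow_p p g k)
              + (\<Sum>\<^sub>\<infinity>k\<in>{k::int. \<bar>real_of_int k\<bar> > L}. Lq_pow_p p gh k))"
proof (cases "0 < A \<and> A \<le> B")
  \<comment> \<open>Such A and B are never Riesz bounds, so the claim is vacuous and any constant
    serves.\<close>
  case False
  then show ?thesis by (intro exI[of _ 1]) (auto simp: riesz_basis_bounds_def)
next
  case True
  then have A: "A > 0" and B: "B > 0" by auto
  define d where "d = sqrt A / 8"
  define c where "c = 8 + 384 * sqrt B / sqrt A"
  have d: "d > 0" using A by (simp add: d_def)
  have c: "c > 0" using A B by (auto simp: c_def intro!: add_pos_nonneg)
  have c2: "2 * c\<^sup>2 > 0" using c by simp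
  \<comment> \<open>The grid will have at most c^2 R L points, and the measure 1 / (M N) is shared
    by two sets: hence 2 c^2. All these quantities depend on A, B and p only, and are fixed before
    g, R and L.\<close>
  obtain C where C: "C > 0" and tail: "tail_constant p d (2 * c\<^sup>2) C"
    using tail_constant_exists[OF assms d c2] by blast
  show ?thesis
  proof (intro exI[of _ C] conjI allI impI C)
    fix g gh :: "real \<Rightarrow> complex" and R L :: real
    assume hyp: "L2 g \<and> riesz_basis_bounds (gabor g) A B \<and> is_fourier_L2 g gh" and R: "R \<ge> 1" and L: "L \<ge> 1"
    let ?S1 = "\<Sum>\<^sub>\<infinity>k\<in>{k::int. \<bar>real_of_int k\<bar> > R}. Lq_pow_p p g k"
    let ?S2 = "\<Sum>\<^sub>\<infinity>k\<in>{k::int. \<bar>real_of_int k\<bar> > L}. Lq_pow_p p gh k"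
    have L2: "L2 g" "L2 gh" using hyp by (auto simp: is_fourier_L2_def)
    have gm: "g \<in> borel_measurable lebesgue" using L2(1) by (simp add: L2_def)
    \<comment> \<open>The product measure arguments run on Borel representatives, but the tail sums
      remain those of the given functions; the link is the almost everywhere bound in the tail
      estimates.\<close>
    obtain g' where g': "sq_integrable lborel g'" and gg': "AE t in lborel. g t = g' t"
      using L2_borel_version[OF L2(1)] .
    obtain gh' where gh': "sq_integrable lborel gh'" and ghgh': "AE t in lborel. gh t = gh' t"
      using L2_borel_version[OF L2(2)] .
    have [measurable]: "g' \<in> borel_measurable borel" using g' by (simp add: sq_integrable_def)
    have one: "\<bar>- 1 :: int\<bar> = 1" "\<bar>1 :: int\<bar> = 1" by simp_all
    obtain G r where G: "zak (- 1) g' G"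
      and Glim: "(\<lambda>N. LINT z|QU. (norm (G z - zak_sum (- 1) g' {- int N..<int N} z))\<^sup>2) \<longlonglongrightarrow> 0"
      and "strict_mono (r :: nat \<Rightarrow> nat)" "AE z in QU. (\<lambda>N. zak_sum (- 1) g' {- int (r N)..<int (r N)} z) \<longlonglongrightarrow> G z"
      and "(LINT z|QU. (norm (G z))\<^sup>2) = (LINT t|lborel. (norm (g' t))\<^sup>2)"
      by (rule zak_exists[OF one(1) g'])
    have "(\<lambda>N. \<integral>\<^sup>+w. ennreal ((norm (gh' w - fourier_trunc g' N w))\<^sup>2) \<partial>lborel) \<longlonglongrightarrow> 0"
    proof -
      have "L2_norm_sq (\<lambda>\<xi>. gh \<xi> - (LINT t:{- real N..real N}|lebesgue. g t * exp (- 2 * pi * \<i> * complex_of_real (\<xi> * t))))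
          = (\<integral>\<^sup>+w. ennreal ((norm (gh' w - fourier_trunc g' N w))\<^sup>2) \<partial>lborel)" for N
        unfolding fourier_trunc_eq_set_integral[OF gm gg' \<open>g' \<in> borel_measurable borel\<close>]
        by (rule L2_norm_sq_cong) (use ghgh' in \<open>auto elim: eventually_mono\<close>)
      then show ?thesis using hyp by (simp add: is_fourier_L2_def)
    qed
    from zak_fourier[OF g' gh' G Glim this]
    have H: "zak 1 gh' (\<lambda>z. ee (- (fst z * snd z)) * G (snd z, fst z))" .
    have GAB: "AE z in QU. A \<le> (norm (G z))\<^sup>2 \<and> (norm (G z))\<^sup>2 \<le> B"
    proof (rule zak_riesz_bounds[OF g' G])
      fix S :: "(int \<times> int) set" and a :: "int \<times> int \<Rightarrow> complex"
      assume S: "finite S"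
      let ?I = "LINT t|lborel. (norm (\<Sum>i\<in>S. a i * (ee (of_int (snd i) * t) * g' (t - of_int (fst i)))))\<^sup>2"
      have nn: "0 \<le> (\<Sum>i\<in>S. (cmod (a i))\<^sup>2)" by (intro sum_nonneg) simp
      have "riesz_lower (gabor g) A" "riesz_upper (gabor g) B"
        using hyp by (simp_all add: riesz_basis_bounds_def)
      from this(1)[unfolded riesz_lower_def, rule_format, OF S, of a] this(2)[unfolded riesz_upper_def, rule_format, OF S, of a]
      have "ennreal A * ennreal (\<Sum>i\<in>S. (cmod (a i))\<^sup>2) \<le> ennreal ?I" "ennreal ?I \<le> ennreal B * ennreal (\<Sum>i\<in>S. (cmod (a i))\<^sup>2)"
        unfolding L2_norm_sq_gabor_sum[OF gg' g' S] .
      then show "A * (\<Sum>i\<in>S. (cmod (a i))\<^sup>2) \<le> ?I" "?I \<le> B * (\<Sum>i\<in>S. (cmod (a i))\<^sup>2)"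
        using A B nn by (auto simp flip: ennreal_mult)
    qed
    have sA: "sqrt A > 0" and sB: "sqrt B \<ge> 0" using A B by auto
    \<comment> \<open>N counts grid points in the second variable, where the low part of G has
      frequencies of order R; M counts those in the first, where the low part of H has frequencies
      of order L.\<close>
    obtain N where N: "N \<ge> 7" "48 * sqrt B * real (nat \<lfloor>R\<rfloor>) / real N \<le> sqrt A / 8" "real N \<le> c * R"
      using exists_grid_size[OF sA sB R] unfolding c_def .
    obtain M where M: "M \<ge> 7" "48 * sqrt B * real (nat \<lfloor>L\<rfloor>) / real M \<le> sqrt A / 8" "real M \<le> c * L"
      using exists_grid_size[OF sA sB L] unfolding c_def .
    let ?D1 = "\<lambda>z. G z - zak_low (- 1) g' (nat \<lfloor>R\<rfloor>) z"
    let ?D2 = "\<lambda>z. ee (- (fst z * snd z)) * G (snd z, fst z) - zak_low 1 gh' (nat \<lfloor>L\<rfloor>) z"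
    have "nat \<lfloor>R\<rfloor> \<ge> 1" "nat \<lfloor>L\<rfloor> \<ge> 1" using R L by (auto simp: le_nat_iff le_floor_iff)
    then have jump: "1 / (real M * real N) \<le> measure QU {z. d \<le> norm (?D1 z)} + measure QU {z. d \<le> norm (?D2 z)}"
      unfolding d_def by (intro zak_jump_measure[OF A g' gh' G H GAB] N(1,2) M(1,2))
    have RL: "R * L \<ge> 1" using R L mult_mono[of 1 R 1 L] by simp
    show "ennreal (C / (R * L) powr (p - 1)) < ?S1 + ?S2"
    proof (rule ccontr)
      assume "\<not> ennreal (C / (R * L) powr (p - 1)) < ?S1 + ?S2"
      then have le: "?S1 + ?S2 \<le> ennreal (C / (R * L) powr (p - 1))" by simp
      \<comment> \<open>Each sum is compared with the product R L, not with its own cutoff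
        alone.\<close>
      have S1: "?S1 \<le> ennreal (C / (R * L) powr (p - 1))" and S2: "?S2 \<le> ennreal (C / (R * L) powr (p - 1))"
        using le by (auto intro: order.trans[OF _ le])
      note h1 = zak_high[OF one(1) g' G gg' R] and h2 = zak_high[OF one(2) gh' H ghgh' L]
      have "measure QU {z. d \<le> norm (?D1 z)} < 1 / (2 * c\<^sup>2 * (R * L))"
        using h1(4) by (intro tail[unfolded tail_constant_def, rule_format, OF one(1) h1(1-3) _ RL S1]) blast
      moreover have "measure QU {z. d \<le> norm (?D2 z)} < 1 / (2 * c\<^sup>2 * (R * L))"
        using h2(4) by (intro tail[unfolded tail_constant_def, rule_format, OF one(2) h2(1-3) _ RL S2]) blast
      \<comment> \<open>Together the two sets measure less than 1 / (c^2 R L), which is at most 1 /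
        (M N), against the lower bound from the jumps.\<close>
      moreover have "1 / (2 * c\<^sup>2 * (R * L)) + 1 / (2 * c\<^sup>2 * (R * L)) = 1 / ((c * L) * (c * R))"
        by (simp add: power2_eq_square mult_ac)
      moreover have "1 / ((c * L) * (c * R)) \<le> 1 / (real M * real N)"
        using M N c R L by (intro divide_left_mono mult_mono mult_pos_pos) auto
      ultimately show False using jump by linarith
    qed
  qed
qed

end
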